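(* Let $G$ be a locally compact abelian group with a compact open subgroup $H$, and let $A\in\operatorname{Aut}(G)$ be expansive with respect to $H$ and such that $A^*$ is expansive with respect to $H^\perp$. Let $\Lambda\subset G\times\widehat{G}$ be a uniformly separated set and $\varphi\in L^2(G)$. (i) If $S(\varphi,\Lambda)$ is a frame for $L^2(G)$, then $D^-(\Lambda)\ge1$. (ii) If $S(\varphi,\Lambda)$ is a Riesz basis for $L^2(G)$, then $D(\Lambda)=1$ (that is, $D^-(\Lambda)=D^+(\Lambda)=1$).
   Context: Locally compact abelian (LCA) groups are Hausdorff and written additively; $\widehat{G}$ is the Pontryagin dual, $\langle x,\xi\rangle$ denotes the character $\xi$ evaluated at $x$, and $H^\perp=\{\xi\in\widehat{G}:\langle h,\xi\rangle=1\ \forall h\in H\}$. Haar measures are normalized by $m_G(H)=1$, $m_{\widehat{G}}(H^\perp)=1$. $\operatorname{Aut}(G)$ is the group of homeomorphic automorphisms of $G$; the modulus $|A|>0$ of $A\in\operatorname{Aut}(G)$ is defined by $m_G(AU)=|A|\,m_G(U)$ for Borel $U$; the adjoint $A^*\in\operatorname{Aut}(\widehat{G})$ is given by $\langle Ax,\gamma\rangle=\langle x,A^*\gamma\rangle$. $A$ is expansive with respect to a compact open subgroup $H$ if $H\subsetneq AH$ and $\bigcap_{n\le0}A^nH=\{0\}$. For $n\in\mathbb{Z}$ and $(x,\xi)\in G\times\widehat{G}$, $Q_n(x,\xi)=(x+A^nH)\times(\xi+(A^* )^nH^\perp)$. A set $\Lambda\subseteq G\times\widehat{G}$ is uniformly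 separated if there is $n\in\mathbb{Z}$ with $\#\{\Lambda\cap Q_n(x,\xi)\}\le1$ for all $(x,\xi)$. The densities are $$D^+(\Lambda)=\limsup_{n\to+\infty}\frac{1}{|A|^{2n}}\max_{(x,\xi)}\#\{\Lambda\cap Q_n(x,\xi)\},\qquad D^-(\Lambda)=\liminf_{n\to+\infty}\frac{1}{|A|^{2n}}\min_{(x,\xi)}\#\{\Lambda\cap Q_n(x,\xi)\},$$ with $(x,\xi)$ ranging over $G\times\widehat{G}$; if they coincide, the common value is denoted $D(\Lambda)$. Translation and modulation on $L^2(G)$: $T_xf(y)=f(y-x)$, $M_\xi f(y)=\langle y,\xi\rangle f(y)$. The Gabor system is $S(\varphi,\Lambda)=\{M_\xi T_x\varphi\}_{(x,\xi)\in\Lambda}$. A family $\{\varphi_i\}_{i\in I}$ in a Hilbert space $\mathcal{H}$ is a frame if there are $a,b>0$ with $a\|f\|^2\le\sum_{i\in I}|\langle f,\varphi_i\rangle|^2\le b\|f\|^2$ for all $f\in\mathcal{H}$; a Riesz basis is a frame that is biorthogonal to its canonical dual frame $\{S^{-1}\varphi_i\}$, where $Sf=\sum_i\langle f,\varphi_i\rangle\varphi_i$. *)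

theory Defs
  imports "HOL-Analysis.Analysis"
begin

section \<open>The Pontryagin dual of a topological abelian group\<close>

typedef (overloaded) 'a dual =
  "{\<kappa> :: 'a::topological_ab_group_add \<Rightarrow> complex.
      continuous_on UNIV \<kappa> \<and> (\<forall>x y. \<kappa> (x + y) = \<kappa> x * \<kappa> y) \<and> (\<forall>x. cmod (\<kappa> x) = 1)}"
  morphisms char_fun Abs_dual
  by (rule exI[of _ "\<lambda>_. 1"]) auto

setup_lifting type_definition_dual

definition pairing :: "'a::topological_ab_group_add \<Rightarrow> 'a dual \<Rightarrow> complex" where
  "pairing x \<xi> = char_fun \<xi> x"

lemma continuous_on_pairing: "continuous_on S (\<lambda>x. pairing x \<xi>)"
  using char_fun[of \<xi>] unfolding pairing_def by (auto intro: continuous_on_subset)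

lemma pairing_add_left: "pairing (x + y) \<xi> = pairing x \<xi> * pairing y \<xi>"
  using char_fun[of \<xi>] unfolding pairing_def by auto

lemma norm_pairing [simp]: "cmod (pairing x \<xi>) = 1"
  using char_fun[of \<xi>] unfolding pairing_def by auto

lemma dual_eqI: "(\<And>x. pairing x \<xi> = pairing x \<eta>) \<Longrightarrow> \<xi> = \<eta>"
  unfolding pairing_def by (simp add: char_fun_inject[symmetric] fun_eq_iff)

instantiation dual :: (topological_ab_group_add) ab_group_add
begin

lift_definition zero_dual :: "'a dual" is "\<lambda>_. 1" by auto

lift_definition plus_dual :: "'a dual \<Rightarrow> 'a dual \<Rightarrow> 'a dual" is "\<lambda>\<kappa> \<psi> x. \<kappa> x * \<psi> x"
  by (auto intro!: continuous_intros simp: norm_mult)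

lift_definition uminus_dual :: "'a dual \<Rightarrow> 'a dual" is "\<lambda>\<kappa> x. cnj (\<kappa> x)"
  by (auto intro!: continuous_intros)

lift_definition minus_dual :: "'a dual \<Rightarrow> 'a dual \<Rightarrow> 'a dual" is "\<lambda>\<kappa> \<psi> x. \<kappa> x * cnj (\<psi> x)"
  by (auto intro!: continuous_intros simp: norm_mult)

instance
proof
  fix a b c :: "'a dual"
  show "a + b + c = a + (b + c)" by transfer (simp add: mult.assoc)
  show "a + b = b + a" by transfer (simp add: mult.commute)
  show "0 + a = a" by transfer simp
  show "- a + a = 0"
    by transfer (auto simp: fun_eq_iff complex_norm_square[symmetric] mult.commute)
  show "a - b = a + - b" by transfer simp
qed

end

lemma pairing_zero [simp]: "pairing x 0 = 1"
  unfolding pairing_def by transfer simp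

lemma pairing_plus: "pairing x (\<xi> + \<eta>) = pairing x \<xi> * pairing x \<eta>"
  unfolding pairing_def by transfer simp

lemma pairing_uminus: "pairing x (- \<xi>) = cnj (pairing x \<xi>)"
  unfolding pairing_def by transfer simp

text \<open>The dual carries the compact-open topology, i.e. the topology of uniform convergence on
  compact sets.\<close>

definition dual_nbhd ::
    "'a::topological_ab_group_add dual \<Rightarrow> 'a set \<Rightarrow> real \<Rightarrow> 'a dual set" where
  "dual_nbhd \<xi> K e = {\<eta>. \<forall>x\<in>K. cmod (pairing x \<eta> - pairing x \<xi>) < e}"

lemma dual_nbhd_self: "e > 0 \<Longrightarrow> \<xi> \<in> dual_nbhd \<xi> K e"
  by (simp add: dual_nbhd_def)

lemma dual_nbhd_Un: "dual_nbhd \<xi> (K \<union> L) (min d e) \<subseteq> dual_nbhd \<xi> K d \<inter> dual_nbhd \<xi> L e"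
  by (auto simp: dual_nbhd_def)

instantiation dual :: (topological_ab_group_add) topological_space
begin

definition open_dual :: "'a dual set \<Rightarrow> bool" where
  "open_dual U \<longleftrightarrow> (\<forall>\<xi>\<in>U. \<exists>K e. compact K \<and> e > 0 \<and> dual_nbhd \<xi> K e \<subseteq> U)"

instance
proof
  show "open (UNIV :: 'a dual set)"
    unfolding open_dual_def by (auto intro!: exI[of _ "{}"] exI[of _ 1])
next
  fix S T :: "'a dual set"
  assume S: "open S" and T: "open T"
  show "open (S \<inter> T)"
    unfolding open_dual_def
  proof
    fix \<xi> assume "\<xi> \<in> S \<inter> T"
    then have \<xi>: "\<xi> \<in> S" "\<xi> \<in> T" by auto
    from bspec[OF S[unfolded open_dual_def] \<xi>(1)] obtain K d where
      K: "compact K" "d > 0" "dual_nbhd \<xi> K d \<subseteq> S" by blast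
    from bspec[OF T[unfolded open_dual_def] \<xi>(2)] obtain L e where
      L: "compact L" "e > 0" "dual_nbhd \<xi> L e \<subseteq> T" by blast
    have "dual_nbhd \<xi> (K \<union> L) (min d e) \<subseteq> S \<inter> T"
      using dual_nbhd_Un[of \<xi> K L d e] K(3) L(3) by blast
    moreover have "compact (K \<union> L)" "min d e > 0"
      using K L by (auto intro: compact_Un)
    ultimately show "\<exists>K e. compact K \<and> e > 0 \<and> dual_nbhd \<xi> K e \<subseteq> S \<inter> T"
      by blast
  qed
next
  fix \<K> :: "'a dual set set"
  assume op: "\<forall>S\<in>\<K>. open S"
  show "open (\<Union>\<K>)"
    unfolding open_dual_def
  proof
    fix \<xi> assume "\<xi> \<in> \<Union>\<K>"
    then obtain S where S: "S \<in> \<K>" "\<xi> \<in> S" by blast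
    from bspec[OF bspec[OF op S(1), unfolded open_dual_def] S(2)] obtain K e where
      "compact K" "e > 0" "dual_nbhd \<xi> K e \<subseteq> S" by blast
    with S(1) show "\<exists>K e. compact K \<and> e > 0 \<and> dual_nbhd \<xi> K e \<subseteq> \<Union>\<K>" by blast
  qed
qed

end

lemma open_dual_nbhd:
  assumes K: "compact K"
  shows "open (dual_nbhd \<xi> K e)"
  unfolding open_dual_def
proof
  fix \<eta> assume \<eta>: "\<eta> \<in> dual_nbhd \<xi> K e"
  show "\<exists>L d. compact L \<and> d > 0 \<and> dual_nbhd \<eta> L d \<subseteq> dual_nbhd \<xi> K e"
  proof (cases "K = {}")
    case True
    then show ?thesis by (intro exI[of _ "{}"] exI[of _ 1]) (auto simp: dual_nbhd_def)
  next
    case False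
    have "continuous_on K (\<lambda>x. cmod (pairing x \<eta> - pairing x \<xi>))"
      by (intro continuous_intros continuous_on_pairing)
    from continuous_attains_sup[OF K False this] obtain x0 where
      x0: "x0 \<in> K"
        "\<And>x. x \<in> K \<Longrightarrow> cmod (pairing x \<eta> - pairing x \<xi>) \<le> cmod (pairing x0 \<eta> - pairing x0 \<xi>)"
      by blast
    define d where "d = e - cmod (pairing x0 \<eta> - pairing x0 \<xi>)"
    have "d > 0" using \<eta> x0(1) by (simp add: d_def dual_nbhd_def)
    moreover have "dual_nbhd \<eta> K d \<subseteq> dual_nbhd \<xi> K e"
    proof
      fix \<zeta> assume \<zeta>: "\<zeta> \<in> dual_nbhd \<eta> K d"
      have "cmod (pairing x \<zeta> - pairing x \<xi>) < e" if "x \<in> K" for x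
      proof -
        have "cmod (pairing x \<zeta> - pairing x \<xi>)
            \<le> cmod (pairing x \<zeta> - pairing x \<eta>) + cmod (pairing x \<eta> - pairing x \<xi>)"
          using norm_triangle_ineq[of "pairing x \<zeta> - pairing x \<eta>" "pairing x \<eta> - pairing x \<xi>"]
          by simp
        moreover have "cmod (pairing x \<zeta> - pairing x \<eta>) < d"
          using \<zeta> that by (simp add: dual_nbhd_def)
        ultimately show ?thesis using x0(2)[OF that] by (simp add: d_def)
      qed
      then show "\<zeta> \<in> dual_nbhd \<xi> K e" by (simp add: dual_nbhd_def)
    qed
    ultimately show ?thesis using K by blast
  qed
qed

lemma eventually_nhds_dual:
  "eventually P (nhds \<xi>) \<longleftrightarrow> (\<exists>K e. compact K \<and> e > 0 \<and> (\<forall>\<eta>\<in>dual_nbhd \<xi> K e. P \<eta>))"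
proof
  assume "eventually P (nhds \<xi>)"
  then obtain S where S: "open S" "\<xi> \<in> S" "\<forall>\<eta>\<in>S. P \<eta>"
    unfolding eventually_nhds by blast
  from bspec[OF S(1)[unfolded open_dual_def] S(2)] obtain K e where
    "compact K" "e > 0" "dual_nbhd \<xi> K e \<subseteq> S" by blast
  with S(3) show "\<exists>K e. compact K \<and> e > 0 \<and> (\<forall>\<eta>\<in>dual_nbhd \<xi> K e. P \<eta>)" by blast
next
  assume "\<exists>K e. compact K \<and> e > 0 \<and> (\<forall>\<eta>\<in>dual_nbhd \<xi> K e. P \<eta>)"
  then obtain K e where Ke: "compact K" "e > 0" "\<forall>\<eta>\<in>dual_nbhd \<xi> K e. P \<eta>" by blast
  show "eventually P (nhds \<xi>)"
    unfolding eventually_nhds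
    by (intro exI[of _ "dual_nbhd \<xi> K e"] conjI open_dual_nbhd dual_nbhd_self Ke)
qed

lemma filterlim_dualI:
  assumes "\<And>K e. compact K \<Longrightarrow> e > 0 \<Longrightarrow> eventually (\<lambda>z. f z \<in> dual_nbhd \<xi> K e) F"
  shows "filterlim f (nhds \<xi>) F"
  unfolding filterlim_iff
proof (intro allI impI)
  fix P assume "eventually P (nhds \<xi>)"
  then obtain K e where Ke: "compact K" "e > 0" "\<forall>\<eta>\<in>dual_nbhd \<xi> K e. P \<eta>"
    unfolding eventually_nhds_dual by blast
  show "eventually (\<lambda>z. P (f z)) F"
    using assms[OF Ke(1,2)] by (rule eventually_mono) (use Ke(3) in blast)
qed

instance dual :: (topological_ab_group_add) topological_ab_group_add
proof
  fix a b :: "'a dual"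
  show "filterlim (\<lambda>z. fst z + snd z) (nhds (a + b)) (nhds a \<times>\<^sub>F nhds b)"
  proof (rule filterlim_dualI)
    fix K :: "'a set" and e :: real
    assume Ke: "compact K" "e > 0"
    have nb: "eventually (\<lambda>z. z \<in> dual_nbhd a K (e/2)) (nhds a)"
      "eventually (\<lambda>z. z \<in> dual_nbhd b K (e/2)) (nhds b)"
      using Ke by (auto intro!: eventually_nhds_in_open open_dual_nbhd dual_nbhd_self)
    have "eventually (\<lambda>z. fst z \<in> dual_nbhd a K (e/2) \<and> snd z \<in> dual_nbhd b K (e/2))
        (nhds a \<times>\<^sub>F nhds b)"
      unfolding eventually_prod_filter using nb by (auto intro!: exI)
    then show "eventually (\<lambda>z. fst z + snd z \<in> dual_nbhd (a + b) K e) (nhds a \<times>\<^sub>F nhds b)"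
    proof eventually_elim
      case (elim z)
      have "cmod (pairing x (fst z + snd z) - pairing x (a + b)) < e" if x: "x \<in> K" for x
      proof -
        have "pairing x (fst z + snd z) - pairing x (a + b)
            = (pairing x (fst z) - pairing x a) * pairing x (snd z)
              + pairing x a * (pairing x (snd z) - pairing x b)"
          by (simp add: pairing_plus algebra_simps)
        also have "cmod \<dots> \<le> cmod (pairing x (fst z) - pairing x a)
            + cmod (pairing x (snd z) - pairing x b)"
          by (rule order_trans[OF norm_triangle_ineq]) (simp add: norm_mult)
        also have "\<dots> < e"
          using elim x unfolding dual_nbhd_def by fastforce
        finally show ?thesis .
      qed
      then show ?case by (simp add: dual_nbhd_def)
    qed
  qed
  show "filterlim uminus (nhds (- a)) (nhds a)"
  proof (rule filterlim_dualI)
    fix K :: "'a set" and e :: real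
    assume Ke: "compact K" "e > 0"
    have "cmod (pairing x (- \<eta>) - pairing x (- a)) = cmod (pairing x \<eta> - pairing x a)" for x \<eta>
      by (simp add: pairing_uminus flip: complex_cnj_diff)
    then show "eventually (\<lambda>\<eta>. - \<eta> \<in> dual_nbhd (- a) K e) (nhds a)"
      unfolding eventually_nhds_dual using Ke
      by (intro exI[of _ K] exI[of _ e]) (auto simp: dual_nbhd_def)
  qed
qed

instance dual :: (topological_ab_group_add) t2_space
proof
  fix \<xi> \<eta> :: "'a dual"
  assume "\<xi> \<noteq> \<eta>"
  then obtain x where x: "pairing x \<xi> \<noteq> pairing x \<eta>" using dual_eqI by blast
  define e where "e = cmod (pairing x \<xi> - pairing x \<eta>) / 2"
  have e: "e > 0" using x by (simp add: e_def)
  have False if "\<zeta> \<in> dual_nbhd \<xi> {x} e" "\<zeta> \<in> dual_nbhd \<eta> {x} e" for \<zeta>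
  proof -
    have "cmod (pairing x \<xi> - pairing x \<eta>)
        \<le> cmod (pairing x \<zeta> - pairing x \<xi>) + cmod (pairing x \<zeta> - pairing x \<eta>)"
      using norm_triangle_ineq4[of "pairing x \<zeta> - pairing x \<eta>" "pairing x \<zeta> - pairing x \<xi>"]
      by simp
    with that show False by (simp add: dual_nbhd_def e_def)
  qed
  then show "\<exists>U V. open U \<and> open V \<and> \<xi> \<in> U \<and> \<eta> \<in> V \<and> U \<inter> V = {}"
    using e by (intro exI[of _ "dual_nbhd \<xi> {x} e"] exI[of _ "dual_nbhd \<eta> {x} e"])
      (auto intro: open_dual_nbhd dual_nbhd_self)
qed

section \<open>Subgroups and expansive automorphisms\<close>

definition add_subgroup :: "'a::ab_group_add set \<Rightarrow> bool" where
  "add_subgroup H \<longleftrightarrow> 0 \<in> H \<and> (\<forall>x\<in>H. \<forall>y\<in>H. x + y \<in> H) \<and> (\<forall>x\<in>H. - x \<in> H)"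

definition annihilator :: "'a::topological_ab_group_add set \<Rightarrow> 'a dual set" where
  "annihilator H = {\<xi>. \<forall>h\<in>H. pairing h \<xi> = 1}"

definition top_automorphism :: "('a::topological_ab_group_add \<Rightarrow> 'a) \<Rightarrow> bool" where
  "top_automorphism A \<longleftrightarrow> Modules.additive A \<and> homeomorphism UNIV UNIV A (inv A)"

definition aut_pow :: "('a \<Rightarrow> 'a) \<Rightarrow> int \<Rightarrow> 'a \<Rightarrow> 'a" where
  "aut_pow A n = (if n \<ge> 0 then A ^^ nat n else inv A ^^ nat (- n))"

definition dual_adjoint ::
    "('a::topological_ab_group_add \<Rightarrow> 'a) \<Rightarrow> 'a dual \<Rightarrow> 'a dual" where
  "dual_adjoint A \<gamma> = (THE \<delta>. \<forall>x. pairing x \<delta> = pairing (A x) \<gamma>)"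

lemma pairing_dual_adjoint:
  assumes "top_automorphism A"
  shows "pairing x (dual_adjoint A \<gamma>) = pairing (A x) \<gamma>"
proof -
  have A: "continuous_on UNIV A" "\<And>x y. A (x + y) = A x + A y"
    using assms unfolding top_automorphism_def homeomorphism_def Modules.additive_def by blast+
  have "continuous_on UNIV (\<lambda>x. pairing (A x) \<gamma>)"
    by (rule continuous_on_compose2[OF continuous_on_pairing[of UNIV \<gamma>] A(1)]) simp
  then have "char_fun (Abs_dual (\<lambda>x. pairing (A x) \<gamma>)) = (\<lambda>x. pairing (A x) \<gamma>)"
    by (intro Abs_dual_inverse) (simp add: A(2) pairing_add_left)
  then have ex: "\<forall>x. pairing x (Abs_dual (\<lambda>x. pairing (A x) \<gamma>)) = pairing (A x) \<gamma>"
    by (simp add: pairing_def fun_eq_iff)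
  have "\<forall>x. pairing x (dual_adjoint A \<gamma>) = pairing (A x) \<gamma>"
    unfolding dual_adjoint_def
    by (rule theI[where a = "Abs_dual (\<lambda>x. pairing (A x) \<gamma>)"], rule ex) (rule dual_eqI, simp add: ex)
  then show ?thesis by blast
qed

definition expansive ::
    "('a::topological_ab_group_add \<Rightarrow> 'a) \<Rightarrow> 'a set \<Rightarrow> bool" where
  "expansive A H \<longleftrightarrow> H \<subset> A ` H \<and> (\<Inter>n\<in>{..0}. aut_pow A n ` H) = {0}"

section \<open>Haar measure and modulus\<close>

definition haar_measure :: "'a::{t2_space, topological_ab_group_add} measure \<Rightarrow> bool" where
  "haar_measure m \<longleftrightarrow>
     sets m = sets borel \<and>
     emeasure m UNIV \<noteq> 0 \<and>
     (\<forall>x. \<forall>B\<in>sets borel. emeasure m ((+) x ` B) = emeasure m B) \<and>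
     (\<forall>K. compact K \<longrightarrow> emeasure m K < \<infinity>) \<and>
     (\<forall>B\<in>sets borel. emeasure m B = (INF U\<in>{U. open U \<and> B \<subseteq> U}. emeasure m U)) \<and>
     (\<forall>U. open U \<longrightarrow> emeasure m U = (SUP K\<in>{K. compact K \<and> K \<subseteq> U}. emeasure m K))"

definition modulus :: "'a::topological_space measure \<Rightarrow> ('a \<Rightarrow> 'a) \<Rightarrow> real" where
  "modulus m A =
     (THE c. c > 0 \<and> (\<forall>U\<in>sets borel. emeasure m (A ` U) = ennreal c * emeasure m U))"

section \<open>Boxes, separation and densities\<close>

definition box_Q ::
    "('a::topological_ab_group_add \<Rightarrow> 'a) \<Rightarrow> 'a set \<Rightarrow> int \<Rightarrow> 'a \<times> 'a dual \<Rightarrow> ('a \<times> 'a dual) set" where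
  "box_Q A H n = (\<lambda>(x, \<xi>).
     (+) x ` (aut_pow A n ` H) \<times> (+) \<xi> ` (aut_pow (dual_adjoint A) n ` annihilator H))"

text \<open>Cardinalities are taken in \<^typ>\<open>ennreal\<close>, because \<^const>\<open>card\<close> is 0 on infinite sets.\<close>

definition num_points :: "'b set \<Rightarrow> ennreal" where
  "num_points X = emeasure (count_space UNIV) X"

definition uniformly_separated ::
    "('a::topological_ab_group_add \<Rightarrow> 'a) \<Rightarrow> 'a set \<Rightarrow> ('a \<times> 'a dual) set \<Rightarrow> bool" where
  "uniformly_separated A H \<Lambda> \<longleftrightarrow> (\<exists>n. \<forall>p. num_points (\<Lambda> \<inter> box_Q A H n p) \<le> 1)"

text \<open>The values of \<^const>\<open>num_points\<close> are natural numbers or infinity, so the infimum below is a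
  minimum, and the supremum is a maximum unless the counts are finite and unbounded; they are
  bounded for uniformly separated sets.\<close>

definition upper_density ::
    "'a::topological_ab_group_add measure \<Rightarrow> ('a \<Rightarrow> 'a) \<Rightarrow> 'a set \<Rightarrow> ('a \<times> 'a dual) set \<Rightarrow> ennreal" where
  "upper_density m A H \<Lambda> = limsup (\<lambda>n.
     (SUP p. num_points (\<Lambda> \<inter> box_Q A H (int n) p)) / ennreal (modulus m A ^ (2 * n)))"

definition lower_density ::
    "'a::topological_ab_group_add measure \<Rightarrow> ('a \<Rightarrow> 'a) \<Rightarrow> 'a set \<Rightarrow> ('a \<times> 'a dual) set \<Rightarrow> ennreal" where
  "lower_density m A H \<Lambda> = liminf (\<lambda>n.
     (INF p. num_points (\<Lambda> \<inter> box_Q A H (int n) p)) / ennreal (modulus m A ^ (2 * n)))"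

section \<open>Frames and Riesz bases in $L^2$\<close>

text \<open>Elements of $L^2$ are represented by square-integrable functions; all notions below depend
  on these only up to equality almost everywhere.\<close>

definition L2 :: "'a measure \<Rightarrow> ('a \<Rightarrow> complex) set" where
  "L2 m = {f \<in> borel_measurable m. integrable m (\<lambda>x. (cmod (f x))\<^sup>2)}"

definition L2_inner :: "'a measure \<Rightarrow> ('a \<Rightarrow> complex) \<Rightarrow> ('a \<Rightarrow> complex) \<Rightarrow> complex" where
  "L2_inner m f g = (LINT x|m. f x * cnj (g x))"

definition L2_norm :: "'a measure \<Rightarrow> ('a \<Rightarrow> complex) \<Rightarrow> real" where
  "L2_norm m f = sqrt (LINT x|m. (cmod (f x))\<^sup>2)"

definition L2_has_sum ::
    "'a measure \<Rightarrow> ('i \<Rightarrow> 'a \<Rightarrow> complex) \<Rightarrow> 'i set \<Rightarrow> ('a \<Rightarrow> complex) \<Rightarrow> bool" where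
  "L2_has_sum m g I s \<longleftrightarrow>
     ((\<lambda>F. L2_norm m (\<lambda>x. (\<Sum>i\<in>F. g i x) - s x)) \<longlongrightarrow> 0) (finite_subsets_at_top I)"

definition L2_frame :: "'a measure \<Rightarrow> 'i set \<Rightarrow> ('i \<Rightarrow> 'a \<Rightarrow> complex) \<Rightarrow> bool" where
  "L2_frame m I \<phi> \<longleftrightarrow>
     (\<forall>i\<in>I. \<phi> i \<in> L2 m) \<and>
     (\<exists>a b. a > 0 \<and> b > 0 \<and>
        (\<forall>f\<in>L2 m. (\<lambda>i. (cmod (L2_inner m f (\<phi> i)))\<^sup>2) summable_on I \<and>
           a * (L2_norm m f)\<^sup>2 \<le> (\<Sum>\<^sub>\<infinity>i\<in>I. (cmod (L2_inner m f (\<phi> i)))\<^sup>2) \<and>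
           (\<Sum>\<^sub>\<infinity>i\<in>I. (cmod (L2_inner m f (\<phi> i)))\<^sup>2) \<le> b * (L2_norm m f)\<^sup>2))"

text \<open>\<open>frame_operator_maps m I \<phi> f h\<close> states that \<open>S f = h\<close> in $L^2$, where \<open>S\<close> is the frame operator
  of \<open>\<phi>\<close>; it is a relation because \<open>h\<close> is determined only almost everywhere.\<close>

definition frame_operator_maps ::
    "'a measure \<Rightarrow> 'i set \<Rightarrow> ('i \<Rightarrow> 'a \<Rightarrow> complex) \<Rightarrow> ('a \<Rightarrow> complex) \<Rightarrow> ('a \<Rightarrow> complex) \<Rightarrow> bool" where
  "frame_operator_maps m I \<phi> f h \<longleftrightarrow>
     f \<in> L2 m \<and> h \<in> L2 m \<and> L2_has_sum m (\<lambda>i x. L2_inner m f (\<phi> i) * \<phi> i x) I h"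

definition canonical_dual_frame ::
    "'a measure \<Rightarrow> 'i set \<Rightarrow> ('i \<Rightarrow> 'a \<Rightarrow> complex) \<Rightarrow> ('i \<Rightarrow> 'a \<Rightarrow> complex) \<Rightarrow> bool" where
  "canonical_dual_frame m I \<phi> \<psi> \<longleftrightarrow> (\<forall>i\<in>I. frame_operator_maps m I \<phi> (\<psi> i) (\<phi> i))"

text \<open>The frame operator of a frame is invertible, so the family \<open>\<psi>\<close> exists and is unique almost
  everywhere.\<close>

definition L2_riesz_basis :: "'a measure \<Rightarrow> 'i set \<Rightarrow> ('i \<Rightarrow> 'a \<Rightarrow> complex) \<Rightarrow> bool" where
  "L2_riesz_basis m I \<phi> \<longleftrightarrow>
     L2_frame m I \<phi> \<and>
     (\<exists>\<psi>. canonical_dual_frame m I \<phi> \<psi> \<and>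
        (\<forall>i\<in>I. \<forall>j\<in>I. L2_inner m (\<phi> i) (\<psi> j) = (if i = j then 1 else 0)))"

section \<open>Gabor systems\<close>

definition translation :: "'a::ab_group_add \<Rightarrow> ('a \<Rightarrow> complex) \<Rightarrow> 'a \<Rightarrow> complex" where
  "translation x f = (\<lambda>y. f (y - x))"

definition modulation ::
    "'a::topological_ab_group_add dual \<Rightarrow> ('a \<Rightarrow> complex) \<Rightarrow> 'a \<Rightarrow> complex" where
  "modulation \<xi> f = (\<lambda>y. pairing y \<xi> * f y)"

text \<open>The Gabor system $S(\varphi,\Lambda)$ is the family \<open>gabor \<phi>\<close> indexed by \<open>\<Lambda>\<close>.\<close>

definition gabor ::
    "('a::topological_ab_group_add \<Rightarrow> complex) \<Rightarrow> 'a \<times> 'a dual \<Rightarrow> 'a \<Rightarrow> complex" where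
  "gabor \<phi> = (\<lambda>(x, \<xi>). modulation \<xi> (translation x \<phi>))"

end

theory Submission
  imports Defs
begin

text \<open>Write \<open>K n = A\<^sup>n H\<close> and \<open>Q n = K n \<times> (A\<^sup>*)\<^sup>n H\<^sup>\<bottom>\<close>, let \<open>q = [A H : H]\<close>, and let \<open>\<pi>(p)\<close> be the
  time-frequency shift by \<open>p\<close>. The boxes are the cosets of the increasing subgroups \<open>Q n\<close>. Hence the
  translate of \<open>Q k\<close> around any point of a translate of \<open>Q n\<close> with \<open>n \<ge> k\<close> stays inside it, and there
  are no boundary terms. Both inequalities compare the number \<open>N\<close> of points of \<open>\<Lambda>\<close> in a translate of
  \<open>Q n\<close> with the dimension \<open>D = q\<^sup>2\<^sup>n\<close> of the space of functions concentrated on it. In both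
  cases a positive quadratic form, bounded below by the frame or Riesz inequality, is restricted to the
  kernel of a system of linear equations, and its trace there is estimated
  (\<open>orthonormal_kernel_family\<close>).

  For a frame with lower bound \<open>a\<close>, consider the vectors in the span of the \<open>D\<close> orthonormal functions
  \<open>\<pi>(\<mu>) 1\<^sub>H\<close> (\<open>\<mu>\<close> in the box, modulo \<open>Q 0\<close>) that are orthogonal to the \<open>N\<close> functions \<open>\<pi>(\<lambda>) \<phi>\<close> with \<open>\<lambda>\<close> in
  the box. For them the frame inequality only sees the \<open>\<lambda>\<close> outside the box. As \<open>\<Lambda>\<close> is uniformly
  separated, the total contribution of these \<open>\<lambda>\<close> at a single \<open>\<mu>\<close> is at most \<open>e\<close>, uniformly in \<open>\<mu>\<close>
  (\<open>gabor_tail\<close>). Hence \<open>a (D - N) \<le> e D\<close> (\<open>frame_count\<close>), and the lower density is at least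
  \<open>1 - e / a\<close>.

  For a Riesz basis, the mirror image works. Approximate \<open>\<phi>\<close> in \<open>L\<^sup>2\<close> by a step function \<open>v\<close>
  (\<open>L2_approximable\<close>). The \<open>N\<close> functions \<open>\<pi>(\<lambda>) v\<close> lie in a space of dimension \<open>D\<close>, so there is an at
  least \<open>(N - D)\<close>-dimensional space of coefficients \<open>u\<close> with \<open>\<Sum> u\<^sub>\<lambda> \<pi>(\<lambda>) v = 0\<close>. For these the lower
  Riesz bound (\<open>riesz_lower_bound\<close>) only sees the functions \<open>\<pi>(\<lambda>) (\<phi> - v)\<close> of squared norm below \<open>e\<close>,
  and \<open>a (N - D) \<le> e N\<close> (\<open>riesz_count\<close>).

  Two facts about the group are needed. The subgroups \<open>K n\<close> exhaust the group and a box has exactly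
  \<open>q\<^sup>2\<^sup>n\<close> cosets of \<open>Q 0\<close>; both rest on the separation of points by characters
  (\<open>annihilator_separates\<close>, from Zorn's lemma), through expansiveness of \<open>A\<^sup>*\<close> and through counting the
  characters of a finite quotient (\<open>annihilator_transversal_card\<close>). The modulus of \<open>A\<close> equals \<open>q\<close>
  because the cosets of the \<open>K n\<close> generate the Borel sets (\<open>emeasure_image\<close>).\<close>

section \<open>Homogeneous linear systems\<close>

text \<open>Gaussian elimination: one equation with a nonzero coefficient eliminates one unknown.\<close>
lemma nontrivial_solution:
  fixes b :: "'i \<Rightarrow> 'j \<Rightarrow> complex"
  assumes "finite J" "finite I" "card J < card I"
  shows "\<exists>u. (\<exists>i\<in>I. u i \<noteq> 0) \<and> (\<forall>y\<in>J. (\<Sum>i\<in>I. u i * b i y) = 0)"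
  using assms
proof (induction J arbitrary: I b rule: finite_induct)
  case empty
  then have "I \<noteq> {}" by auto
  then show ?case by (intro exI[of _ "\<lambda>_. 1"]) auto
next
  case (insert y J)
  show ?case
  proof (cases "\<forall>i\<in>I. b i y = 0")
    case True
    have "card J < card I" using insert by auto
    from insert.IH[OF insert.prems(1) this, of b] obtain u where
      "\<exists>i\<in>I. u i \<noteq> 0" "\<forall>y\<in>J. (\<Sum>i\<in>I. u i * b i y) = 0" by blast
    with True show ?thesis by (intro exI[of _ u]) auto
  next
    case False
    then obtain k where k: "k \<in> I" "b k y \<noteq> 0" by blast
    define I' where "I' = I - {k}"
    have I: "I = insert k I'" "k \<notin> I'" "finite I'" using k insert.prems by (auto simp: I'_def)
    have "card J < card I'"
      using insert.prems(2) insert.hyps I by simp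
    from insert.IH[OF I(3) this, of "\<lambda>i z. b i z - b i y / b k y * b k z"] obtain u where u:
      "\<exists>i\<in>I'. u i \<noteq> 0" "\<And>z. z \<in> J \<Longrightarrow> (\<Sum>i\<in>I'. u i * (b i z - b i y / b k y * b k z)) = 0"
      by blast
    define s where "s = (\<Sum>i\<in>I'. u i * b i y)"
    define v where "v = u(k := - s / b k y)"
    have v: "(\<Sum>i\<in>I. v i * b i z) = - s / b k y * b k z + (\<Sum>i\<in>I'. u i * b i z)" for z
    proof -
      have "(\<Sum>i\<in>I'. v i * b i z) = (\<Sum>i\<in>I'. u i * b i z)"
        using I(2) by (intro sum.cong) (auto simp: v_def)
      then show ?thesis using I by (simp add: v_def)
    qed
    have "(\<Sum>i\<in>I. v i * b i y) = 0" using k by (simp add: v s_def)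
    moreover have "(\<Sum>i\<in>I. v i * b i z) = 0" if "z \<in> J" for z
    proof -
      have "(\<Sum>i\<in>I'. u i * b i z) - s / b k y * b k z
          = (\<Sum>i\<in>I'. u i * (b i z - b i y / b k y * b k z))"
        by (simp add: s_def right_diff_distrib sum_subtractf sum_divide_distrib sum_distrib_right
            sum_distrib_left mult.assoc)
      then show ?thesis using u(2)[OF that] by (simp add: v)
    qed
    moreover have "\<exists>i\<in>I. v i \<noteq> 0" using u(1) I by (auto simp: v_def)
    ultimately show ?thesis by (intro exI[of _ v]) auto
  qed
qed

section \<open>Square-integrable functions\<close>

lemma L2_finite_count_space:
  "finite I \<Longrightarrow> f \<in> L2 (count_space I)"
  by (auto simp: L2_def integrable_count_space)

lemma L2_measurable: "f \<in> L2 m \<Longrightarrow> f \<in> borel_measurable m"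
  by (simp add: L2_def)

lemma L2_square_integrable: "f \<in> L2 m \<Longrightarrow> integrable m (\<lambda>x. (cmod (f x))\<^sup>2)"
  by (simp add: L2_def)

lemma norm_sum_squared_le: "(cmod (z + w))\<^sup>2 \<le> 2 * (cmod z)\<^sup>2 + 2 * (cmod w)\<^sup>2"
proof -
  have "(cmod (z + w))\<^sup>2 \<le> (cmod z + cmod w)\<^sup>2"
    by (intro power_mono norm_triangle_ineq) auto
  also have "\<dots> \<le> 2 * (cmod z)\<^sup>2 + 2 * (cmod w)\<^sup>2"
    using zero_le_power2[of "cmod z - cmod w"] by (simp add: power2_eq_square algebra_simps)
  finally show ?thesis .
qed

lemma L2_add: "f \<in> L2 m \<Longrightarrow> g \<in> L2 m \<Longrightarrow> (\<lambda>x. f x + g x) \<in> L2 m"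
proof -
  assume f: "f \<in> L2 m" and g: "g \<in> L2 m"
  have meas: "(\<lambda>x. f x + g x) \<in> borel_measurable m" using f g by (auto simp: L2_def)
  have "integrable m (\<lambda>x. (cmod (f x + g x))\<^sup>2)"
  proof (rule Bochner_Integration.integrable_bound)
    show "integrable m (\<lambda>x. 2 * (cmod (f x))\<^sup>2 + 2 * (cmod (g x))\<^sup>2)"
      using f g by (auto simp: L2_def)
    show "AE x in m. norm ((cmod (f x + g x))\<^sup>2) \<le> norm (2 * (cmod (f x))\<^sup>2 + 2 * (cmod (g x))\<^sup>2)"
      using norm_sum_squared_le by (intro AE_I2) auto
  qed (use meas in measurable)
  with meas show ?thesis by (simp add: L2_def)
qed

lemma L2_scale: "f \<in> L2 m \<Longrightarrow> (\<lambda>x. c * f x) \<in> L2 m"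
  by (auto simp: L2_def norm_mult power_mult_distrib)

lemma L2_zero: "(\<lambda>x. 0) \<in> L2 m"
  by (simp add: L2_def)

lemma L2_sum: "(\<And>i. i \<in> I \<Longrightarrow> f i \<in> L2 m) \<Longrightarrow> (\<lambda>x. \<Sum>i\<in>I. f i x) \<in> L2 m"
  by (induction I rule: infinite_finite_induct) (auto simp: L2_zero intro: L2_add)

lemma L2_diff: "f \<in> L2 m \<Longrightarrow> g \<in> L2 m \<Longrightarrow> (\<lambda>x. f x - g x) \<in> L2 m"
  using L2_add[of f m "\<lambda>x. -1 * g x"] L2_scale[of g m "-1"] by simp

lemma integrable_L2_product:
  assumes "f \<in> L2 m" "g \<in> L2 m"
  shows "integrable m (\<lambda>x. f x * cnj (g x))"
proof (rule Bochner_Integration.integrable_bound)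
  show "integrable m (\<lambda>x. (cmod (f x))\<^sup>2 + (cmod (g x))\<^sup>2)"
    using assms by (auto simp: L2_def)
  have "cnj \<in> borel_measurable borel"
    by (intro borel_measurable_continuous_onI continuous_intros)
  with assms show "(\<lambda>x. f x * cnj (g x)) \<in> borel_measurable m"
    by (auto simp: L2_def intro!: borel_measurable_times measurable_compose[of g m borel cnj])
  show "AE x in m. norm (f x * cnj (g x)) \<le> norm ((cmod (f x))\<^sup>2 + (cmod (g x))\<^sup>2)"
  proof (rule AE_I2)
    fix x
    have "0 \<le> (cmod (f x) - cmod (g x))\<^sup>2" "0 \<le> cmod (f x) * cmod (g x)" by auto
    then have "cmod (f x) * cmod (g x) \<le> (cmod (f x))\<^sup>2 + (cmod (g x))\<^sup>2"
      unfolding power2_diff by linarith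
    then show "norm (f x * cnj (g x)) \<le> norm ((cmod (f x))\<^sup>2 + (cmod (g x))\<^sup>2)"
      by (simp add: norm_mult)
  qed
qed

lemma L2_inner_cnj: "L2_inner m g f = cnj (L2_inner m f g)"
proof -
  have "L2_inner m g f = (LINT x|m. cnj (f x * cnj (g x)))"
    unfolding L2_inner_def by (simp add: mult.commute)
  then show ?thesis unfolding L2_inner_def by (simp only: Bochner_Integration.integral_cnj)
qed

lemma L2_inner_sum_left:
  assumes "finite I" "\<And>i. i \<in> I \<Longrightarrow> f i \<in> L2 m" "g \<in> L2 m"
  shows "L2_inner m (\<lambda>x. \<Sum>i\<in>I. c i * f i x) g = (\<Sum>i\<in>I. c i * L2_inner m (f i) g)"
proof -
  have "L2_inner m (\<lambda>x. \<Sum>i\<in>I. c i * f i x) g = (LINT x|m. (\<Sum>i\<in>I. c i * (f i x * cnj (g x))))"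
    unfolding L2_inner_def by (simp add: sum_distrib_right mult.assoc)
  also have "\<dots> = (\<Sum>i\<in>I. c i * L2_inner m (f i) g)"
    unfolding L2_inner_def using assms
    by (subst Bochner_Integration.integral_sum) (auto intro!: integrable_L2_product)
  finally show ?thesis .
qed

lemma L2_inner_diff_left:
  assumes "f \<in> L2 m" "f' \<in> L2 m" "g \<in> L2 m"
  shows "L2_inner m (\<lambda>x. f x - f' x) g = L2_inner m f g - L2_inner m f' g"
  unfolding L2_inner_def
  using assms by (simp add: left_diff_distrib integrable_L2_product)

lemma L2_inner_sum_right:
  assumes "finite I" "\<And>i. i \<in> I \<Longrightarrow> f i \<in> L2 m" "g \<in> L2 m"
  shows "L2_inner m g (\<lambda>x. \<Sum>i\<in>I. c i * f i x) = (\<Sum>i\<in>I. cnj (c i) * L2_inner m g (f i))"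
proof -
  have "L2_inner m g (\<lambda>x. \<Sum>i\<in>I. c i * f i x) = cnj (\<Sum>i\<in>I. c i * L2_inner m (f i) g)"
    using L2_inner_sum_left[of I f m g c] assms L2_inner_cnj[of m g] by metis
  also have "\<dots> = (\<Sum>i\<in>I. cnj (c i) * L2_inner m g (f i))"
    unfolding cnj_sum complex_cnj_mult using L2_inner_cnj[of m g] by (intro sum.cong refl) metis
  finally show ?thesis .
qed

lemma L2_inner_diff_right:
  assumes "f \<in> L2 m" "f' \<in> L2 m" "g \<in> L2 m"
  shows "L2_inner m g (\<lambda>x. f x - f' x) = L2_inner m g f - L2_inner m g f'"
  unfolding L2_inner_def
  using assms by (simp add: right_diff_distrib integrable_L2_product)

lemma L2_inner_self: "L2_inner m f f = of_real (LINT x|m. (cmod (f x))\<^sup>2)"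
  unfolding L2_inner_def by (simp add: complex_norm_square[symmetric] del: of_real_power)

lemma L2_norm_squared: "(L2_norm m f)\<^sup>2 = (LINT x|m. (cmod (f x))\<^sup>2)"
  unfolding L2_norm_def by simp

text \<open>The right-hand side minus the left-hand side is the squared distance of \<open>f\<close> to the span of
  the family.\<close>
lemma L2_bessel:
  assumes F: "finite F" and e: "\<And>j. j \<in> F \<Longrightarrow> e j \<in> L2 m"
    and orth: "\<And>j k. j \<in> F \<Longrightarrow> k \<in> F \<Longrightarrow> L2_inner m (e j) (e k) = (if j = k then 1 else 0)"
    and f: "f \<in> L2 m"
  shows "(\<Sum>j\<in>F. (cmod (L2_inner m f (e j)))\<^sup>2) \<le> (LINT x|m. (cmod (f x))\<^sup>2)"
proof -
  define c where "c j = L2_inner m f (e j)" for j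
  define p where "p = (\<lambda>x. \<Sum>j\<in>F. c j * e j x)"
  have p: "p \<in> L2 m" unfolding p_def using e by (intro L2_sum L2_scale)
  define r where "r = (\<lambda>x. f x - p x)"
  have r: "r \<in> L2 m" unfolding r_def using f p by (rule L2_diff)
  have re: "L2_inner m r (e k) = 0" if "k \<in> F" for k
  proof -
    have "L2_inner m p (e k) = (\<Sum>j\<in>F. c j * L2_inner m (e j) (e k))"
      unfolding p_def using F e that by (intro L2_inner_sum_left) auto
    also have "\<dots> = (\<Sum>j\<in>F. if j = k then c j else 0)"
      using orth that by (intro sum.cong) auto
    also have "\<dots> = c k" using F that by simp
    finally show ?thesis
      unfolding r_def using L2_inner_diff_left[OF f p e[OF that]] by (simp add: c_def)
  qed
  have "L2_inner m r r = L2_inner m r f - L2_inner m r p"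
    using L2_inner_diff_right[OF f p r] unfolding r_def[symmetric] .
  also have "L2_inner m r p = 0"
    unfolding p_def using F e r re by (subst L2_inner_sum_right) auto
  also have "L2_inner m r f = L2_inner m f f - L2_inner m p f"
    unfolding r_def using f p by (intro L2_inner_diff_left)
  also have "L2_inner m p f = (\<Sum>j\<in>F. c j * cnj (c j))"
    unfolding p_def c_def using F e f
    by (subst L2_inner_sum_left) (auto simp: L2_inner_cnj[of m _ f])
  also have "\<dots> = of_real (\<Sum>j\<in>F. (cmod (c j))\<^sup>2)"
    by (simp add: complex_norm_square[symmetric] del: of_real_power)
  finally have "complex_of_real (LINT x|m. (cmod (r x))\<^sup>2)
      = of_real ((LINT x|m. (cmod (f x))\<^sup>2) - (\<Sum>j\<in>F. (cmod (c j))\<^sup>2))"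
    unfolding L2_inner_self by simp
  then have "(LINT x|m. (cmod (r x))\<^sup>2) = (LINT x|m. (cmod (f x))\<^sup>2) - (\<Sum>j\<in>F. (cmod (c j))\<^sup>2)"
    by (simp only: of_real_eq_iff)
  moreover have "0 \<le> (LINT x|m. (cmod (r x))\<^sup>2)" by simp
  ultimately show ?thesis by (simp add: c_def)
qed

lemma L2_cauchy_schwarz:
  assumes f: "f \<in> L2 m" and h: "h \<in> L2 m"
  shows "(cmod (L2_inner m f h))\<^sup>2 \<le> (LINT x|m. (cmod (f x))\<^sup>2) * (LINT x|m. (cmod (h x))\<^sup>2)"
proof (cases "(LINT x|m. (cmod (h x))\<^sup>2) = 0")
  case True
  then have "AE x in m. (cmod (h x))\<^sup>2 = 0"
    using integral_nonneg_eq_0_iff_AE[OF L2_square_integrable[OF h]] by auto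
  then have "L2_inner m f h = 0"
    unfolding L2_inner_def by (intro integral_eq_zero_AE) auto
  then show ?thesis using True by simp
next
  case False
  define s where "s = (LINT x|m. (cmod (h x))\<^sup>2)"
  have s: "s > 0" using False unfolding s_def
    by (simp add: order_less_le)
  define e where "e = (\<lambda>x. complex_of_real (1 / sqrt s) * h x)"
  have e: "e \<in> L2 m" unfolding e_def by (intro L2_scale h)
  have fe: "L2_inner m f e = of_real (1 / sqrt s) * L2_inner m f h"
    unfolding L2_inner_def e_def by (simp add: mult.left_commute[of "f _"])
  have ee: "L2_inner m e e = 1"
  proof -
    have "(LINT x|m. (cmod (e x))\<^sup>2) = (1 / s) * s"
      using s unfolding e_def by (simp add: norm_mult power_mult_distrib norm_divide power_divide s_def[symmetric])
    then show ?thesis unfolding L2_inner_self using s by simp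
  qed
  from L2_bessel[of "{()}" "\<lambda>_. e" m f] have "(cmod (L2_inner m f e))\<^sup>2 \<le> (LINT x|m. (cmod (f x))\<^sup>2)"
    using e ee f by simp
  then show ?thesis
    unfolding fe using s by (simp add: norm_mult norm_divide power_mult_distrib power_divide s_def[symmetric] field_simps)
qed

text \<open>A system of \<open>card J\<close> homogeneous equations in \<open>card I\<close> unknowns has \<open>card I - card J\<close>
  orthonormal solutions; each new one solves a system enlarged by the orthogonality to the previous
  ones. The truncated subtraction makes the claim empty if there are at least as many equations as
  unknowns. The last clause is Bessel's inequality for the conjugate vectors in the space of functions
  on \<open>I\<close>, that is, in \<open>L2 (count_space I)\<close>. It bounds the trace of a positive form on the kernel by
  its trace on the whole space, which is how dimensions are compared below.\<close>
lemma orthonormal_kernel_family: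
  fixes b :: "'i \<Rightarrow> 'j \<Rightarrow> complex"
  assumes I: "finite I" and J: "finite J"
  obtains u :: "nat \<Rightarrow> 'i \<Rightarrow> complex" where
    "\<And>j. j < card I - card J \<Longrightarrow> (\<Sum>i\<in>I. (cmod (u j i))\<^sup>2) = 1"
    "\<And>j y. j < card I - card J \<Longrightarrow> y \<in> J \<Longrightarrow> (\<Sum>i\<in>I. u j i * b i y) = 0"
    "\<And>w. (\<Sum>j<card I - card J. (cmod (\<Sum>i\<in>I. u j i * w i))\<^sup>2) \<le> (\<Sum>i\<in>I. (cmod (w i))\<^sup>2)"
proof -
  have ex: "\<exists>u. (\<forall>j<r. \<forall>k<r. (\<Sum>i\<in>I. u j i * cnj (u k i)) = (if j = k then 1 else 0)) \<and>
        (\<forall>j<r. \<forall>y\<in>J. (\<Sum>i\<in>I. u j i * b i y) = 0)" if "r \<le> card I - card J" for r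
    using that
  proof (induction r)
    case 0
    then show ?case by simp
  next
    case (Suc r)
    then obtain u where u1: "\<And>j k. j < r \<Longrightarrow> k < r \<Longrightarrow>
        (\<Sum>i\<in>I. u j i * cnj (u k i)) = (if j = k then 1 else 0)"
      and u2: "\<And>j y. j < r \<Longrightarrow> y \<in> J \<Longrightarrow> (\<Sum>i\<in>I. u j i * b i y) = 0"
      by (metis Suc_leD)
    let ?J = "J <+> {..<r}"
    have "card ?J < card I" using Suc.prems J by (simp add: card_Plus)
    then obtain v where v0: "\<exists>i\<in>I. v i \<noteq> 0" and v:
      "\<And>y. y \<in> ?J \<Longrightarrow> (\<Sum>i\<in>I. v i * (case y of Inl y \<Rightarrow> b i y | Inr k \<Rightarrow> cnj (u k i))) = 0"
      using nontrivial_solution[of ?J I "\<lambda>i y. case y of Inl y \<Rightarrow> b i y | Inr k \<Rightarrow> cnj (u k i)"]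
        I J by auto
    have v1: "(\<Sum>i\<in>I. v i * b i y) = 0" if "y \<in> J" for y
      using v[of "Inl y"] that by (simp add: Plus_def)
    have v2: "(\<Sum>i\<in>I. v i * cnj (u k i)) = 0" if "k < r" for k
      using v[of "Inr k"] that by (simp add: Plus_def)
    define s where "s = (\<Sum>i\<in>I. (cmod (v i))\<^sup>2)"
    have s: "s > 0"
    proof -
      obtain i where "i \<in> I" "v i \<noteq> 0" using v0 by blast
      then show ?thesis unfolding s_def using I by (intro sum_pos2[of _ i]) auto
    qed
    define w where "w i = v i / of_real (sqrt s)" for i
    have w1: "(\<Sum>i\<in>I. w i * b i y) = 0" if "y \<in> J" for y
      using v1[OF that] by (simp add: w_def flip: sum_divide_distrib)
    have w2: "(\<Sum>i\<in>I. w i * cnj (u k i)) = 0" if "k < r" for k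
      using v2[OF that] by (simp add: w_def flip: sum_divide_distrib)
    have w3: "(\<Sum>i\<in>I. u k i * cnj (w i)) = 0" if "k < r" for k
    proof -
      have "(\<Sum>i\<in>I. u k i * cnj (w i)) = cnj (\<Sum>i\<in>I. w i * cnj (u k i))"
        by (simp add: mult.commute)
      then show ?thesis using w2[OF that] by simp
    qed
    have "of_real (sqrt s) * of_real (sqrt s) = complex_of_real s"
      using s by (simp flip: of_real_mult)
    moreover have "(\<Sum>i\<in>I. v i * cnj (v i)) = of_real s"
      by (simp add: s_def complex_norm_square[symmetric] del: of_real_power)
    ultimately have w4: "(\<Sum>i\<in>I. w i * cnj (w i)) = 1"
      using s by (simp add: w_def flip: sum_divide_distrib)
    show ?case
      using u1 u2 w1 w2 w3 w4 by (intro exI[of _ "u(r := w)"]) (auto simp: less_Suc_eq)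
  qed
  define r where "r = card I - card J"
  obtain u where u1: "\<And>j k. j < r \<Longrightarrow> k < r \<Longrightarrow>
        (\<Sum>i\<in>I. u j i * cnj (u k i)) = (if j = k then 1 else 0)"
      and u2: "\<And>j y. j < r \<Longrightarrow> y \<in> J \<Longrightarrow> (\<Sum>i\<in>I. u j i * b i y) = 0"
    using ex[of r] unfolding r_def by blast
  have inner: "L2_inner (count_space I) f g = (\<Sum>i\<in>I. f i * cnj (g i))" for f g :: "'i \<Rightarrow> complex"
    unfolding L2_inner_def using I by (simp add: lebesgue_integral_count_space_finite)
  show ?thesis
  proof (rule that[of u]; (fold r_def)?)
    fix j assume j: "j < r"
    have "complex_of_real (\<Sum>i\<in>I. (cmod (u j i))\<^sup>2) = 1"
      using u1[OF j j] by (simp add: complex_norm_square[symmetric] del: of_real_power)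
    then show "(\<Sum>i\<in>I. (cmod (u j i))\<^sup>2) = 1" by (simp only: of_real_eq_1_iff)
  next
    fix j y assume "j < r" "y \<in> J"
    then show "(\<Sum>i\<in>I. u j i * b i y) = 0" by (rule u2)
  next
    fix w
    have orth: "L2_inner (count_space I) (\<lambda>i. cnj (u j i)) (\<lambda>i. cnj (u k i)) = (if j = k then 1 else 0)"
      if "j < r" "k < r" for j k
      using u1[OF that(2,1)] by (auto simp: inner mult.commute)
    have "(\<Sum>j<r. (cmod (L2_inner (count_space I) w (\<lambda>i. cnj (u j i))))\<^sup>2)
        \<le> (LINT i|count_space I. (cmod (w i))\<^sup>2)"
      using orth I by (intro L2_bessel L2_finite_count_space) auto
    then show "(\<Sum>j<r. (cmod (\<Sum>i\<in>I. u j i * w i))\<^sup>2) \<le> (\<Sum>i\<in>I. (cmod (w i))\<^sup>2)"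
      using I by (simp add: inner lebesgue_integral_count_space_finite mult.commute)
  qed
qed

section \<open>Transversals of subgroups\<close>

lemma add_subgroup_0: "add_subgroup H \<Longrightarrow> 0 \<in> H"
  by (simp add: add_subgroup_def)

lemma add_subgroup_add: "add_subgroup H \<Longrightarrow> x \<in> H \<Longrightarrow> y \<in> H \<Longrightarrow> x + y \<in> H"
  by (simp add: add_subgroup_def)

lemma add_subgroup_minus: "add_subgroup H \<Longrightarrow> x \<in> H \<Longrightarrow> - x \<in> H"
  by (simp add: add_subgroup_def)

lemma add_subgroup_diff: "add_subgroup H \<Longrightarrow> x \<in> H \<Longrightarrow> y \<in> H \<Longrightarrow> x - y \<in> H"
  using add_subgroup_add[of H x "- y"] add_subgroup_minus by auto

lemma add_subgroup_diff_swap: "add_subgroup H \<Longrightarrow> x - y \<in> H \<longleftrightarrow> y - x \<in> H"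
  using add_subgroup_minus[of H "x - y"] add_subgroup_minus[of H "y - x"] by auto

lemma add_subgroup_Times:
  "add_subgroup H \<Longrightarrow> add_subgroup K \<Longrightarrow> add_subgroup (H \<times> K)"
  by (auto simp: add_subgroup_def zero_prod_def)

lemma mem_coset_iff: "y \<in> (+) x ` H \<longleftrightarrow> y - (x :: 'a :: ab_group_add) \<in> H"
  by (metis add_diff_cancel_left' diff_add_cancel add.commute image_iff)

definition transversal :: "'a::ab_group_add set \<Rightarrow> 'a set \<Rightarrow> 'a set \<Rightarrow> bool" where
  "transversal K L R \<longleftrightarrow> R \<subseteq> K \<and> (\<forall>x\<in>K. \<exists>!r. r \<in> R \<and> x - r \<in> L)"

lemma transversal_subset: "transversal K L R \<Longrightarrow> R \<subseteq> K"
  by (simp add: transversal_def)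

lemma transversalE:
  assumes "transversal K L R" "x \<in> K" obtains r where "r \<in> R" "x - r \<in> L"
  using assms unfolding transversal_def by blast

lemma transversal_eqI:
  assumes "transversal K L R" "add_subgroup L" "r \<in> R" "s \<in> R" "r - s \<in> L" shows "r = s"
  using assms unfolding transversal_def
  by (metis add_subgroup_0 diff_self subsetD)

lemma transversal_exists:
  assumes K: "add_subgroup K" and L: "add_subgroup L"
  obtains R where "transversal K L R"
proof -
  define c where "c x = (SOME r. r \<in> K \<and> x - r \<in> L)" for x
  have c: "c x \<in> K \<and> x - c x \<in> L" if "x \<in> K" for x
    unfolding c_def by (rule someI[of _ x]) (use that add_subgroup_0[OF L] in auto)
  have c_eq: "c x = c y" if "x - y \<in> L" for x y
  proof -
    have "x - r \<in> L \<longleftrightarrow> y - r \<in> L" for r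
      using add_subgroup_add[OF L that, of "y - r"] add_subgroup_diff[OF L _ that, of "x - r"] by auto
    then show ?thesis by (simp add: c_def)
  qed
  have "transversal K L (c ` K)"
    unfolding transversal_def
  proof (intro conjI ballI)
    show "c ` K \<subseteq> K" using c by auto
    fix x assume x: "x \<in> K"
    show "\<exists>!r. r \<in> c ` K \<and> x - r \<in> L"
    proof (intro ex1I[of _ "c x"])
      show "c x \<in> c ` K \<and> x - c x \<in> L" using x c by auto
      fix r assume r: "r \<in> c ` K \<and> x - r \<in> L"
      then obtain y where y: "y \<in> K" "r = c y" by auto
      have "x - y \<in> L"
        using add_subgroup_diff[OF L, of "x - r" "y - r"] c[OF y(1)] r y by auto
      then show "r = c x" using c_eq y(2) by simp
    qed
  qed
  then show ?thesis by (rule that)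
qed

lemma transversal_Times:
  assumes "transversal K L R" "transversal K' L' R'"
  shows "transversal (K \<times> K') (L \<times> L') (R \<times> R')"
  unfolding transversal_def
proof (intro conjI ballI)
  show "R \<times> R' \<subseteq> K \<times> K'" using assms by (intro Sigma_mono) (auto simp: transversal_def)
  fix z assume "z \<in> K \<times> K'"
  then obtain x y where z: "z = (x, y)" "x \<in> K" "y \<in> K'" by auto
  obtain r where r: "r \<in> R" "x - r \<in> L" "\<And>s. s \<in> R \<Longrightarrow> x - s \<in> L \<Longrightarrow> s = r"
    using assms(1) z(2) unfolding transversal_def by metis
  obtain r' where r': "r' \<in> R'" "y - r' \<in> L'" "\<And>s. s \<in> R' \<Longrightarrow> y - s \<in> L' \<Longrightarrow> s = r'"
    using assms(2) z(3) unfolding transversal_def by metis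
  show "\<exists>!t. t \<in> R \<times> R' \<and> z - t \<in> L \<times> L'"
  proof (rule ex1I)
    show "(r, r') \<in> R \<times> R' \<and> z - (r, r') \<in> L \<times> L'"
      using r(1,2) r'(1,2) z(1) by simp
    fix t assume t: "t \<in> R \<times> R' \<and> z - t \<in> L \<times> L'"
    show "t = (r, r')"
      using t z(1) r(3)[of "fst t"] r'(3)[of "snd t"] by (cases t) simp
  qed
qed

section \<open>Extension of characters\<close>

text \<open>Homomorphisms from subgroups of \<open>'a\<close> to the circle, represented by their graphs: a subgroup of
  \<open>'a \<times> circle\<close> is a graph iff it contains no point above 0 other than 1.\<close>
definition partial_character :: "('a::ab_group_add \<times> complex) set \<Rightarrow> bool" where
  "partial_character S \<longleftrightarrow> (0, 1) \<in> S \<and>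
     (\<forall>x z y w. (x, z) \<in> S \<longrightarrow> (y, w) \<in> S \<longrightarrow> (x - y, z / w) \<in> S) \<and>
     (\<forall>x z. (x, z) \<in> S \<longrightarrow> cmod z = 1) \<and> (\<forall>z. (0, z) \<in> S \<longrightarrow> z = 1)"

lemma partial_character_unique:
  assumes "partial_character S" "(x, z) \<in> S" "(x, w) \<in> S" shows "z = w"
proof -
  have "(x - x, z / w) \<in> S" using assms unfolding partial_character_def by blast
  moreover have "cmod w = 1" using assms unfolding partial_character_def by blast
  ultimately show ?thesis using assms(1) unfolding partial_character_def
    by (metis diff_self divide_eq_1_iff)
qed

lemma partial_character_minus:
  assumes S: "partial_character S" "(x, z) \<in> S"
  shows "(- x, inverse z) \<in> S"
proof -
  have "(0 - x, 1 / z) \<in> S" using S unfolding partial_character_def by blast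
  then show ?thesis by (simp add: field_simps)
qed

lemma partial_character_plus:
  assumes S: "partial_character S" "(x, z) \<in> S" "(y, w) \<in> S"
  shows "(x + y, z * w) \<in> S"
proof -
  have "(x - (- y), z / inverse w) \<in> S"
    using S partial_character_minus[OF S(1,3)] unfolding partial_character_def by blast
  then show ?thesis by (simp add: field_simps)
qed

lemma aut_pow_0: "aut_pow A 0 = id"
  by (simp add: aut_pow_def)

lemma aut_pow_Suc:
  assumes "bij A" shows "aut_pow A (n + 1) = A \<circ> aut_pow A n"
proof (cases "n \<ge> 0")
  case True
  then have "nat (n + 1) = Suc (nat n)" by simp
  with True show ?thesis by (simp add: aut_pow_def)
next
  case False
  then obtain k where k: "nat (- n) = Suc k" by (cases "nat (- n)") auto
  have A: "A \<circ> inv A = id" using assms bij_is_surj surj_iff by blast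
  have "A \<circ> aut_pow A n = (A \<circ> inv A) \<circ> (inv A ^^ k)"
    using False k by (simp add: aut_pow_def o_assoc)
  also have "\<dots> = aut_pow A (n + 1)"
  proof (cases "n = -1")
    case True then show ?thesis using k A by (simp add: aut_pow_def)
  next
    case n: False
    with False have "\<not> n + 1 \<ge> 0" by simp
    moreover have "nat (- (n + 1)) = k" using k by simp
    ultimately show ?thesis using A by (simp add: aut_pow_def)
  qed
  finally show ?thesis by simp
qed

lemma aut_pow_induct [consumes 1, case_names zero up down]:
  assumes A: "bij A" and "P id"
    and "\<And>n. P (aut_pow A n) \<Longrightarrow> P (A \<circ> aut_pow A n)"
    and "\<And>n. P (aut_pow A n) \<Longrightarrow> P (inv A \<circ> aut_pow A n)"
  shows "P (aut_pow A n)"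
proof (induction n rule: int_induct[where k = 0])
  case base then show ?case unfolding aut_pow_0 by (rule assms(2))
next
  case (step1 i) then show ?case unfolding aut_pow_Suc[OF A] by (intro assms(3))
next
  case (step2 i)
  have "inv A \<circ> aut_pow A i = aut_pow A (i - 1)"
    using aut_pow_Suc[OF A, of "i - 1"] A by (simp add: o_assoc bij_is_inj)
  then show ?case using assms(4) step2 by metis
qed

lemma aut_pow_add:
  assumes A: "bij A" shows "aut_pow A (n + k) = aut_pow A n \<circ> aut_pow A k"
proof (induction n rule: int_induct[where k = 0])
  case base then show ?case by (simp add: aut_pow_0)
next
  case (step1 i)
  then show ?case
    using aut_pow_Suc[OF A, of "i + k"] aut_pow_Suc[OF A, of i] by (simp add: algebra_simps o_assoc)
next
  case (step2 i)
  have "A \<circ> aut_pow A (i - 1 + k) = aut_pow A (i + k)"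
    using aut_pow_Suc[OF A, of "i - 1 + k"] by (simp add: algebra_simps)
  also have "\<dots> = A \<circ> (aut_pow A (i - 1) \<circ> aut_pow A k)"
    using step2(2) aut_pow_Suc[OF A, of "i - 1"] by (simp only: o_assoc diff_add_cancel)
  finally have "A (aut_pow A (i - 1 + k) x) = A ((aut_pow A (i - 1) \<circ> aut_pow A k) x)" for x
    by (simp add: fun_eq_iff)
  then show ?case using A by (simp add: bij_is_inj fun_eq_iff inj_eq)
qed

lemma aut_pow_minus_cancel:
  assumes A: "bij A" shows "aut_pow A n (aut_pow A (- n) x) = x" "aut_pow A (- n) (aut_pow A n x) = x"
  using aut_pow_add[OF A, of n "- n"] aut_pow_add[OF A, of "- n" n]
  by (simp_all add: aut_pow_0 fun_eq_iff)

lemma bij_aut_pow: "bij A \<Longrightarrow> bij (aut_pow A n)"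
  using aut_pow_minus_cancel[of A n] by (intro o_bij[of "aut_pow A (- n)"]) (auto simp: fun_eq_iff)

text \<open>The integer multiple \<open>k x\<close> is the image of 0 under the \<open>k\<close>-th power of the translation by
  \<open>x\<close>.\<close>
definition int_multiple :: "int \<Rightarrow> 'a::ab_group_add \<Rightarrow> 'a" where
  "int_multiple k x = aut_pow ((+) x) k 0"

lemma aut_pow_translation: "aut_pow ((+) x) k y = int_multiple k x + (y :: 'a :: ab_group_add)"
  unfolding int_multiple_def
proof (induction k rule: int_induct[where k = 0])
  case base
  then show ?case by (simp add: aut_pow_0)
next
  case (step1 i)
  then show ?case by (simp add: aut_pow_Suc add.assoc)
next
  case (step2 i)
  then show ?case
    using aut_pow_Suc[OF bij_plus, of x "i - 1"] by (simp add: fun_eq_iff add.assoc)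
qed

lemma int_multiple_add: "int_multiple (k + l) x = int_multiple k x + int_multiple l x"
  unfolding int_multiple_def
  by (simp add: aut_pow_add aut_pow_translation)

lemma int_multiple_0 [simp]: "int_multiple 0 x = 0"
  by (simp add: int_multiple_def aut_pow_0)

lemma int_multiple_1 [simp]: "int_multiple 1 x = x"
  by (simp add: int_multiple_def aut_pow_def)

lemma int_multiple_minus: "int_multiple (- k) x = - int_multiple k x"
  using int_multiple_add[of k "- k" x] by (simp add: add_eq_0_iff)

lemma partial_character_multiple:
  assumes S: "partial_character S" "(int_multiple d x, z) \<in> S"
  shows "(int_multiple (d * k) x, z powi k) \<in> S"
proof -
  have z: "z \<noteq> 0" using S unfolding partial_character_def by (metis norm_zero zero_neq_one)
  have inv: "(- int_multiple d x, inverse z) \<in> S"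
    by (rule partial_character_minus[OF S])
  show ?thesis
  proof (induction k rule: int_induct[where k = 0])
    case base
    then show ?case using S(1) by (simp add: partial_character_def)
  next
    case (step1 i)
    from partial_character_plus[OF S(1) step1(2) S(2)] show ?case
      using z by (simp add: int_multiple_add power_int_add distrib_left)
  next
    case (step2 i)
    from partial_character_plus[OF S(1) step2(2) inv] show ?case
      using z int_multiple_add[of "d * i" "- d" x]
      by (simp add: int_multiple_minus power_int_diff right_diff_distrib divide_inverse)
  qed
qed

text \<open>If \<open>d x\<close> is the smallest positive multiple of \<open>x\<close> at which \<open>S\<close> is defined, the value at \<open>x\<close> may
  be any \<open>d\<close>-th root of the value at \<open>d x\<close>. Since \<open>d \<noteq> 1\<close>, there are at least two choices, one of
  which is not 1. If there is no such multiple, the value at \<open>x\<close> is arbitrary.\<close>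
lemma partial_character_extend:
  fixes x :: "'a::ab_group_add"
  assumes S: "partial_character S" and x: "x \<notin> fst ` S"
  obtains S' z where "partial_character S'" "S \<subseteq> S'" "(x, z) \<in> S'" "z \<noteq> 1"
proof -
  define D where "D = {k. int_multiple k x \<in> fst ` S}"
  obtain z where z: "cmod z = 1" "z \<noteq> 1"
    and compat: "\<And>k w. (int_multiple k x, w) \<in> S \<Longrightarrow> w = z powi k"
  proof (cases "\<exists>k\<in>D. k > 0")
    case False
    have "k = 0" if "k \<in> D" for k
    proof -
      from that obtain w where "(int_multiple k x, w) \<in> S" unfolding D_def by auto
      from partial_character_minus[OF S this] have "- k \<in> D"
        unfolding D_def int_multiple_minus[symmetric] mem_Collect_eq by (metis fst_conv image_eqI)
      moreover have "\<not> k > 0" "\<not> - k > 0" using False that calculation by blast+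
      ultimately show ?thesis by linarith
    qed
    then have "w = (-1) powi k" if "(int_multiple k x, w) \<in> S" for k w
    proof -
      have "k = 0" using that \<open>\<And>k. k \<in> D \<Longrightarrow> k = 0\<close> unfolding D_def by force
      with that S show ?thesis by (simp add: partial_character_def)
    qed
    then show ?thesis by (intro that[of "-1"]) auto
  next
    case True
    then obtain k0 where k0: "k0 \<in> D" "k0 > 0" by blast
    define d where "d = (LEAST n::nat. n > 0 \<and> int n \<in> D)"
    have ex: "\<exists>n::nat. n > 0 \<and> int n \<in> D" using k0 by (intro exI[of _ "nat k0"]) auto
    have d: "d > 0" "int d \<in> D" using LeastI_ex[OF ex] unfolding d_def by auto
    have d_min: "d \<le> n" if "n > 0" "int n \<in> D" for n
      unfolding d_def using that by (intro Least_le) auto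
    obtain v where v: "(int_multiple (int d) x, v) \<in> S" using d(2) unfolding D_def by auto
    have nv: "cmod v = 1" using v S unfolding partial_character_def by blast
    have "d \<noteq> 1" using d(2) x unfolding D_def by (intro notI) simp
    with d(1) have d2: "d \<ge> 2" by linarith
    have "card {z. z ^ d = v} = d" using nv d(1) by (intro card_nth_roots) auto
    then have "\<not> {z. z ^ d = v} \<subseteq> {1}"
      using d2 card_mono[of "{1}" "{z. z ^ d = v}"] by auto
    then obtain z where z: "z ^ d = v" "z \<noteq> 1" by blast
    have "cmod z ^ d = 1" using nv z(1) by (metis norm_power)
    then have nz: "cmod z = 1" using d(1) power_eq_iff_eq_base[of d "cmod z" 1] by simp
    have "w = z powi k" if kw: "(int_multiple k x, w) \<in> S" for k w
    proof -
      define q r where "q = k div int d" and "r = k mod int d"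
      have k: "k = int d * q + r" "0 \<le> r" "r < int d" using d(1) by (auto simp: q_def r_def)
      have q: "(int_multiple (int d * q) x, v powi q) \<in> S" by (rule partial_character_multiple[OF S v])
      have "int_multiple r x = int_multiple k x - int_multiple (int d * q) x"
        using k(1) int_multiple_add[of "int d * q" r x] by simp
      then have "(int_multiple r x, w / v powi q) \<in> S"
        using S q kw unfolding partial_character_def by metis
      then have "r \<in> D" unfolding D_def by force
      then have "r = 0" using d_min[of "nat r"] k(2,3) by (cases "r = 0") auto
      then have "w = v powi q" using q kw k(1) partial_character_unique[OF S] by simp
      also have "\<dots> = z powi k"
        using \<open>r = 0\<close> k(1) by (simp add: z(1)[symmetric] power_int_mult)
      finally show ?thesis .
    qed
    with nz z(2) show ?thesis by (intro that[of z]) auto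
  qed
  have z0: "z \<noteq> 0" using z by auto
  define S' where "S' = {(s + int_multiple k x, w * z powi k) | s w k. (s, w) \<in> S}"
  have S'I: "(s + int_multiple k x, w * z powi k) \<in> S'" if "(s, w) \<in> S" for s w k
    using that unfolding S'_def by blast
  have S01: "(0, 1) \<in> S" using S by (simp add: partial_character_def)
  have "partial_character S'"
    unfolding partial_character_def
  proof (intro conjI allI impI)
    show "(0, 1) \<in> S'" using S'I[OF S01, of 0] by simp
  next
    fix a u b v assume "(a, u) \<in> S'" "(b, v) \<in> S'"
    from \<open>(a, u) \<in> S'\<close> obtain s w k where
      a: "a = s + int_multiple k x" "u = w * z powi k" "(s, w) \<in> S"
      unfolding S'_def by blast
    from \<open>(b, v) \<in> S'\<close> obtain t y l where
      b: "b = t + int_multiple l x" "v = y * z powi l" "(t, y) \<in> S"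
      unfolding S'_def by blast
    note * = a b
    have "(s - t, w / y) \<in> S" using * S unfolding partial_character_def by blast
    moreover have "int_multiple (k - l) x = int_multiple k x - int_multiple l x"
      using int_multiple_add[of k "- l" x] by (simp add: int_multiple_minus)
    ultimately show "(a - b, u / v) \<in> S'"
      using S'I[of "s - t" "w / y" "k - l"] z0 by (simp add: * power_int_diff diff_add_eq diff_diff_eq2 add_diff_eq diff_diff_eq add.commute add.left_commute)
  next
    fix a u assume "(a, u) \<in> S'"
    then obtain s w k where "u = w * z powi k" "(s, w) \<in> S" unfolding S'_def by auto
    moreover then have "cmod w = 1" using S unfolding partial_character_def by blast
    ultimately show "cmod u = 1" using z by (simp add: norm_mult norm_power_int)
  next
    fix u assume "(0, u) \<in> S'"
    then obtain s w k where *: "s + int_multiple k x = 0" "u = w * z powi k" "(s, w) \<in> S"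
      unfolding S'_def by auto
    have "s = int_multiple (- k) x" using *(1) by (simp add: int_multiple_minus eq_neg_iff_add_eq_0)
    then have "w = z powi (- k)" using *(3) compat by blast
    then show "u = 1" using *(2) z0 by (simp add: power_int_minus)
  qed
  moreover have "S \<subseteq> S'"
  proof
    fix p assume "p \<in> S"
    then show "p \<in> S'" using S'I[of "fst p" "snd p" 0] by simp
  qed
  moreover have "(x, z) \<in> S'" using S'I[OF S01, of 1] by simp
  ultimately show ?thesis using z(2) that by blast
qed

lemma partial_character_chain_Union:
  assumes "C \<noteq> {}" "\<And>S. S \<in> C \<Longrightarrow> partial_character S"
    and chain: "\<And>S T. S \<in> C \<Longrightarrow> T \<in> C \<Longrightarrow> S \<subseteq> T \<or> T \<subseteq> S"
  shows "partial_character (\<Union>C)"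
  unfolding partial_character_def
proof (intro conjI allI impI)
  show "(0, 1) \<in> \<Union>C" using assms(1,2) unfolding partial_character_def by blast
next
  fix x z y w assume "(x, z) \<in> \<Union>C" "(y, w) \<in> \<Union>C"
  then obtain S T where "S \<in> C" "T \<in> C" "(x, z) \<in> S" "(y, w) \<in> T" by blast
  with chain[of S T] obtain U where "U \<in> C" "(x, z) \<in> U" "(y, w) \<in> U" by blast
  with assms(2)[of U] have "(x - y, z / w) \<in> U" unfolding partial_character_def by blast
  with \<open>U \<in> C\<close> show "(x - y, z / w) \<in> \<Union>C" by blast
next
  fix x z assume "(x, z) \<in> \<Union>C"
  then show "cmod z = 1" using assms(2) unfolding partial_character_def by blast
next
  fix z assume "(0, z) \<in> \<Union>C"
  then show "z = 1" using assms(2) unfolding partial_character_def by blast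
qed

lemma open_coset:
  fixes x :: "'a::topological_ab_group_add"
  assumes "open U" shows "open ((+) x ` U)"
proof -
  have "(+) x ` U = (\<lambda>t. t - x) -` U" by (auto simp: mem_coset_iff)
  moreover have "open ((\<lambda>t. t - x) -` U)"
    using assms by (intro open_vimage continuous_intros)
  ultimately show ?thesis by simp
qed

text \<open>By Zorn's lemma there is a maximal partial character that is trivial on \<open>H\<close> but not at \<open>x\<close>, and a
  maximal one is defined everywhere. It is continuous because it is constant on the cosets of
  \<open>H\<close>.\<close>
lemma annihilator_separates:
  fixes H :: "'a::topological_ab_group_add set"
  assumes H: "add_subgroup H" and oH: "open H" and x: "x \<notin> H"
  obtains \<xi> where "\<xi> \<in> annihilator H" "pairing x \<xi> \<noteq> 1"
proof -
  have "partial_character (H \<times> {1})"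
    using H add_subgroup_diff[OF H] by (auto simp: partial_character_def add_subgroup_def)
  moreover have "x \<notin> fst ` (H \<times> {1 :: complex})" using x by auto
  ultimately obtain S0 z where S0: "partial_character S0" "H \<times> {1} \<subseteq> S0" "(x, z) \<in> S0" "z \<noteq> 1"
    by (rule partial_character_extend)
  define P where "P = {S. partial_character S \<and> S0 \<subseteq> S}"
  have "\<exists>M\<in>P. \<forall>X\<in>P. M \<subseteq> X \<longrightarrow> X = M"
  proof (rule subset_Zorn_nonempty)
    show "P \<noteq> {}" using S0(1) by (auto simp: P_def)
    fix C assume C: "C \<noteq> {}" "subset.chain P C"
    have "partial_character (\<Union>C)"
      using C unfolding subset.chain_def P_def
      by (intro partial_character_chain_Union) blast+
    then show "\<Union>C \<in> P" using C unfolding subset.chain_def P_def by blast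
  qed
  then obtain M where "M \<in> P" and M_max: "\<forall>X\<in>P. M \<subseteq> X \<longrightarrow> X = M" by (rule bexE)
  then have M: "partial_character M" "S0 \<subseteq> M" by (simp_all add: P_def)
  have total: "y \<in> fst ` M" for y
  proof (rule ccontr)
    assume y: "y \<notin> fst ` M"
    from partial_character_extend[OF M(1) y] obtain S' w where
      "partial_character S'" "M \<subseteq> S'" "(y, w) \<in> S'" by metis
    moreover have "S' = M" using M_max calculation M(2) by (simp add: P_def)
    ultimately show False using y by force
  qed
  define \<kappa> where "\<kappa> y = (THE w. (y, w) \<in> M)" for y
  have \<kappa>: "(y, \<kappa> y) \<in> M" for y
  proof -
    obtain w where "(y, w) \<in> M" using total[of y] by auto
    then show ?thesis unfolding \<kappa>_def
      using partial_character_unique[OF M(1)] by (metis (no_types, lifting) theI)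
  qed
  have \<kappa>_eq: "\<kappa> y = w" if "(y, w) \<in> M" for y w
    using partial_character_unique[OF M(1) \<kappa> that] .
  have \<kappa>_add: "\<kappa> (y + t) = \<kappa> y * \<kappa> t" for y t
    by (rule \<kappa>_eq[OF partial_character_plus[OF M(1) \<kappa> \<kappa>]])
  have \<kappa>_H: "\<kappa> h = 1" if "h \<in> H" for h
  proof (rule \<kappa>_eq)
    have "(h, 1) \<in> S0" using that S0(2) by auto
    then show "(h, 1) \<in> M" using M(2) by (rule rev_subsetD)
  qed
  have "(\<kappa> \<longlongrightarrow> \<kappa> y) (at y)" for y
  proof -
    have "open ((+) y ` H)" using oH by (rule open_coset)
    moreover have "y \<in> (+) y ` H" using add_subgroup_0[OF H] by (auto simp: image_iff)
    ultimately have "eventually (\<lambda>t. t \<in> (+) y ` H) (nhds y)" by (rule eventually_nhds_in_open)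
    then have "eventually (\<lambda>t. t \<noteq> y \<longrightarrow> \<kappa> t = \<kappa> y) (nhds y)"
      by (rule eventually_mono) (auto simp: \<kappa>_add \<kappa>_H)
    then show ?thesis
      by (intro tendsto_eventually) (simp add: eventually_at_filter)
  qed
  then have "continuous_on UNIV \<kappa>" by (simp add: continuous_on_def)
  moreover have "cmod (\<kappa> y) = 1" for y
    using M(1) \<kappa>[of y] unfolding partial_character_def by blast
  ultimately have "char_fun (Abs_dual \<kappa>) = \<kappa>"
    using \<kappa>_add by (intro Abs_dual_inverse) auto
  then have *: "pairing y (Abs_dual \<kappa>) = \<kappa> y" for y by (simp add: pairing_def)
  have "\<kappa> x = z" using \<kappa>_eq rev_subsetD[OF S0(3) M(2)] .
  with S0(4) \<kappa>_H show ?thesis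
    by (intro that[of "Abs_dual \<kappa>"]) (auto simp: * annihilator_def)
qed

section \<open>Characters of finite quotients\<close>

lemma transversal_translation_bij:
  assumes R: "transversal K L R" "finite R" and K: "add_subgroup K" and L: "add_subgroup L"
    and k: "k \<in> K"
  obtains \<rho> where "bij_betw \<rho> R R" "\<And>r. r \<in> R \<Longrightarrow> r + k - \<rho> r \<in> L"
proof -
  have "\<exists>s. s \<in> R \<and> r + k - s \<in> L" if "r \<in> R" for r
    using that R(1) transversal_subset[OF R(1)] add_subgroup_add[OF K _ k]
    by (metis subsetD transversalE)
  then obtain \<rho> where \<rho>: "\<And>r. r \<in> R \<Longrightarrow> \<rho> r \<in> R \<and> r + k - \<rho> r \<in> L" by metis
  have "inj_on \<rho> R"
  proof (rule inj_onI)
    fix r s assume *: "r \<in> R" "s \<in> R" "\<rho> r = \<rho> s"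
    then have "(r + k - \<rho> r) - (s + k - \<rho> s) \<in> L"
      using \<rho> add_subgroup_diff[OF L] by blast
    then have "r - s \<in> L" using * by (simp add: algebra_simps)
    then show "r = s" using transversal_eqI[OF R(1) L] * by blast
  qed
  moreover have "\<rho> ` R \<subseteq> R" using \<rho> by blast
  ultimately have "bij_betw \<rho> R R"
    using R(2) by (simp add: bij_betw_def endo_inj_surj)
  with \<rho> show ?thesis using that by blast
qed

text \<open>Orthogonality of characters: shifting the sum by \<open>k\<close> permutes the cosets, so the sum is
  multiplied by \<open>f k\<close> and unchanged.\<close>
lemma sum_character_transversal:
  fixes f :: "'a::ab_group_add \<Rightarrow> complex"
  assumes R: "transversal K L R" "finite R" and K: "add_subgroup K" and L: "add_subgroup L"
    and f_add: "\<And>x y. f (x + y) = f x * f y" and f_L: "\<And>x. x \<in> L \<Longrightarrow> f x = 1"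
    and k: "k \<in> K" "f k \<noteq> 1"
  shows "(\<Sum>r\<in>R. f r) = 0"
proof -
  obtain \<rho> where \<rho>: "bij_betw \<rho> R R" "\<And>r. r \<in> R \<Longrightarrow> r + k - \<rho> r \<in> L"
    using transversal_translation_bij[OF R K L k(1)] by blast
  have "(\<Sum>r\<in>R. f r) * f k = (\<Sum>r\<in>R. f (\<rho> r))"
    unfolding sum_distrib_right
  proof (rule sum.cong[OF refl])
    fix r assume r: "r \<in> R"
    have "f r * f k = f ((r + k - \<rho> r) + \<rho> r)" by (simp add: f_add[symmetric])
    also have "\<dots> = f (\<rho> r)" unfolding f_add using f_L[OF \<rho>(2)[OF r]] by simp
    finally show "f r * f k = f (\<rho> r)" .
  qed
  also have "\<dots> = (\<Sum>r\<in>R. f r)" by (rule sum.reindex_bij_betw[OF \<rho>(1)])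
  finally show ?thesis using k(2) by simp
qed

lemma pairing_zero_left [simp]: "pairing 0 \<xi> = 1"
proof -
  have "pairing 0 \<xi> * pairing 0 \<xi> = pairing 0 \<xi>" using pairing_add_left[of 0 0 \<xi>] by simp
  moreover have "pairing 0 \<xi> \<noteq> 0" by (metis norm_pairing norm_zero zero_neq_one)
  ultimately show ?thesis by simp
qed

lemma pairing_nonzero [simp]: "pairing x \<xi> \<noteq> 0"
  by (metis norm_pairing norm_zero zero_neq_one)

lemma pairing_mult_cnj [simp]: "pairing x \<xi> * cnj (pairing x \<xi>) = 1"
  by (simp add: complex_norm_square[symmetric])

lemma pairing_minus_left: "pairing (- x) \<xi> = cnj (pairing x \<xi>)"
proof -
  have "pairing (- x) \<xi> * pairing x \<xi> = cnj (pairing x \<xi>) * pairing x \<xi>"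
    by (simp add: pairing_add_left[symmetric] mult.commute[of "cnj _"])
  then show ?thesis by simp
qed

lemma pairing_minus_right: "pairing x (\<xi> - \<eta>) = pairing x \<xi> * cnj (pairing x \<eta>)"
  using pairing_plus[of x \<xi> "- \<eta>"] by (simp add: pairing_uminus)

lemma add_subgroup_annihilator: "add_subgroup (annihilator H)"
  by (auto simp: add_subgroup_def annihilator_def pairing_plus pairing_uminus)

lemma annihilator_antimono: "H \<subseteq> K \<Longrightarrow> annihilator K \<subseteq> annihilator H"
  by (auto simp: annihilator_def)

text \<open>The characters in \<open>T\<close> are orthogonal functions on \<open>R\<close>, and Bessel's inequality for the
  indicator function of a single point of \<open>R\<close> bounds their number by \<open>card R\<close>.\<close>
lemma annihilator_transversal_finite:
  fixes K L :: "'a::topological_ab_group_add set"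
  assumes R: "transversal K L R" "finite R" and K: "add_subgroup K" and L: "add_subgroup L"
    and T: "transversal (annihilator L) (annihilator K) T"
  shows "finite T"
proof -
  have bound: "card F \<le> card R" if F: "F \<subseteq> T" "finite F" for F
  proof -
    obtain r0 where r0: "r0 \<in> R" "0 - r0 \<in> L"
      using transversalE[OF R(1) add_subgroup_0[OF K]] by blast
    then have pos: "card R > 0" using R(2) card_gt_0_iff by blast
    define c where "c = complex_of_real (1 / sqrt (card R))"
    have cc: "c * cnj c = 1 / card R"
      using pos by (simp add: c_def flip: of_real_mult)
    define e where "e = (\<lambda>(s :: 'a dual) r. c * pairing r s)"
    define f where "f = (\<lambda>r. if r = r0 then 1 else 0 :: complex)"
    have orth: "L2_inner (count_space R) (e s) (e t) = (if s = t then 1 else 0)"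
      if st: "s \<in> F" "t \<in> F" for s t
    proof -
      have "L2_inner (count_space R) (e s) (e t) = (\<Sum>r\<in>R. c * cnj c * pairing r (s - t))"
        unfolding L2_inner_def e_def using R(2)
        by (simp add: lebesgue_integral_count_space_finite pairing_minus_right mult_ac sum_distrib_left)
      also have "\<dots> = c * cnj c * (\<Sum>r\<in>R. pairing r (s - t))" by (simp add: sum_distrib_left)
      also have "\<dots> = (if s = t then 1 else 0)"
      proof (cases "s = t")
        case True
        then show ?thesis using pos by (simp add: cc)
      next
        case False
        have "s - t \<notin> annihilator K"
          using transversal_eqI[OF T add_subgroup_annihilator] st F False by blast
        then obtain k where "k \<in> K" "pairing k (s - t) \<noteq> 1" unfolding annihilator_def by blast
        moreover have "s - t \<in> annihilator L"
          using st F transversal_subset[OF T]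
          by (intro add_subgroup_diff[OF add_subgroup_annihilator]) auto
        ultimately have "(\<Sum>r\<in>R. pairing r (s - t)) = 0"
          using sum_character_transversal[OF R K L, of "\<lambda>x. pairing x (s - t)" k]
          by (auto simp: pairing_add_left annihilator_def)
        then show ?thesis using False by simp
      qed
      finally show ?thesis .
    qed
    have fe: "(cmod (L2_inner (count_space R) f (e s)))\<^sup>2 = 1 / card R" for s
    proof -
      have "L2_inner (count_space R) f (e s) = cnj (e s r0)"
        unfolding L2_inner_def f_def using R(2) r0(1)
        by (simp add: lebesgue_integral_count_space_finite if_distrib[of "\<lambda>x. x * _"] cong: if_cong)
      then show ?thesis by (simp add: e_def norm_mult c_def norm_divide power_divide)
    qed
    have "(\<Sum>s\<in>F. (cmod (L2_inner (count_space R) f (e s)))\<^sup>2) \<le> (LINT r|count_space R. (cmod (f r))\<^sup>2)"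
      using F R(2) orth by (intro L2_bessel L2_finite_count_space) auto
    also have "(LINT r|count_space R. (cmod (f r))\<^sup>2) = 1"
      unfolding f_def using R(2) r0(1)
      by (simp add: lebesgue_integral_count_space_finite if_distrib[of cmod] if_distrib[of "\<lambda>x. x\<^sup>2"] cong: if_cong)
    finally show ?thesis using pos by (simp add: fe field_simps)
  qed
  show ?thesis
    using finite_if_finite_subsets_card_bdd[of T "card R"] bound by blast
qed

text \<open>Both numbers are the value of the sum of \<open>\<langle>x, \<xi>\<rangle>\<close> over all pairs: by orthogonality only the trivial character contributes to
  the sum over \<open>x\<close>, and, since characters separate points, only the zero element contributes to the
  sum over \<open>\<xi>\<close>.\<close>
lemma annihilator_transversal_card:
  fixes K L :: "'a::topological_ab_group_add set"
  assumes R: "transversal K L R" "finite R" and K: "add_subgroup K" and L: "add_subgroup L" "open L"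
    and T: "transversal (annihilator L) (annihilator K) T"
  shows "card T = card R"
proof -
  note T_fin = annihilator_transversal_finite[OF R K L(1) T]
  have 1: "(\<Sum>r\<in>R. pairing r s) = (if s \<in> annihilator K then of_nat (card R) else 0)"
    if "s \<in> T" for s
  proof (cases "s \<in> annihilator K")
    case True
    then show ?thesis using transversal_subset[OF R(1)] by (auto simp: annihilator_def subset_iff)
  next
    case False
    then obtain k where "k \<in> K" "pairing k s \<noteq> 1" unfolding annihilator_def by blast
    moreover have "s \<in> annihilator L" using that transversal_subset[OF T] by blast
    ultimately show ?thesis
      using False sum_character_transversal[OF R K L(1), of "\<lambda>x. pairing x s" k]
      by (auto simp: pairing_add_left annihilator_def)
  qed
  have 2: "(\<Sum>s\<in>T. pairing r s) = (if r \<in> L then of_nat (card T) else 0)" if "r \<in> R" for r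
  proof (cases "r \<in> L")
    case True
    then show ?thesis using transversal_subset[OF T] by (auto simp: annihilator_def subset_iff)
  next
    case False
    then obtain \<xi> where "\<xi> \<in> annihilator L" "pairing r \<xi> \<noteq> 1"
      using annihilator_separates[OF L] by blast
    moreover have "r \<in> K" using that transversal_subset[OF R(1)] by blast
    ultimately show ?thesis
      using False sum_character_transversal[OF T T_fin add_subgroup_annihilator
          add_subgroup_annihilator, of "pairing r" \<xi>]
      by (auto simp: pairing_plus annihilator_def)
  qed
  have single: "\<exists>x. {r \<in> R. r \<in> L} = {x}"
    if K: "transversal K L R" "add_subgroup K" "add_subgroup L" for K L R :: "'b::ab_group_add set"
  proof -
    obtain x where x: "x \<in> R" "0 - x \<in> L"
      using transversalE[OF K(1) add_subgroup_0[OF K(2)]] by blast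
    then have xL: "x \<in> L" using add_subgroup_minus[OF K(3)] by force
    have "r = x" if r: "r \<in> R" "r \<in> L" for r
      using transversal_eqI[OF \<open>transversal K L R\<close> \<open>add_subgroup L\<close> r(1) x(1)]
        add_subgroup_diff[OF \<open>add_subgroup L\<close> r(2) xL] by blast
    with x xL show ?thesis by blast
  qed
  obtain x where x: "{r \<in> R. r \<in> L} = {x}" using single[OF R(1) K L(1)] by blast
  obtain y where y: "{s \<in> T. s \<in> annihilator K} = {y}"
    using single[OF T add_subgroup_annihilator add_subgroup_annihilator] by blast
  have "(of_nat (card T) :: complex) = (\<Sum>r\<in>R. if r \<in> L then of_nat (card T) else 0)"
    using R(2) x by (simp add: sum.If_cases Int_def)
  also have "\<dots> = (\<Sum>r\<in>R. \<Sum>s\<in>T. pairing r s)" using 2 by simp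
  also have "\<dots> = (\<Sum>s\<in>T. \<Sum>r\<in>R. pairing r s)" by (rule sum.swap)
  also have "\<dots> = (\<Sum>s\<in>T. if s \<in> annihilator K then of_nat (card R) else 0)" using 1 by simp
  also have "\<dots> = of_nat (card R)"
    using T_fin y by (simp add: sum.If_cases Int_def)
  finally show ?thesis by (simp only: of_nat_eq_iff)
qed

lemma transversal_cover:
  assumes "transversal K L R" shows "K \<subseteq> (\<Union>r\<in>R. (+) r ` L)"
proof
  fix x assume "x \<in> K"
  then obtain r where "r \<in> R" "x - r \<in> L" using transversalE[OF assms] by blast
  then show "x \<in> (\<Union>r\<in>R. (+) r ` L)" by (auto simp only: UN_iff mem_coset_iff)
qed

lemma transversal_finite:
  fixes K L :: "'a::topological_ab_group_add set"
  assumes R: "transversal K L R" and L: "add_subgroup L" "open L" and K: "compact K"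
  shows "finite R"
proof -
  have "K \<subseteq> (\<Union>r\<in>R. (+) r ` L)"
    by (rule transversal_cover[OF R])
  then obtain R0 where R0: "R0 \<subseteq> R" "finite R0" "K \<subseteq> (\<Union>r\<in>R0. (+) r ` L)"
    using compactE_image[OF K, of R "\<lambda>r. (+) r ` L"] open_coset[OF L(2)] by metis
  have "R \<subseteq> R0"
  proof
    fix r assume r: "r \<in> R"
    then have "r \<in> (\<Union>r\<in>R0. (+) r ` L)" using R0(3) transversal_subset[OF R] by blast
    then obtain s where s: "s \<in> R0" "r - s \<in> L" by (auto simp: mem_coset_iff)
    then have "r = s" using transversal_eqI[OF R L(1) r] R0(1) by blast
    with s show "r \<in> R0" by simp
  qed
  with R0(2) show ?thesis by (rule finite_subset[rotated])
qed

lemma transversal_decomposition: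
  assumes R: "transversal K L R" and L: "add_subgroup L" and K: "add_subgroup K" "L \<subseteq> K"
  shows "K = (\<Union>r\<in>R. (+) r ` L)" "disjoint_family_on (\<lambda>r. (+) r ` L) R"
proof -
  show "K = (\<Union>r\<in>R. (+) r ` L)"
  proof
    show "K \<subseteq> (\<Union>r\<in>R. (+) r ` L)"
      using transversal_cover[OF R] .
    show "(\<Union>r\<in>R. (+) r ` L) \<subseteq> K"
      using transversal_subset[OF R] K by (auto intro!: add_subgroup_add)
  qed
  show "disjoint_family_on (\<lambda>r. (+) r ` L) R"
    unfolding disjoint_family_on_def
  proof (intro ballI impI, rule ccontr)
    fix r s assume rs: "r \<in> R" "s \<in> R" "r \<noteq> s" "(+) r ` L \<inter> (+) s ` L \<noteq> {}"
    then obtain x where "x - r \<in> L" "x - s \<in> L" by (auto simp: mem_coset_iff set_eq_iff)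
    then have "r - s \<in> L" using add_subgroup_diff[OF L, of "x - s" "x - r"] by simp
    then show False using transversal_eqI[OF R L rs(1,2)] rs(3) by blast
  qed
qed

section \<open>Powers of an automorphism and of its adjoint\<close>

lemma aut_pow_1: "aut_pow A 1 = A"
  by (simp add: aut_pow_def)

lemma top_automorphism_bij: "top_automorphism A \<Longrightarrow> bij A"
  unfolding top_automorphism_def homeomorphism_def by (metis UNIV_I bij_betw_byWitness iso_tuple_UNIV_I order_refl bij_def inj_on_inverseI)

lemma top_automorphism_inv:
  assumes "top_automorphism A" shows "top_automorphism (inv A)"
proof -
  have bij: "bij A" by (rule top_automorphism_bij[OF assms])
  have A: "A (x + y) = A x + A y" for x y
    using assms unfolding top_automorphism_def Modules.additive_def by blast
  have "inv A (x + y) = inv A x + inv A y" for x y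
    using bij A[of "inv A x" "inv A y"]
    by (metis bij_inv_eq_iff)
  moreover have "homeomorphism UNIV UNIV (inv A) (inv (inv A))"
    using assms bij homeomorphism_sym[of UNIV UNIV A] unfolding top_automorphism_def
    by (simp add: inv_inv_eq)
  ultimately show ?thesis by (simp add: top_automorphism_def Modules.additive_def)
qed

lemma top_automorphism_add: "top_automorphism A \<Longrightarrow> A (x + y) = A x + A y"
  unfolding top_automorphism_def Modules.additive_def by blast

lemma top_automorphism_continuous: "top_automorphism A \<Longrightarrow> continuous_on UNIV A"
  unfolding top_automorphism_def homeomorphism_def by blast

lemma aut_pow_additive:
  assumes "top_automorphism A" shows "aut_pow A n (x + y) = aut_pow A n x + aut_pow A n y"
proof -
  have "\<forall>x y. aut_pow A n (x + y) = aut_pow A n x + aut_pow A n y"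
    by (rule aut_pow_induct[OF top_automorphism_bij[OF assms],
          where P = "\<lambda>f. \<forall>x y. f (x + y) = f x + f y"])
      (simp_all add: top_automorphism_add[OF assms]
        top_automorphism_add[OF top_automorphism_inv[OF assms]])
  then show ?thesis by blast
qed

lemma aut_pow_continuous:
  assumes "top_automorphism A" shows "continuous_on UNIV (aut_pow A n)"
proof (rule aut_pow_induct[OF top_automorphism_bij[OF assms], where P = "continuous_on UNIV"])
  show "continuous_on UNIV (id :: 'a \<Rightarrow> 'a)" by (rule continuous_on_id')
  fix n assume "continuous_on UNIV (aut_pow A n)"
  then show "continuous_on UNIV (A \<circ> aut_pow A n)" "continuous_on UNIV (inv A \<circ> aut_pow A n)"
    using top_automorphism_continuous[OF assms]
      top_automorphism_continuous[OF top_automorphism_inv[OF assms]]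
    by (auto intro!: continuous_on_compose simp del: o_apply elim: continuous_on_subset)
qed

lemma dual_adjoint_inverse:
  assumes "top_automorphism A"
  shows "dual_adjoint A (dual_adjoint (inv A) \<xi>) = \<xi>" "dual_adjoint (inv A) (dual_adjoint A \<xi>) = \<xi>"
proof -
  note bij = top_automorphism_bij[OF assms]
  note A' = top_automorphism_inv[OF assms]
  show "dual_adjoint A (dual_adjoint (inv A) \<xi>) = \<xi>"
    using bij by (intro dual_eqI)
      (simp add: pairing_dual_adjoint assms A' bij_is_inj)
  show "dual_adjoint (inv A) (dual_adjoint A \<xi>) = \<xi>"
    using bij by (intro dual_eqI)
      (simp add: pairing_dual_adjoint assms A' bij_is_surj surj_f_inv_f)
qed

lemma bij_dual_adjoint: "top_automorphism A \<Longrightarrow> bij (dual_adjoint A)"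
  using dual_adjoint_inverse[of A]
  by (intro o_bij[of "dual_adjoint (inv A)"]) (auto simp: fun_eq_iff)

lemma pairing_aut_pow_dual:
  assumes A: "top_automorphism A"
  shows "pairing x (aut_pow (dual_adjoint A) n \<xi>) = pairing (aut_pow A n x) \<xi>"
proof -
  note bij = top_automorphism_bij[OF A]
  have "\<forall>x. pairing x (aut_pow (dual_adjoint A) n \<xi>) = pairing (aut_pow A n x) \<xi>"
  proof (induction n rule: int_induct[where k = 0])
    case base
    then show ?case by (simp add: aut_pow_0)
  next
    case (step1 i)
    have "aut_pow A (i + 1) x = aut_pow A i (A x)" for x
      by (simp add: aut_pow_add[OF bij] aut_pow_1)
    then show ?case
      using step1 by (simp add: aut_pow_Suc[OF bij_dual_adjoint[OF A]] pairing_dual_adjoint[OF A])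
  next
    case (step2 i)
    show ?case
    proof
      fix x
      obtain y where y: "x = A y" using bij by (metis bij_pointE)
      have "pairing x (aut_pow (dual_adjoint A) (i - 1) \<xi>)
          = pairing y (dual_adjoint A (aut_pow (dual_adjoint A) (i - 1) \<xi>))"
        by (simp add: y pairing_dual_adjoint[OF A])
      also have "\<dots> = pairing y (aut_pow (dual_adjoint A) i \<xi>)"
        using aut_pow_Suc[OF bij_dual_adjoint[OF A], of "i - 1"] by simp
      also have "\<dots> = pairing (aut_pow A i y) \<xi>" using step2(2) by blast
      also have "aut_pow A i y = aut_pow A (i - 1) x"
        using aut_pow_add[OF bij, of "i - 1" 1] by (simp add: y aut_pow_1)
      finally show "pairing x (aut_pow (dual_adjoint A) (i - 1) \<xi>) = pairing (aut_pow A (i - 1) x) \<xi>" .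
    qed
  qed
  then show ?thesis by blast
qed

lemma aut_pow_dual_annihilator:
  assumes A: "top_automorphism A"
  shows "aut_pow (dual_adjoint A) n ` annihilator H = annihilator (aut_pow A (- n) ` H)"
proof -
  let ?P = "aut_pow (dual_adjoint A)"
  note bij = bij_dual_adjoint[OF A]
  have "\<xi> \<in> ?P n ` annihilator H \<longleftrightarrow> ?P (- n) \<xi> \<in> annihilator H" for \<xi>
  proof
    assume "\<xi> \<in> ?P n ` annihilator H"
    then show "?P (- n) \<xi> \<in> annihilator H" using aut_pow_minus_cancel(2)[OF bij] by auto
  next
    assume "?P (- n) \<xi> \<in> annihilator H"
    then have "?P n (?P (- n) \<xi>) \<in> ?P n ` annihilator H" by (rule imageI)
    then show "\<xi> \<in> ?P n ` annihilator H" by (simp add: aut_pow_minus_cancel(1)[OF bij])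
  qed
  moreover have "?P (- n) \<xi> \<in> annihilator H \<longleftrightarrow> \<xi> \<in> annihilator (aut_pow A (- n) ` H)" for \<xi>
    by (simp add: annihilator_def pairing_aut_pow_dual[OF A])
  ultimately show ?thesis by (simp only: set_eq_iff) simp
qed

text \<open>Squaring expands the distance of \<open>z\<close> to 1 by the factor \<open>\<bar>z + 1\<bar> \<ge> 3/2\<close> as long as
  \<open>\<bar>z - 1\<bar> < 1/2\<close>, so the powers \<open>z\<close>, \<open>z\<^sup>2\<close>, \<open>z\<^sup>4\<close>, ... leave that disc unless \<open>z = 1\<close>.\<close>
lemma no_small_subgroups:
  fixes z :: complex
  assumes "\<And>n::nat. cmod (z ^ n - 1) < 1/2"
  shows "z = 1"
proof (rule ccontr)
  assume "z \<noteq> 1"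
  have "(3/2) ^ k * cmod (z - 1) \<le> cmod (z ^ (2 ^ k) - 1)" for k
  proof (induction k)
    case 0 then show ?case by simp
  next
    case (Suc k)
    let ?w = "z ^ (2 ^ k)"
    have "cmod (?w - 1) < 1/2" by (rule assms)
    moreover have "2 \<le> cmod (?w + 1) + cmod (?w - 1)"
      using norm_triangle_ineq4[of "?w + 1" "?w - 1"] by simp
    ultimately have "3/2 \<le> cmod (?w + 1)" by linarith
    then have "(3/2) * cmod (?w - 1) \<le> cmod (?w + 1) * cmod (?w - 1)"
      by (intro mult_right_mono) auto
    also have "\<dots> = cmod (z ^ (2 ^ Suc k) - 1)"
      by (simp add: norm_mult[symmetric] algebra_simps power_mult[symmetric] flip: power_add mult_2)
    finally show ?case using Suc by simp
  qed
  moreover obtain k where "1 / cmod (z - 1) < (3/2) ^ k"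
    using real_arch_pow[of "3/2" "1 / cmod (z - 1)"] by auto
  moreover have "cmod (z - 1) > 0" using \<open>z \<noteq> 1\<close> by simp
  ultimately have "1 < cmod (z ^ (2 ^ k) - 1)"
    by (metis less_le_trans pos_divide_less_eq)
  then show False using assms[of "2 ^ k"] by simp
qed

section \<open>The filtration by the images of the compact open subgroup\<close>

locale expansive_automorphism =
  fixes H :: "'a::{t2_space, topological_ab_group_add} set" and A :: "'a \<Rightarrow> 'a"
  assumes H: "add_subgroup H" and compact_H: "compact H" and open_H: "open H"
    and aut: "top_automorphism A"
    and expansive: "expansive A H"
    and expansive_dual: "expansive (dual_adjoint A) (annihilator H)"
begin

definition K :: "int \<Rightarrow> 'a set" where "K n = aut_pow A n ` H"

text \<open>The box centred at 0. By \<open>aut_pow_dual_annihilator\<close> its second factor is \<open>(A\<^sup>*)\<^sup>n H\<^sup>\<bottom>\<close>; writing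
  it as an annihilator avoids powers of the adjoint.\<close>
definition Q :: "int \<Rightarrow> ('a \<times> 'a dual) set" where "Q n = K n \<times> annihilator (K (- n))"

lemma bij: "bij A"
  by (rule top_automorphism_bij[OF aut])

lemma K_0: "K 0 = H"
  by (simp add: K_def aut_pow_0)

lemma mem_K_iff: "x \<in> K n \<longleftrightarrow> aut_pow A (- n) x \<in> H"
  unfolding K_def using aut_pow_minus_cancel[OF bij] by (metis image_iff)

lemma image_K: "aut_pow A k ` K n = K (k + n)"
  by (simp add: K_def aut_pow_add[OF bij] image_comp)

lemma subgroup_K: "add_subgroup (K n)"
proof -
  note add = aut_pow_additive[OF aut]
  have 0: "aut_pow A (- n) 0 = 0" using add[of "- n" 0 0] by simp
  have "aut_pow A (- n) (- x) = - aut_pow A (- n) x" for x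
    using add[of "- n" "- x" x] 0 by (simp add: eq_neg_iff_add_eq_0)
  then show ?thesis
    using H 0 by (simp add: add_subgroup_def mem_K_iff add)
qed

lemma compact_K: "compact (K n)"
  unfolding K_def
  by (intro compact_continuous_image compact_H continuous_on_subset[OF aut_pow_continuous[OF aut]]) simp

lemma open_K: "open (K n)"
proof -
  have "K n = aut_pow A (- n) -` H" by (auto simp: mem_K_iff)
  then show ?thesis using aut_pow_continuous[OF aut] open_H by (simp add: open_vimage)
qed

lemma K_mono: "n \<le> k \<Longrightarrow> K n \<subseteq> K k"
proof (induction k rule: int_ge_induct)
  case (step k)
  have "K k \<subseteq> aut_pow A k ` (A ` H)"
    using expansive unfolding expansive_def K_def by blast
  also have "\<dots> = K (k + 1)"
    by (simp add: K_def aut_pow_add[OF bij] aut_pow_1 image_comp)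
  finally show ?case using step by blast
qed simp

lemma K_Inter: "(\<And>k::nat. x \<in> K (- int k)) \<Longrightarrow> x = 0"
proof -
  assume x: "\<And>k::nat. x \<in> K (- int k)"
  have "x \<in> aut_pow A n ` H" if "n \<le> 0" for n
    using x[of "nat (- n)"] that by (simp add: K_def)
  then have "x \<in> (\<Inter>n\<in>{..0}. aut_pow A n ` H)" by blast
  then show ?thesis using expansive unfolding expansive_def by blast
qed

text \<open>A character that is trivial on \<open>\<Union>n. K n\<close> lies in every \<open>(A\<^sup>*)\<^sup>n H\<^sup>\<bottom>\<close> with \<open>n \<le> 0\<close>, hence is
  trivial; since characters separate points from open subgroups, that union is the whole group.\<close>
lemma K_exhausts:
  obtains n :: nat where "x \<in> K (int n)"
proof (rule ccontr)
  assume "\<not> thesis"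
  with that have x: "x \<notin> (\<Union>n::nat. K (int n))" by blast
  have "add_subgroup (\<Union>n::nat. K (int n))"
    unfolding add_subgroup_def
  proof (intro conjI ballI)
    show "0 \<in> (\<Union>n::nat. K (int n))" using add_subgroup_0[OF subgroup_K] by blast
    fix x assume "x \<in> (\<Union>n::nat. K (int n))"
    then obtain n :: nat where n: "x \<in> K (int n)" by blast
    then show "- x \<in> (\<Union>n::nat. K (int n))" using add_subgroup_minus[OF subgroup_K] by blast
    fix y assume "y \<in> (\<Union>n::nat. K (int n))"
    then obtain k :: nat where k: "y \<in> K (int k)" by blast
    have "x \<in> K (int (max n k))" "y \<in> K (int (max n k))"
      using n k K_mono[of "int n" "int (max n k)"] K_mono[of "int k" "int (max n k)"] by auto
    then have "x + y \<in> K (int (max n k))" by (rule add_subgroup_add[OF subgroup_K])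
    then show "x + y \<in> (\<Union>n::nat. K (int n))" by blast
  qed
  moreover have "open (\<Union>n::nat. K (int n))" by (intro open_UN ballI open_K)
  ultimately obtain \<xi> where \<xi>: "\<xi> \<in> annihilator (\<Union>n::nat. K (int n))" "pairing x \<xi> \<noteq> 1"
    using x by (rule annihilator_separates)
  have "\<xi> \<in> aut_pow (dual_adjoint A) n ` annihilator H" if "n \<le> 0" for n
  proof -
    have "K (int (nat (- n))) = aut_pow A (- n) ` H" using that by (simp add: K_def)
    then have "\<xi> \<in> annihilator (aut_pow A (- n) ` H)"
      using \<xi>(1) by (metis UN_upper UNIV_I annihilator_antimono subsetD)
    then show ?thesis by (simp add: aut_pow_dual_annihilator[OF aut])
  qed
  then have "\<xi> \<in> (\<Inter>n\<in>{..0}. aut_pow (dual_adjoint A) n ` annihilator H)" by blast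
  then have "\<xi> = 0" using expansive_dual unfolding expansive_def by blast
  with \<xi>(2) show False by simp
qed

text \<open>By compactness of \<open>H\<close>, a decreasing sequence of compact sets with intersection \<open>{0}\<close> is
  eventually contained in every neighbourhood of 0.\<close>
lemma K_small:
  assumes "open U" "0 \<in> U"
  obtains k :: nat where "K (- int k) \<subseteq> U"
proof -
  have "compact (H - U)" using compact_H assms(1) by (rule compact_diff)
  moreover have "H - U \<subseteq> (\<Union>k\<in>UNIV. - K (- int k))"
    using K_Inter assms(2) by blast
  moreover have "open (- K (- int k))" for k
    using compact_imp_closed[OF compact_K] by (simp add: closed_def)
  ultimately obtain C where C: "finite C" "H - U \<subseteq> (\<Union>k\<in>C. - K (- int k))"
    using compactE_image[of "H - U" UNIV "\<lambda>k. - K (- int k)"] by metis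
  define M where "M = Max (insert 0 C)"
  have "K (- int M) \<subseteq> K (- int k)" if "k \<in> C" for k
    using that C(1) by (intro K_mono) (simp add: M_def)
  moreover have "K (- int M) \<subseteq> H" using K_mono[of "- int M" 0] by (simp add: K_0)
  ultimately have "K (- int M) \<subseteq> U" using C(2) by blast
  then show ?thesis by (rule that)
qed

text \<open>A continuous character maps some \<open>K (- n)\<close> into a small disc around 1, and the image is a
  subgroup of the circle.\<close>
lemma annihilator_K_exhausts:
  obtains n :: nat where "\<xi> \<in> annihilator (K (- int n))"
proof -
  define U where "U = {x. cmod (pairing x \<xi> - 1) < 1/2}"
  have "open U"
    unfolding U_def by (intro open_Collect_less continuous_intros continuous_on_pairing)
  moreover have "0 \<in> U" by (simp add: U_def)
  ultimately obtain n :: nat where n: "K (- int n) \<subseteq> U" by (rule K_small)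
  have "pairing x \<xi> = 1" if x: "x \<in> K (- int n)" for x
  proof (rule no_small_subgroups)
    fix k :: nat
    have "((+) x ^^ k) 0 \<in> K (- int n) \<and> pairing (((+) x ^^ k) 0) \<xi> = pairing x \<xi> ^ k"
      using x add_subgroup_0[OF subgroup_K] add_subgroup_add[OF subgroup_K x]
      by (induction k) (auto simp: pairing_add_left)
    then show "cmod (pairing x \<xi> ^ k - 1) < 1/2" using n by (force simp: U_def)
  qed
  then show ?thesis by (intro that[of n]) (simp add: annihilator_def)
qed

lemma subgroup_Q: "add_subgroup (Q n)"
  unfolding Q_def by (intro add_subgroup_Times subgroup_K add_subgroup_annihilator)

lemma Q_mono: "n \<le> k \<Longrightarrow> Q n \<subseteq> Q k"
  unfolding Q_def by (intro Sigma_mono K_mono annihilator_antimono) auto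

lemma Q_exhausts:
  obtains n :: nat where "p \<in> Q (int n)"
proof -
  obtain x \<xi> where p: "p = (x, \<xi>)" by (cases p)
  obtain n :: nat where n: "x \<in> K (int n)" by (rule K_exhausts)
  obtain k :: nat where k: "\<xi> \<in> annihilator (K (- int k))" by (rule annihilator_K_exhausts)
  have "x \<in> K (int (max n k))" using n K_mono[of "int n" "int (max n k)"] by auto
  moreover have "\<xi> \<in> annihilator (K (- int (max n k)))"
    using k annihilator_antimono[OF K_mono, of "- int (max n k)" "- int k"] by auto
  ultimately show ?thesis using that[of "max n k"] by (simp add: p Q_def)
qed

lemma box_Q_iff: "p \<in> box_Q A H n q \<longleftrightarrow> p - q \<in> Q n"
  by (cases p; cases q)
    (simp add: box_Q_def Q_def aut_pow_dual_annihilator[OF aut] mem_coset_iff flip: K_def)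

lemma transversal_K_finite: "transversal (K n) (K k) R \<Longrightarrow> finite R"
  by (rule transversal_finite[OF _ subgroup_K open_K compact_K])

lemma transversal_Q_exists:
  obtains R S T where "transversal (K n) (K k) R" "transversal (K (- k)) (K (- n)) S"
    "transversal (Q n) (Q k) T" "finite T" "card T = card R * card S"
proof -
  obtain R where R: "transversal (K n) (K k) R"
    using transversal_exists[OF subgroup_K subgroup_K] .
  obtain S where S: "transversal (K (- k)) (K (- n)) S"
    using transversal_exists[OF subgroup_K subgroup_K] .
  obtain S' where S': "transversal (annihilator (K (- n))) (annihilator (K (- k))) S'"
    using transversal_exists[OF add_subgroup_annihilator add_subgroup_annihilator] .
  note S_fin = transversal_K_finite[OF S]
  have "finite S'" "card S' = card S"
    using annihilator_transversal_finite[OF S S_fin subgroup_K subgroup_K S']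
      annihilator_transversal_card[OF S S_fin subgroup_K subgroup_K open_K S'] by simp_all
  then show ?thesis
    using that[OF R S] transversal_Times[OF R S'] transversal_K_finite[OF R]
    by (simp add: Q_def card_cartesian_product)
qed

end

section \<open>Haar measure and the modulus\<close>

locale expansive_haar = expansive_automorphism H A
  for H :: "'a::{t2_space, topological_ab_group_add} set" and A :: "'a \<Rightarrow> 'a" +
  fixes m :: "'a measure"
  assumes haar: "haar_measure m" and measure_H: "emeasure m H = 1"
begin

lemma sets_m [simp, measurable_cong]: "sets m = sets borel"
  using haar by (simp add: haar_measure_def)

lemma space_m [simp]: "space m = UNIV"
  using sets_eq_imp_space_eq[OF sets_m] by simp

lemma emeasure_coset: "B \<in> sets borel \<Longrightarrow> emeasure m ((+) x ` B) = emeasure m B"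
  using haar by (simp add: haar_measure_def)

lemma borel_K [measurable]: "K n \<in> sets borel"
  by (rule borel_open[OF open_K])

lemma borel_coset_K [measurable]: "(+) x ` K n \<in> sets borel"
  by (rule borel_open[OF open_coset[OF open_K]])

lemma emeasure_K_finite: "emeasure m (K n) < \<infinity>"
proof -
  have "\<forall>C. compact C \<longrightarrow> emeasure m C < \<infinity>" using haar unfolding haar_measure_def by (elim conjE)
  then show ?thesis using compact_K by simp
qed

lemma emeasure_K_transversal:
  assumes R: "transversal (K n) (K k) R" and "k \<le> n"
  shows "emeasure m (K n) = of_nat (card R) * emeasure m (K k)"
proof -
  note dec = transversal_decomposition[OF R subgroup_K subgroup_K K_mono[OF \<open>k \<le> n\<close>]]
  have "emeasure m (K n) = emeasure m (\<Union>r\<in>R. (+) r ` K k)" using dec(1) by simp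
  also have "\<dots> = (\<Sum>r\<in>R. emeasure m ((+) r ` K k))"
    using dec(2) transversal_K_finite[OF R] by (intro sum_emeasure[symmetric]) auto
  also have "\<dots> = of_nat (card R) * emeasure m (K k)"
    by (simp add: emeasure_coset)
  finally show ?thesis .
qed

lemma transversal_image:
  assumes R: "transversal (K n) (K k) R"
  shows "transversal (K (j + n)) (K (j + k)) (aut_pow A j ` R)" "card (aut_pow A j ` R) = card R"
proof -
  let ?P = "aut_pow A j"
  note bijP = bij_aut_pow[OF bij, of j]
  have P_diff: "?P x - ?P y \<in> K (j + k) \<longleftrightarrow> x - y \<in> K k" for x y
  proof -
    have "?P (x - y) + ?P y = ?P x" using aut_pow_additive[OF aut, of j "x - y" y] by simp
    then have "?P x - ?P y = ?P (x - y)" by (simp add: algebra_simps)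
    then show ?thesis
      using image_K[of j k] bijP by (metis bij_is_inj inj_image_mem_iff)
  qed
  show "transversal (K (j + n)) (K (j + k)) (?P ` R)"
    unfolding transversal_def
  proof (intro conjI ballI)
    show "?P ` R \<subseteq> K (j + n)" using transversal_subset[OF R] image_K[of j n] by blast
    fix y assume "y \<in> K (j + n)"
    then obtain x where x: "x \<in> K n" "y = ?P x" using image_K[of j n] by blast
    then obtain r where r: "r \<in> R" "x - r \<in> K k" using transversalE[OF R] by blast
    show "\<exists>!s. s \<in> ?P ` R \<and> y - s \<in> K (j + k)"
    proof (rule ex1I)
      show "?P r \<in> ?P ` R \<and> y - ?P r \<in> K (j + k)" using r x by (simp add: P_diff)
      fix s assume s: "s \<in> ?P ` R \<and> y - s \<in> K (j + k)"
      then obtain t where t: "t \<in> R" "s = ?P t" by blast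
      have "x - t \<in> K k" using s t x by (simp add: P_diff)
      then have "t - r \<in> K k" using add_subgroup_diff[OF subgroup_K r(2)] by fastforce
      then show "s = ?P r" using transversal_eqI[OF R subgroup_K t(1) r(1)] t(2) by simp
    qed
  qed
  show "card (?P ` R) = card R"
    using bijP by (intro card_image) (metis bij_is_inj inj_on_subset subset_UNIV)
qed

text \<open>The index \<open>[A H : H]\<close>, counted on an arbitrarily chosen transversal.\<close>
definition q :: nat where "q = card (SOME R. transversal (K 1) (K 0) R)"

lemma emeasure_K_step: "emeasure m (K (n + 1)) = of_nat q * emeasure m (K n)"
proof -
  have "\<exists>R. transversal (K 1) (K 0) R" using transversal_exists[OF subgroup_K subgroup_K] by metis
  then have "transversal (K 1) (K 0) (SOME R. transversal (K 1) (K 0) R)" by (rule someI_ex)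
  from transversal_image[OF this, of n] show ?thesis
    using emeasure_K_transversal[of "n + 1" n] by (simp add: q_def)
qed

lemma emeasure_K: "k \<le> n \<Longrightarrow> emeasure m (K n) = of_nat (q ^ nat (n - k)) * emeasure m (K k)"
proof (induction n rule: int_ge_induct)
  case (step n)
  have "nat (n + 1 - k) = Suc (nat (n - k))" using step(1) by simp
  then show ?case using step by (simp add: emeasure_K_step mult.assoc)
qed simp

lemma q_pos: "q > 0"
proof -
  have "emeasure m (K 0) \<le> emeasure m (K 1)" by (intro emeasure_mono K_mono) simp_all
  then have "of_nat q \<noteq> (0 :: ennreal)"
    using emeasure_K_step[of 0] by (auto simp: K_0 measure_H)
  then show ?thesis by (cases q) auto
qed

lemma emeasure_K_nonzero: "emeasure m (K n) \<noteq> 0"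
proof -
  have "emeasure m (K (int (nat n))) = of_nat (q ^ nat (int (nat n))) * 1"
    using emeasure_K[of 0 "int (nat n)"] by (simp add: K_0 measure_H)
  then have "emeasure m (K (int (nat n))) \<noteq> 0" using q_pos by simp
  then show ?thesis using emeasure_K[of n "int (nat n)"] by auto
qed

text \<open>Measuring both groups determines the index, since \<open>m (K k)\<close> is neither 0 nor infinite.\<close>
lemma card_transversal_K:
  assumes R: "transversal (K n) (K k) R" and "k \<le> n"
  shows "card R = q ^ nat (n - k)"
proof -
  have "emeasure m (K k) * of_nat (card R) = emeasure m (K k) * of_nat (q ^ nat (n - k))"
    using emeasure_K_transversal[OF R \<open>k \<le> n\<close>] emeasure_K[OF \<open>k \<le> n\<close>] by (simp add: mult.commute)
  then have "(of_nat (card R) :: ennreal) = of_nat (q ^ nat (n - k))"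
    using emeasure_K_nonzero[of k] emeasure_K_finite[of k]
    by (simp only: ennreal_mult_cancel_left) auto
  then show ?thesis by (simp only: of_nat_eq_iff)
qed

definition cosets :: "'a set set" where "cosets = {(+) x ` K (- int k) | x k. True}"

lemma coset_subset:
  assumes "open U" "x \<in> U" obtains k :: nat where "(+) x ` K (- int k) \<subseteq> U"
proof -
  have "open ((+) x -` U)" using assms(1) by (intro open_vimage continuous_intros)
  moreover have "0 \<in> (+) x -` U" using assms(2) by simp
  ultimately obtain k :: nat where "K (- int k) \<subseteq> (+) x -` U" by (rule K_small)
  then show ?thesis using that by blast
qed

lemma mem_coset_self: "x \<in> (+) x ` K n"
  using add_subgroup_0[OF subgroup_K] by (simp add: mem_coset_iff)

lemma coset_K_eq:
  assumes "z - x \<in> K n" shows "(+) x ` K n = (+) z ` K n"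
proof -
  have "y - x \<in> K n \<longleftrightarrow> y - z \<in> K n" for y
    using add_subgroup_add[OF subgroup_K, of "y - z" n "z - x"]
      add_subgroup_diff[OF subgroup_K, of "y - x" n "z - x"] assms by auto
  then show ?thesis by (intro set_eqI) (simp only: mem_coset_iff)
qed

lemma countable_cosets: "countable cosets"
proof -
  have "\<exists>R. transversal (K (int n)) (K (- int k)) R" for n k :: nat
    using transversal_exists[OF subgroup_K subgroup_K] by metis
  then obtain R where R: "\<And>n k :: nat. transversal (K (int n)) (K (- int k)) (R n k)" by metis
  have "cosets \<subseteq> (\<Union>n. \<Union>k. (\<lambda>r. (+) r ` K (- int k)) ` R n k)"
  proof
    fix C assume "C \<in> cosets"
    then obtain x k where C: "C = (+) x ` K (- int k)" unfolding cosets_def by blast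
    obtain n :: nat where "x \<in> K (int n)" by (rule K_exhausts)
    then obtain r where r: "r \<in> R n k" "x - r \<in> K (- int k)" using transversalE[OF R] by blast
    have "C = (+) r ` K (- int k)" unfolding C using coset_K_eq[OF r(2)] by (rule sym)
    with r(1) show "C \<in> (\<Union>n. \<Union>k. (\<lambda>r. (+) r ` K (- int k)) ` R n k)" by blast
  qed
  moreover have "finite (R n k)" for n k by (rule transversal_K_finite[OF R])
  then have "countable (\<Union>n. \<Union>k. (\<lambda>r. (+) r ` K (- int k)) ` R n k)"
    by (intro countable_UN countable_image countableI_type) (rule countable_finite)
  ultimately show ?thesis by (rule countable_subset)
qed

text \<open>There are only countably many cosets, and every open set is a union of cosets.\<close>
lemma borel_eq_cosets: "sets (borel :: 'a measure) = sigma_sets UNIV (insert {} cosets)"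
proof -
  have "sigma_sets UNIV {U. open U} = sigma_sets UNIV (insert {} cosets)"
  proof (rule sigma_sets_eqI)
    fix U :: "'a set" assume "U \<in> {U. open U}"
    then have U: "open U" by simp
    have "U = \<Union>{C \<in> cosets. C \<subseteq> U}"
    proof
      show "U \<subseteq> \<Union>{C \<in> cosets. C \<subseteq> U}"
      proof
        fix x assume "x \<in> U"
        with U obtain k :: nat where "(+) x ` K (- int k) \<subseteq> U" by (rule coset_subset)
        moreover have "(+) x ` K (- int k) \<in> cosets" unfolding cosets_def by blast
        ultimately show "x \<in> \<Union>{C \<in> cosets. C \<subseteq> U}" using mem_coset_self by blast
      qed
    qed blast
    moreover have "\<Union>{C \<in> cosets. C \<subseteq> U} \<in> sigma_sets UNIV (insert {} cosets)"
      using countable_cosets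
      by (intro sigma_sets_UNION) (auto intro: countable_subset)
    ultimately show "U \<in> sigma_sets UNIV (insert {} cosets)" by simp
  next
    fix C assume "C \<in> insert {} cosets"
    then have "open C" unfolding cosets_def using open_coset[OF open_K] by auto
    then show "C \<in> sigma_sets UNIV {U. open U}" by auto
  qed
  then show ?thesis by (simp add: borel_def)
qed

lemma cosets_Int_stable: "Int_stable (insert {} cosets)"
  unfolding Int_stable_def
proof (intro ballI)
  fix C D assume CD: "C \<in> insert {} cosets" "D \<in> insert {} cosets"
  show "C \<inter> D \<in> insert {} cosets"
  proof (cases "C \<inter> D = {}")
    case False
    then obtain z where z: "z \<in> C" "z \<in> D" by blast
    then obtain x k y l where C: "C = (+) x ` K (- int k)" and D: "D = (+) y ` K (- int l)"
      using CD unfolding cosets_def by blast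
    have "z - x \<in> K (- int k)" "z - y \<in> K (- int l)"
      using z by (simp_all only: C D mem_coset_iff)
    then have CD_z: "C = (+) z ` K (- int k)" "D = (+) z ` K (- int l)"
      unfolding C D by (simp_all only: coset_K_eq)
    have "K (- int k) \<inter> K (- int l) = K (- int (max k l))"
      using K_mono[of "- int k" "- int l"] K_mono[of "- int l" "- int k"]
      by (cases "k \<le> l") (auto simp: max_def)
    then have "C \<inter> D = (+) z ` K (- int (max k l))"
      unfolding CD_z by (simp flip: image_Int[OF inj_on_add] )
    then show ?thesis unfolding cosets_def by blast
  qed simp
qed

text \<open>The measures \<open>B \<mapsto> m (A B)\<close> and \<open>q m\<close> agree on the cosets of the subgroups \<open>A\<^sup>-\<^sup>k H\<close>, which
  form an intersection-stable generator of the Borel sets.\<close>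
lemma emeasure_image:
  assumes B: "B \<in> sets borel" shows "emeasure m (A ` B) = of_nat q * emeasure m B"
proof -
  have inv_meas: "inv A \<in> borel_measurable borel"
    by (intro borel_measurable_continuous_onI top_automorphism_continuous top_automorphism_inv aut)
  define N where "N = distr m borel (inv A)"
  have N: "emeasure N B = emeasure m (A ` B)" if "B \<in> sets borel" for B
  proof -
    have "inv A -` B = A ` B" using bij by (simp add: bij_vimage_eq_inv_image bij_imp_bij_inv inv_inv_eq)
    then show ?thesis
      unfolding N_def using that inv_meas by (subst emeasure_distr) (auto simp: measurable_def)
  qed
  have "N = scale_measure (of_nat q) m"
  proof (rule measure_eqI_generator_eq_countable[OF cosets_Int_stable])
    show "insert {} cosets \<subseteq> Pow UNIV" by simp
    show "sets N = sigma_sets UNIV (insert {} cosets)"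
      "sets (scale_measure (of_nat q) m) = sigma_sets UNIV (insert {} cosets)"
      by (simp_all add: N_def borel_eq_cosets[symmetric])
    have coset: "emeasure N C = of_nat q * emeasure m C \<and> emeasure N C \<noteq> \<infinity>" if C: "C \<in> cosets" for C
    proof -
      obtain x k where C: "C = (+) x ` K (- int k)" using C unfolding cosets_def by blast
      have "A ` C = (+) (A x) ` (aut_pow A 1 ` K (- int k))"
        unfolding C image_image by (simp add: top_automorphism_add[OF aut] aut_pow_1)
      then have "A ` C = (+) (A x) ` K (- int k + 1)" by (simp only: image_K add.commute)
      then have "emeasure N C = emeasure m (K (- int k + 1))"
        using N[of C] by (simp add: emeasure_coset C)
      also have "\<dots> = of_nat q * emeasure m C"
        by (simp only: emeasure_K_step emeasure_coset[OF borel_K] C)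
      finally show ?thesis
        using emeasure_K_finite[of "- int k + 1"] \<open>emeasure N C = emeasure m (K (- int k + 1))\<close> by auto
    qed
    then show "emeasure N C = emeasure (scale_measure (of_nat q) m) C" if "C \<in> insert {} cosets" for C
      using that by auto
    show "countable cosets" by (rule countable_cosets)
    show "cosets \<subseteq> insert {} cosets" by blast
    show "emeasure N C \<noteq> \<infinity>" if "C \<in> cosets" for C using coset[OF that] by blast
    show "\<Union>cosets = UNIV" unfolding cosets_def using mem_coset_self by blast
  qed
  then show ?thesis using N[OF B] by simp
qed

lemma modulus_eq: "modulus m A = real q"
  unfolding modulus_def
proof (rule the_equality)
  show "0 < real q \<and> (\<forall>U\<in>sets borel. emeasure m (A ` U) = ennreal (real q) * emeasure m U)"
    using q_pos emeasure_image by (simp add: ennreal_of_nat_eq_real_of_nat)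
next
  fix c assume c: "0 < c \<and> (\<forall>U\<in>sets borel. emeasure m (A ` U) = ennreal c * emeasure m U)"
  then have "ennreal c = emeasure m (A ` H)" using open_H measure_H by simp
  also have "\<dots> = ennreal (real q)"
    using emeasure_image[of H] open_H measure_H by (simp add: ennreal_of_nat_eq_real_of_nat)
  finally show "c = real q" using c by simp
qed

lemma distr_translation: "distr m m (\<lambda>y. y - x) = m"
proof (rule measure_eqI)
  fix B assume "B \<in> sets (distr m m (\<lambda>y. y - x))"
  then have B: "B \<in> sets borel" by simp
  have "(\<lambda>y. y - x) \<in> measurable m m"
    by (simp cong: measurable_cong_sets) (intro borel_measurable_continuous_onI continuous_intros)
  moreover have "(\<lambda>y. y - x) -` B = (+) x ` B" by (auto simp: mem_coset_iff)
  ultimately show "emeasure (distr m m (\<lambda>y. y - x)) B = emeasure m B"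
    using B by (subst emeasure_distr) (simp_all add: emeasure_coset)
qed simp

lemma measurable_translation [measurable]: "(\<lambda>y. y - x) \<in> measurable m m"
  by (simp cong: measurable_cong_sets) (intro borel_measurable_continuous_onI continuous_intros)

lemma integral_translation:
  fixes f :: "'a \<Rightarrow> 'b::{banach, second_countable_topology}"
  assumes "f \<in> borel_measurable m"
  shows "(LINT y|m. f (y - x)) = (LINT y|m. f y)"
  using integral_distr[OF measurable_translation assms, of x] by (simp add: distr_translation)

lemma integrable_translation:
  fixes f :: "'a \<Rightarrow> 'b::{banach, second_countable_topology}"
  assumes "f \<in> borel_measurable m"
  shows "integrable m (\<lambda>y. f (y - x)) \<longleftrightarrow> integrable m f"
  using integrable_distr_eq[OF measurable_translation assms, of x] by (simp add: distr_translation)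

end

section \<open>Density of the step functions\<close>

abbreviation sq_norm :: "'a measure \<Rightarrow> ('a \<Rightarrow> complex) \<Rightarrow> real" where
  "sq_norm m f \<equiv> (LINT x|m. (cmod (f x))\<^sup>2)"

lemma sq_norm_add_le:
  assumes "f \<in> L2 m" "g \<in> L2 m"
  shows "sq_norm m (\<lambda>x. f x + g x) \<le> 2 * sq_norm m f + 2 * sq_norm m g"
proof -
  have "sq_norm m (\<lambda>x. f x + g x) \<le> (LINT x|m. 2 * (cmod (f x))\<^sup>2 + 2 * (cmod (g x))\<^sup>2)"
    using assms L2_square_integrable[OF L2_add[OF assms]]
    by (intro integral_mono norm_sum_squared_le) (auto simp: L2_square_integrable)
  also have "\<dots> = 2 * sq_norm m f + 2 * sq_norm m g"
    using assms by (simp add: L2_square_integrable)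
  finally show ?thesis .
qed

lemma L2_indicator:
  assumes "B \<in> sets m" "emeasure m B < \<infinity>"
  shows "indicator B \<in> L2 m"
proof -
  have "(\<lambda>x. (cmod (indicator B x))\<^sup>2) = (indicator B :: _ \<Rightarrow> real)"
    by (auto simp: indicator_def)
  then show ?thesis using assms by (simp add: L2_def)
qed

context expansive_haar
begin

text \<open>These functions form the space of dimension \<open>q\<^sup>2\<^sup>k\<close> that is spanned by the indicator functions
  of the cosets of \<open>A\<^sup>-\<^sup>k H\<close> in \<open>A\<^sup>k H\<close>.\<close>
definition step_function :: "nat \<Rightarrow> ('a \<Rightarrow> complex) \<Rightarrow> bool" where
  "step_function k v \<longleftrightarrow>
     (\<forall>t. v t \<noteq> 0 \<longrightarrow> t \<in> K (int k)) \<and> (\<forall>t s. s \<in> K (- int k) \<longrightarrow> v (t + s) = v t)"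

lemma step_function_mono:
  assumes "step_function k v" "k \<le> l" shows "step_function l v"
  using assms K_mono[of "int k" "int l"] K_mono[of "- int l" "- int k"]
  unfolding step_function_def by (meson of_nat_mono neg_le_iff_le subsetD)

lemma step_function_add:
  "step_function k v \<Longrightarrow> step_function k w \<Longrightarrow> step_function k (\<lambda>t. v t + w t)"
  unfolding step_function_def by (metis add.right_neutral)

lemma step_function_scale: "step_function k v \<Longrightarrow> step_function k (\<lambda>t. c * v t)"
  unfolding step_function_def by auto

lemma step_function_expand:
  assumes v: "step_function k v" and R: "transversal (K (int k)) (K (- int k)) R"
  shows "v t = (\<Sum>r\<in>R. v r * indicator ((+) r ` K (- int k)) t)"
proof (cases "t \<in> K (int k)")
  case True
  then obtain r where r: "r \<in> R" "t - r \<in> K (- int k)" using transversalE[OF R] by blast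
  have "t - s \<in> K (- int k) \<longleftrightarrow> s = r" if "s \<in> R" for s
    using transversal_eqI[OF R subgroup_K that r(1)] add_subgroup_diff[OF subgroup_K r(2), of "t - s"] r(2)
    by auto
  then have "(\<Sum>s\<in>R. v s * indicator ((+) s ` K (- int k)) t) = (\<Sum>s\<in>R. if s = r then v s else 0)"
    by (intro sum.cong) (simp_all add: indicator_def mem_coset_iff)
  also have "\<dots> = v r" using r(1) transversal_K_finite[OF R] by simp
  also have "\<dots> = v (r + (t - r))" using v r(2) unfolding step_function_def by metis
  finally show ?thesis by simp
next
  case False
  then have "v t = 0" using v unfolding step_function_def by blast
  moreover have "indicator ((+) r ` K (- int k)) t = (0 :: complex)" if "r \<in> R" for r
  proof -
    have "r \<in> K (int k)" using that transversal_subset[OF R] by blast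
    moreover have "t = (t - r) + r" by simp
    ultimately have "t - r \<notin> K (- int k)"
      using False K_mono[of "- int k" "int k"] add_subgroup_add[OF subgroup_K, of "t - r" "int k" r]
      by auto
    then show ?thesis by (simp add: indicator_def mem_coset_iff)
  qed
  ultimately show ?thesis by simp
qed

lemma step_function_L2:
  assumes "step_function k v" shows "v \<in> L2 m"
proof -
  obtain R where R: "transversal (K (int k)) (K (- int k)) R"
    using transversal_exists[OF subgroup_K subgroup_K] .
  have "indicator ((+) r ` K (- int k)) \<in> L2 m" for r
    using emeasure_K_finite[of "- int k"]
    by (intro L2_indicator) (simp_all add: emeasure_coset)
  then have "(\<lambda>t. \<Sum>r\<in>R. v r * indicator ((+) r ` K (- int k)) t) \<in> L2 m"
    by (intro L2_sum L2_scale)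
  moreover have "(\<lambda>t. \<Sum>r\<in>R. v r * indicator ((+) r ` K (- int k)) t) = v"
    by (intro ext) (rule step_function_expand[OF assms R, symmetric])
  ultimately show ?thesis by (simp only:)
qed

definition approximable :: "('a \<Rightarrow> complex) \<Rightarrow> bool" where
  "approximable f \<longleftrightarrow> f \<in> L2 m \<and>
     (\<forall>e>0. \<exists>k v. step_function k v \<and> sq_norm m (\<lambda>t. f t - v t) < e)"

lemma approximable_add:
  assumes f: "approximable f" and g: "approximable g"
  shows "approximable (\<lambda>t. f t + g t)"
proof -
  have fg: "f \<in> L2 m" "g \<in> L2 m" using f g unfolding approximable_def by blast+
  have "\<exists>k v. step_function k v \<and> sq_norm m (\<lambda>t. f t + g t - v t) < e" if e: "e > 0" for e
  proof -
    have "e / 4 > 0" using e by simp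
    then obtain k v l w where v: "step_function k v" "sq_norm m (\<lambda>t. f t - v t) < e / 4"
      and w: "step_function l w" "sq_norm m (\<lambda>t. g t - w t) < e / 4"
      using f g unfolding approximable_def by meson
    have "step_function (max k l) (\<lambda>t. v t + w t)"
      using v(1) w(1) by (intro step_function_add) (auto intro: step_function_mono)
    moreover have "sq_norm m (\<lambda>t. (f t - v t) + (g t - w t))
        \<le> 2 * sq_norm m (\<lambda>t. f t - v t) + 2 * sq_norm m (\<lambda>t. g t - w t)"
      using fg step_function_L2[OF v(1)] step_function_L2[OF w(1)]
      by (intro sq_norm_add_le L2_diff)
    then have "sq_norm m (\<lambda>t. f t + g t - (v t + w t)) < e"
      using v(2) w(2) by (simp add: algebra_simps)
    ultimately show ?thesis by blast
  qed
  then show ?thesis unfolding approximable_def using L2_add[OF fg] by blast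
qed

lemma approximable_scale:
  assumes f: "approximable f" shows "approximable (\<lambda>t. c * f t)"
proof -
  have fL: "f \<in> L2 m" using f unfolding approximable_def by blast
  have "\<exists>k v. step_function k v \<and> sq_norm m (\<lambda>t. c * f t - v t) < e" if e: "e > 0" for e
  proof -
    have pos: "(cmod c)\<^sup>2 + 1 > 0" by (simp add: add_nonneg_pos)
    then have "e / ((cmod c)\<^sup>2 + 1) > 0" using e by simp
    then obtain k v where v: "step_function k v" "sq_norm m (\<lambda>t. f t - v t) < e / ((cmod c)\<^sup>2 + 1)"
      using f unfolding approximable_def by meson
    have "sq_norm m (\<lambda>t. c * f t - c * v t) = (cmod c)\<^sup>2 * sq_norm m (\<lambda>t. f t - v t)"
      by (simp add: norm_mult power_mult_distrib flip: right_diff_distrib)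
    also have "\<dots> \<le> ((cmod c)\<^sup>2 + 1) * sq_norm m (\<lambda>t. f t - v t)"
      by (intro mult_right_mono) auto
    also have "\<dots> < e" using v(2) pos by (simp add: field_simps)
    finally show ?thesis using step_function_scale[OF v(1)] by blast
  qed
  then show ?thesis unfolding approximable_def using L2_scale[OF fL] by blast
qed

lemma approximable_zero: "approximable (\<lambda>t. 0)"
proof -
  have "step_function 0 (\<lambda>t. 0)" by (simp add: step_function_def)
  then show ?thesis unfolding approximable_def by (intro conjI L2_zero allI impI exI) auto
qed

lemma approximable_sum:
  "(\<And>i. i \<in> I \<Longrightarrow> approximable (f i)) \<Longrightarrow> approximable (\<lambda>t. \<Sum>i\<in>I. f i t)"
  by (induction I rule: infinite_finite_induct) (auto simp: approximable_zero intro: approximable_add)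

lemma approximable_limit:
  assumes f: "f \<in> L2 m"
    and g: "\<And>e. e > 0 \<Longrightarrow> \<exists>g. approximable g \<and> sq_norm m (\<lambda>t. f t - g t) < e"
  shows "approximable f"
proof -
  have "\<exists>k v. step_function k v \<and> sq_norm m (\<lambda>t. f t - v t) < e" if e: "e > 0" for e
  proof -
    have e4: "e / 4 > 0" using e by simp
    obtain g where g: "approximable g" "sq_norm m (\<lambda>t. f t - g t) < e / 4" using g[OF e4] by blast
    then obtain k v where v: "step_function k v" "sq_norm m (\<lambda>t. g t - v t) < e / 4"
      using e4 unfolding approximable_def by meson
    have "g \<in> L2 m" using g(1) unfolding approximable_def by blast
    then have "sq_norm m (\<lambda>t. (f t - g t) + (g t - v t))
        \<le> 2 * sq_norm m (\<lambda>t. f t - g t) + 2 * sq_norm m (\<lambda>t. g t - v t)"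
      using f step_function_L2[OF v(1)] by (intro sq_norm_add_le L2_diff)
    then have "sq_norm m (\<lambda>t. f t - v t) < e" using g(2) v(2) by simp
    with v(1) show ?thesis by blast
  qed
  with f show ?thesis unfolding approximable_def by blast
qed

text \<open>By outer regularity it suffices to approximate open sets \<open>U\<close>; and \<open>U\<close> is the increasing
  union of the sets of those points of \<open>A\<^sup>k H\<close> whose coset of \<open>A\<^sup>-\<^sup>k H\<close> lies in \<open>U\<close>.\<close>
lemma approximable_indicator:
  assumes B: "B \<in> sets borel" "emeasure m B < \<infinity>"
  shows "approximable (indicator B)"
proof -
  have "\<exists>k v. step_function k v \<and> sq_norm m (\<lambda>t. indicator B t - v t) < e" if e: "e > 0" for e :: real
  proof -
    \<comment> \<open>the error is at most \<open>m (U - B) + m (U - W)\<close>, and each of the two terms will be below \<open>d\<close>\<close>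
    define d where "d = e / 3"
    have d: "d > 0" using e by (simp add: d_def)
    have "emeasure m B = (INF U\<in>{U. open U \<and> B \<subseteq> U}. emeasure m U)"
      using haar B(1) unfolding haar_measure_def by blast
    moreover have "emeasure m B < emeasure m B + ennreal d"
      using B(2) d ennreal_add_left_cancel_less[of "emeasure m B" 0 "ennreal d"]
      by (simp add: less_top)
    ultimately obtain U where U: "open U" "B \<subseteq> U" "emeasure m U < emeasure m B + ennreal d"
      by (metis (no_types, lifting) INF_less_iff mem_Collect_eq)
    have "emeasure m B + ennreal d < \<infinity>" using B(2) by simp
    with U(3) have U_fin: "emeasure m U < \<infinity>" by (rule less_trans)
    have [measurable]: "U \<in> sets borel" using U(1) by (rule borel_open)
    define W where "W k = {x. (+) x ` K (- int k) \<subseteq> U} \<inter> K (int k)" for k :: nat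
    have W_coset: "(+) x ` K (- int k) \<subseteq> W k" if x: "x \<in> W k" for x k
    proof
      fix y assume y: "y \<in> (+) x ` K (- int k)"
      then have yx: "y - x \<in> K (- int k)" by (simp only: mem_coset_iff)
      have "(+) y ` K (- int k) = (+) x ` K (- int k)" using coset_K_eq[OF yx] by (rule sym)
      moreover have "y \<in> K (int k)"
        using yx x K_mono[of "- int k" "int k"] add_subgroup_add[OF subgroup_K, of "y - x" "int k" x]
        unfolding W_def by auto
      ultimately show "y \<in> W k" using x unfolding W_def by blast
    qed
    have W_open: "open (W k)" for k
      unfolding open_subopen[of "W k"]
    proof (rule ballI)
      fix x assume "x \<in> W k"
      from W_coset[OF this] show "\<exists>S. open S \<and> x \<in> S \<and> S \<subseteq> W k"
        by (intro exI[of _ "(+) x ` K (- int k)"] conjI open_coset open_K mem_coset_self)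
    qed
    have [measurable]: "W k \<in> sets borel" for k using W_open by (rule borel_open)
    have W_U: "W k \<subseteq> U" for k
      using mem_coset_self unfolding W_def by blast
    have "incseq W"
      unfolding incseq_def
    proof (intro allI impI)
      fix k l :: nat assume "k \<le> l"
      then have "K (- int l) \<subseteq> K (- int k)" "K (int k) \<subseteq> K (int l)"
        by (intro K_mono; simp)+
      then show "W k \<subseteq> W l" unfolding W_def by blast
    qed
    moreover have "(\<Union>k. W k) = U"
    proof
      show "U \<subseteq> (\<Union>k. W k)"
      proof
        fix x assume x: "x \<in> U"
        obtain k :: nat where k: "(+) x ` K (- int k) \<subseteq> U" by (rule coset_subset[OF U(1) x])
        obtain l :: nat where l: "x \<in> K (int l)" by (rule K_exhausts)
        have "K (- int (max k l)) \<subseteq> K (- int k)" "K (int l) \<subseteq> K (int (max k l))"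
          by (intro K_mono; simp)+
        with k l have "x \<in> W (max k l)" unfolding W_def by blast
        then show "x \<in> (\<Union>k. W k)" by blast
      qed
    qed (use W_U in blast)
    ultimately have "(\<lambda>k. measure m (W k)) \<longlonglongrightarrow> measure m U"
      using Lim_measure_incseq[of W m] U_fin by (simp add: less_top image_subset_iff)
    then obtain k where k: "measure m U - d < measure m (W k)"
      using d by (metis (no_types, lifting) order_tendstoD(1) diff_less_eq less_add_same_cancel1 eventually_sequentially order_refl)
    define v where "v = (indicator (W k) :: 'a \<Rightarrow> complex)"
    have "step_function k v"
      unfolding step_function_def
    proof (intro conjI allI impI)
      fix t assume "v t \<noteq> 0"
      then show "t \<in> K (int k)" by (auto simp: v_def W_def indicator_def split: if_splits)
    next
      fix t s assume s: "s \<in> K (- int k)"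
      have "t + s \<in> (+) t ` K (- int k)" "t \<in> (+) (t + s) ` K (- int k)"
        using s add_subgroup_minus[OF subgroup_K s] by (simp_all add: mem_coset_iff)
      then have "t + s \<in> W k \<longleftrightarrow> t \<in> W k" using W_coset by blast
      then show "v (t + s) = v t" by (simp add: v_def indicator_def)
    qed
    moreover have "sq_norm m (\<lambda>t. indicator B t - v t) < e"
    proof -
      have fin: "emeasure m (U - S) < \<infinity>" "emeasure m S < \<infinity>" if "S \<in> sets borel" "S \<subseteq> U" for S
        using that emeasure_mono[of "U - S" U m] emeasure_mono[of S U m] U_fin
        by (auto simp: le_less_trans)
      have meas: "measure m (U - S) = measure m U - measure m S" if "S \<in> sets borel" "S \<subseteq> U" for S
        using that fin[OF that] U_fin by (intro measure_Diff) auto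
      have UB: "measure m U - measure m B < d"
      proof -
        have "ennreal (measure m U) < ennreal (measure m B) + ennreal d"
          using U(3) U_fin B(2) by (simp add: emeasure_eq_ennreal_measure less_top)
        also have "\<dots> = ennreal (measure m B + d)" using d by (simp add: ennreal_plus)
        finally show ?thesis by (simp add: ennreal_less_iff)
      qed
      have int: "integrable m (indicator (U - S) :: 'a \<Rightarrow> real)" if "S \<in> sets borel" "S \<subseteq> U" for S
        using that fin[OF that] by (intro integrable_real_indicator) auto
      have "sq_norm m (\<lambda>t. indicator B t - v t)
          \<le> (LINT t|m. indicator (U - B) t + indicator (U - W k) t)"
      proof (rule integral_mono)
        have "indicator B \<in> L2 m" "v \<in> L2 m"
          using B step_function_L2[OF \<open>step_function k v\<close>] by (simp_all add: L2_indicator)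
        then show "integrable m (\<lambda>t. (cmod (indicator B t - v t))\<^sup>2)"
          by (intro L2_square_integrable L2_diff)
        show "integrable m (\<lambda>t. indicator (U - B) t + indicator (U - W k) t :: real)"
          using int[OF B(1) U(2)] int[OF _ W_U[of k]] by simp
        show "(cmod (indicator B t - v t))\<^sup>2 \<le> indicator (U - B) t + indicator (U - W k) t" for t
          using U(2) W_U[of k] by (auto simp: v_def indicator_def)
      qed
      also have "\<dots> = measure m (U - B) + measure m (U - W k)"
        using int[OF B(1) U(2)] int[OF _ W_U[of k]] by simp
      also have "\<dots> < e" using meas[OF B(1) U(2)] meas[OF _ W_U[of k]] UB k d by (simp add: d_def)
      finally show ?thesis .
    qed
    ultimately show ?thesis by blast
  qed
  then show ?thesis unfolding approximable_def using B by (simp add: L2_indicator)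
qed

text \<open>Simple functions that converge to \<open>f\<close> pointwise and are dominated by \<open>2 \<bar>f\<bar>\<close> converge in the
  \<open>L\<^sup>2\<close> norm, and they are combinations of indicator functions of sets of finite measure.\<close>
lemma L2_approximable:
  assumes f: "f \<in> L2 m" shows "approximable f"
proof -
  obtain s where s: "\<And>i. simple_function m (s i)" "\<And>x. (\<lambda>i. s i x) \<longlonglongrightarrow> f x"
    "\<And>i x. cmod (s i x) \<le> 2 * cmod (f x)"
    using borel_measurable_implies_sequence_metric[OF L2_measurable[OF f], of 0] by auto
  have s_meas [measurable]: "s i \<in> borel_measurable m" for i
    using s(1) by (rule borel_measurable_simple_function)
  have f_meas [measurable]: "f \<in> borel_measurable m" by (rule L2_measurable[OF f])
  have s_L2: "s i \<in> L2 m" for i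
  proof -
    have "integrable m (\<lambda>x. (cmod (s i x))\<^sup>2)"
    proof (rule Bochner_Integration.integrable_bound)
      show "integrable m (\<lambda>x. 4 * (cmod (f x))\<^sup>2)" using L2_square_integrable[OF f] by simp
      have "(cmod (s i x))\<^sup>2 \<le> (2 * cmod (f x))\<^sup>2" for x by (intro power_mono s(3)) auto
      then show "AE x in m. norm ((cmod (s i x))\<^sup>2) \<le> norm (4 * (cmod (f x))\<^sup>2)"
        by (simp add: power_mult_distrib)
    qed measurable
    then show ?thesis by (simp add: L2_def)
  qed
  have approx: "approximable (s i)" for i
  proof -
    have fin: "finite (s i ` UNIV)" using simple_functionD(1)[OF s(1)[of i]] by simp
    have "approximable (\<lambda>x. y * indicator (s i -` {y}) x)" for y
    proof (cases "y = 0")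
      case True
      then show ?thesis using approximable_zero by simp
    next
      case False
      have B: "s i -` {y} \<in> sets borel"
        using measurable_sets[OF s_meas[of i], of "{y}"] by simp
      have "integrable m (indicator (s i -` {y}) :: 'a \<Rightarrow> real)"
      proof (rule Bochner_Integration.integrable_bound)
        show "integrable m (\<lambda>x. (cmod (s i x))\<^sup>2 / (cmod y)\<^sup>2)"
          using L2_square_integrable[OF s_L2] by simp
        show "AE x in m. norm (indicator (s i -` {y}) x :: real) \<le> norm ((cmod (s i x))\<^sup>2 / (cmod y)\<^sup>2)"
          using False by (intro AE_I2) (auto simp: indicator_def)
      qed (use B in simp)
      then have "emeasure m (s i -` {y}) < \<infinity>" by (simp add: integrable_indicator_iff)
      with B show ?thesis by (intro approximable_scale approximable_indicator)
    qed
    then have "approximable (\<lambda>x. \<Sum>y\<in>s i ` UNIV. y * indicator (s i -` {y}) x)"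
      by (intro approximable_sum)
    moreover have "(\<Sum>y\<in>s i ` UNIV. y * indicator (s i -` {y}) x) = s i x" for x
    proof -
      have "(\<Sum>y\<in>s i ` UNIV. y * indicator (s i -` {y}) x) = (\<Sum>y\<in>s i ` UNIV. if y = s i x then y else 0)"
        by (intro sum.cong) (auto simp: indicator_def)
      then show ?thesis using fin by simp
    qed
    ultimately show ?thesis by simp
  qed
  have "(\<lambda>i. sq_norm m (\<lambda>x. f x - s i x)) \<longlonglongrightarrow> (LINT x|m. 0)"
  proof (rule integral_dominated_convergence)
    show "integrable m (\<lambda>x. 9 * (cmod (f x))\<^sup>2)" using L2_square_integrable[OF f] by simp
    have "(\<lambda>i. (cmod (f x - s i x))\<^sup>2) \<longlonglongrightarrow> (cmod (f x - f x))\<^sup>2" for x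
      by (intro tendsto_intros s(2))
    then show "AE x in m. (\<lambda>i. (cmod (f x - s i x))\<^sup>2) \<longlonglongrightarrow> 0" by simp
    have "(cmod (f x - s i x))\<^sup>2 \<le> (3 * cmod (f x))\<^sup>2" for x i
      using norm_triangle_ineq4[of "f x" "s i x"] s(3)[of i x] by (intro power_mono) auto
    then show "AE x in m. norm ((cmod (f x - s i x))\<^sup>2) \<le> 9 * (cmod (f x))\<^sup>2" for i
      by (simp add: power_mult_distrib)
  qed measurable
  then have lim: "(\<lambda>i. sq_norm m (\<lambda>x. f x - s i x)) \<longlonglongrightarrow> 0" by simp
  show ?thesis
  proof (rule approximable_limit[OF f])
    fix e :: real assume "e > 0"
    from order_tendstoD(2)[OF lim this] obtain i where "sq_norm m (\<lambda>x. f x - s i x) < e"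
      unfolding eventually_sequentially by blast
    then show "\<exists>g. approximable g \<and> sq_norm m (\<lambda>t. f t - g t) < e" using approx by blast
  qed
qed

end

section \<open>Time-frequency shifts of the window\<close>

lemma num_points_finite: "finite X \<Longrightarrow> num_points X = of_nat (card X)"
  by (simp add: num_points_def)

lemma num_points_le_1:
  assumes "num_points X \<le> 1" shows "finite X" "card X \<le> 1"
proof -
  show fin: "finite X"
  proof (rule ccontr)
    assume "infinite X"
    then have "num_points X = \<infinity>" by (simp add: num_points_def)
    with assms show False by (simp add: top_unique)
  qed
  show "card X \<le> 1"
    using assms num_points_finite[OF fin] of_nat_le_iff[of "card X" 1, where 'a = ennreal] by simp
qed

lemma borel_measurable_pairing [measurable]: "(\<lambda>t. pairing t \<xi>) \<in> borel_measurable borel"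
  by (intro borel_measurable_continuous_onI continuous_on_pairing)

lemma gabor_apply: "gabor f p t = pairing t (snd p) * f (t - fst p)"
  by (cases p) (simp add: gabor_def modulation_def translation_def)

lemma gabor_diff: "gabor f p t - gabor g p t = gabor (\<lambda>s. f s - g s) p t"
  by (simp add: gabor_apply right_diff_distrib)

context expansive_haar
begin

lemma gabor_measurable:
  assumes [measurable]: "f \<in> borel_measurable m" shows "gabor f p \<in> borel_measurable m"
proof -
  have "(\<lambda>t. f (t - fst p)) \<in> borel_measurable m"
    by (rule measurable_compose[OF measurable_translation assms])
  moreover have "(\<lambda>t. pairing t (snd p)) \<in> borel_measurable m"
    using borel_measurable_pairing by (simp cong: measurable_cong_sets)
  ultimately have "(\<lambda>t. pairing t (snd p) * f (t - fst p)) \<in> borel_measurable m"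
    by (rule borel_measurable_times[rotated])
  then show ?thesis by (simp add: gabor_apply[abs_def])
qed

lemma gabor_L2:
  assumes f: "f \<in> L2 m" shows "gabor f p \<in> L2 m"
proof -
  have "(\<lambda>t. (cmod (f t))\<^sup>2) \<in> borel_measurable m" using L2_measurable[OF f] by measurable
  from integrable_translation[OF this, of "fst p"]
  have "integrable m (\<lambda>t. (cmod (gabor f p t))\<^sup>2)"
    using L2_square_integrable[OF f] by (simp add: gabor_apply norm_mult)
  with gabor_measurable[OF L2_measurable[OF f]] show ?thesis by (simp add: L2_def)
qed

lemma sq_norm_gabor:
  assumes f: "f \<in> L2 m" shows "sq_norm m (gabor f p) = sq_norm m f"
proof -
  have "(\<lambda>t. (cmod (f t))\<^sup>2) \<in> borel_measurable m" using L2_measurable[OF f] by measurable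
  from integral_translation[OF this, of "fst p"] show ?thesis
    by (simp add: gabor_apply norm_mult)
qed

text \<open>Up to a phase, \<open>\<pi>(p')\<^sup>* \<pi>(p)\<close> is \<open>\<pi>(p - p')\<close>.\<close>
lemma gabor_covariance:
  assumes f: "f \<in> L2 m" and g: "g \<in> L2 m"
  shows "cmod (L2_inner m (gabor f p) (gabor g p')) = cmod (L2_inner m (gabor f (p - p')) g)"
proof -
  define c where "c = pairing (fst p') (snd p - snd p')"
  define F where "F = (\<lambda>t. c * (gabor f (p - p') t * cnj (g t)))"
  have "F \<in> borel_measurable m"
    unfolding F_def using integrable_L2_product[OF gabor_L2[OF f] g]
    by (intro borel_measurable_times borel_measurable_const borel_measurable_integrable)
  have "gabor f p t * cnj (gabor g p' t) = F (t - fst p')" for t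
  proof -
    have "pairing t (snd p - snd p') = pairing ((t - fst p') + fst p') (snd p - snd p')" by simp
    also have "\<dots> = pairing (t - fst p') (snd p - snd p') * c"
      by (simp only: pairing_add_left c_def)
    finally show ?thesis
      by (simp add: F_def gabor_apply pairing_minus_right algebra_simps)
  qed
  then have "L2_inner m (gabor f p) (gabor g p') = (LINT t|m. F (t - fst p'))"
    by (simp add: L2_inner_def)
  also have "\<dots> = c * L2_inner m (gabor f (p - p')) g"
    unfolding integral_translation[OF \<open>F \<in> borel_measurable m\<close>] by (simp add: F_def L2_inner_def)
  finally show ?thesis by (simp add: norm_mult c_def)
qed

definition window :: "'a \<Rightarrow> complex" where "window = indicator H"

lemma window_L2: "window \<in> L2 m"
  unfolding window_def using open_H measure_H by (intro L2_indicator) auto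

lemma sq_norm_window: "sq_norm m window = 1"
proof -
  have "(\<lambda>t. (cmod (window t))\<^sup>2) = (indicator H :: 'a \<Rightarrow> real)"
    by (auto simp: window_def indicator_def)
  then show ?thesis using open_H measure_H by (simp add: measure_def)
qed

lemma Q_0: "Q 0 = H \<times> annihilator H"
  by (simp add: Q_def K_0)

lemma integral_character_H:
  assumes "\<xi> \<notin> annihilator H"
  shows "(LINT t|m. pairing t \<xi> * indicator H t) = 0"
proof -
  obtain h where h: "h \<in> H" "pairing h \<xi> \<noteq> 1" using assms by (auto simp: annihilator_def)
  define F where "F = (\<lambda>t. pairing t \<xi> * indicator H t :: complex)"
  have "F = gabor window (0, \<xi>)" by (simp add: F_def window_def gabor_apply fun_eq_iff)
  then have F: "F \<in> borel_measurable m" using gabor_measurable[OF L2_measurable[OF window_L2]] by simp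
  have "F (t - h) = cnj (pairing h \<xi>) * F t" for t
  proof -
    have "t - h \<in> H \<longleftrightarrow> t \<in> H"
      using h(1) add_subgroup_add[OF H, of "t - h" h] add_subgroup_diff[OF H] by auto
    moreover have "pairing (t - h) \<xi> = pairing t \<xi> * cnj (pairing h \<xi>)"
      using pairing_add_left[of t "- h" \<xi>] by (simp add: pairing_minus_left)
    ultimately show ?thesis by (simp add: F_def indicator_def)
  qed
  then have "(LINT t|m. F t) = cnj (pairing h \<xi>) * (LINT t|m. F t)"
    using integral_translation[OF F, of h] by simp
  moreover have "cnj (pairing h \<xi>) \<noteq> 1" using h(2) by (metis complex_cnj_cnj complex_cnj_one)
  ultimately show ?thesis by (simp add: F_def)
qed

text \<open>If the first components differ modulo \<open>H\<close>, the supports are disjoint; otherwise the inner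
  product is the integral over \<open>H\<close> of a nontrivial character of \<open>H\<close>.\<close>
lemma window_gabor_orthogonal:
  assumes "p - p' \<notin> Q 0"
  shows "L2_inner m (gabor window p) (gabor window p') = 0"
proof -
  obtain x \<xi> where z: "p - p' = (x, \<xi>)" by (cases "p - p'")
  have "L2_inner m (gabor window (p - p')) window = 0"
  proof (cases "x \<in> H")
    case False
    have "t \<in> H \<Longrightarrow> t - x \<notin> H" for t
      using False add_subgroup_diff[OF H, of t "t - x"] by auto
    then show ?thesis
      unfolding L2_inner_def z by (intro integral_eq_zero_AE AE_I2) (auto simp: gabor_apply window_def indicator_def)
  next
    case True
    then have \<xi>: "\<xi> \<notin> annihilator H" using assms by (simp add: z Q_0)
    have "t - x \<in> H \<longleftrightarrow> t \<in> H" for t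
      using True add_subgroup_add[OF H, of "t - x" x] add_subgroup_diff[OF H] by auto
    then have "gabor window (x, \<xi>) t * cnj (window t) = pairing t \<xi> * indicator H t" for t
      by (simp add: gabor_apply window_def indicator_def)
    then show ?thesis using integral_character_H[OF \<xi>] by (simp add: L2_inner_def z)
  qed
  then have "cmod (L2_inner m (gabor window p) (gabor window p')) = 0"
    by (simp add: gabor_covariance[OF window_L2 window_L2])
  then show ?thesis by simp
qed

lemma window_gabor_orthonormal:
  assumes T: "\<And>p p'. p \<in> F \<Longrightarrow> p' \<in> F \<Longrightarrow> p - p' \<in> Q 0 \<Longrightarrow> p = p'" and "p \<in> F" "p' \<in> F"
  shows "L2_inner m (gabor window p) (gabor window p') = (if p = p' then 1 else 0)"
proof (cases "p = p'")
  case True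
  then show ?thesis
    by (simp add: L2_inner_self sq_norm_gabor[OF window_L2] sq_norm_window)
next
  case False
  then have "p - p' \<notin> Q 0" using assms by blast
  then show ?thesis using False window_gabor_orthogonal by simp
qed

text \<open>The squared modulus of the short-time Fourier transform of \<open>\<phi>\<close> with window \<open>1\<^sub>H\<close>.\<close>
definition spectrogram :: "('a \<Rightarrow> complex) \<Rightarrow> 'a \<times> 'a dual \<Rightarrow> real" where
  "spectrogram \<phi> z = (cmod (L2_inner m (gabor window z) \<phi>))\<^sup>2"

text \<open>A time-frequency shift by a point of \<open>H \<times> H\<^sup>\<bottom>\<close> does not move \<open>1\<^sub>H\<close>, because the characters in
  \<open>H\<^sup>\<bottom>\<close> are 1 on \<open>H\<close>.\<close>
lemma spectrogram_Q_0:
  assumes "z - w \<in> Q 0" shows "spectrogram \<phi> z = spectrogram \<phi> w"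
proof -
  have x: "fst z - fst w \<in> H" and \<xi>: "snd z - snd w \<in> annihilator H"
    using assms by (auto simp: Q_0 mem_Times_iff)
  define c where "c = pairing (fst w) (snd z - snd w)"
  have "gabor window z t = c * gabor window w t" for t
  proof -
    have "t - fst w \<in> H \<longleftrightarrow> t - fst z \<in> H"
      using add_subgroup_add[OF H, of "t - fst z" "fst z - fst w"]
        add_subgroup_diff[OF H, of "t - fst w" "fst z - fst w"] x by auto
    moreover have "pairing t (snd z) = c * pairing t (snd w)" if "t - fst w \<in> H"
    proof -
      have "pairing t (snd z) = pairing t (snd w) * pairing t (snd z - snd w)"
        using pairing_plus[of t "snd w" "snd z - snd w"] by simp
      also have "pairing t (snd z - snd w) = pairing (t - fst w) (snd z - snd w) * c"
        using pairing_add_left[of "t - fst w" "fst w" "snd z - snd w"] by (simp add: c_def)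
      also have "pairing (t - fst w) (snd z - snd w) = 1"
        using \<xi> that by (simp add: annihilator_def)
      finally show ?thesis by simp
    qed
    ultimately show ?thesis by (auto simp: gabor_apply window_def indicator_def)
  qed
  then have "L2_inner m (gabor window z) \<phi> = c * L2_inner m (gabor window w) \<phi>"
    by (simp add: L2_inner_def mult.assoc)
  then show ?thesis by (simp add: spectrogram_def norm_mult c_def)
qed

lemma spectrogram_sum_le:
  assumes \<phi>: "\<phi> \<in> L2 m" and F: "finite F" "\<And>p p'. p \<in> F \<Longrightarrow> p' \<in> F \<Longrightarrow> p - p' \<in> Q 0 \<Longrightarrow> p = p'"
  shows "(\<Sum>z\<in>F. spectrogram \<phi> z) \<le> sq_norm m \<phi>"
proof -
  have "(\<Sum>z\<in>F. (cmod (L2_inner m \<phi> (gabor window z)))\<^sup>2) \<le> sq_norm m \<phi>"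
    using window_gabor_orthonormal[of F] F(2)
    by (intro L2_bessel F(1) gabor_L2 window_L2 \<phi>) auto
  moreover have "cmod (L2_inner m \<phi> (gabor window z)) = cmod (L2_inner m (gabor window z) \<phi>)" for z
    by (subst L2_inner_cnj) simp
  ultimately show ?thesis by (simp add: spectrogram_def)
qed

text \<open>The box \<open>Q 0\<close> is covered by finitely many translates of \<open>Q n\<close>, each of which contains at most
  one point.\<close>
lemma separated_Q_0:
  assumes "uniformly_separated A H \<Lambda>"
  obtains B :: nat where "\<And>p. finite {l \<in> \<Lambda>. l - p \<in> Q 0}" "\<And>p. card {l \<in> \<Lambda>. l - p \<in> Q 0} \<le> B"
proof -
  obtain n where n: "\<And>p. num_points (\<Lambda> \<inter> box_Q A H n p) \<le> 1"
    using assms unfolding uniformly_separated_def by blast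
  obtain T where T: "transversal (Q 0) (Q n) T" "finite T"
    using transversal_Q_exists[of 0 n] by metis
  have sub: "{l \<in> \<Lambda>. l - p \<in> Q 0} \<subseteq> (\<Union>t\<in>T. \<Lambda> \<inter> box_Q A H n (p + t))" for p
  proof
    fix l assume l: "l \<in> {l \<in> \<Lambda>. l - p \<in> Q 0}"
    then obtain t where "t \<in> T" "l - p - t \<in> Q n" using transversalE[OF T(1)] by blast
    with l show "l \<in> (\<Union>t\<in>T. \<Lambda> \<inter> box_Q A H n (p + t))"
      by (auto simp: box_Q_iff diff_diff_eq)
  qed
  note fin = num_points_le_1[OF n]
  have fin_UN: "finite (\<Union>t\<in>T. \<Lambda> \<inter> box_Q A H n (p + t))" for p
    by (rule finite_UN_I[OF T(2) fin(1)])
  have "card {l \<in> \<Lambda>. l - p \<in> Q 0} \<le> card T" for p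
  proof -
    have "card {l \<in> \<Lambda>. l - p \<in> Q 0} \<le> card (\<Union>t\<in>T. \<Lambda> \<inter> box_Q A H n (p + t))"
      by (intro card_mono sub fin_UN)
    also have "\<dots> \<le> (\<Sum>t\<in>T. card (\<Lambda> \<inter> box_Q A H n (p + t)))" by (rule card_UN_le[OF T(2)])
    also have "\<dots> \<le> (\<Sum>t\<in>T. 1)" by (intro sum_mono fin(2))
    finally show ?thesis by simp
  qed
  moreover have "finite {l \<in> \<Lambda>. l - p \<in> Q 0}" for p
    by (rule finite_subset[OF sub fin_UN])
  ultimately show ?thesis using that by blast
qed

lemma separated_finite:
  assumes "uniformly_separated A H \<Lambda>" shows "finite {l \<in> \<Lambda>. l - p \<in> Q n}"
proof -
  obtain B :: nat where B: "\<And>p. finite {l \<in> \<Lambda>. l - p \<in> Q 0}" "\<And>p. card {l \<in> \<Lambda>. l - p \<in> Q 0} \<le> B"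
    using separated_Q_0[OF assms] by blast
  obtain T where T: "transversal (Q n) (Q 0) T" "finite T"
    using transversal_Q_exists[of n 0] by metis
  have "{l \<in> \<Lambda>. l - p \<in> Q n} \<subseteq> (\<Union>t\<in>T. {l \<in> \<Lambda>. l - (p + t) \<in> Q 0})"
  proof
    fix l assume l: "l \<in> {l \<in> \<Lambda>. l - p \<in> Q n}"
    then obtain t where "t \<in> T" "l - p - t \<in> Q 0" using transversalE[OF T(1)] by blast
    with l show "l \<in> (\<Union>t\<in>T. {l \<in> \<Lambda>. l - (p + t) \<in> Q 0})"
      by (auto simp: diff_diff_eq)
  qed
  moreover have "finite (\<Union>t\<in>T. {l \<in> \<Lambda>. l - (p + t) \<in> Q 0})" using T(2) B(1) by blast
  ultimately show ?thesis by (rule finite_subset)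
qed

text \<open>The homogeneous approximation property: one radius \<open>k\<close> serves all centres \<open>\<mu>\<close>. Indeed
  \<open>\<bar>\<langle>\<pi>(\<mu>) 1\<^sub>H, \<pi>(\<lambda>) \<phi>\<rangle>\<bar>\<^sup>2\<close> is the value of the spectrogram on the \<open>Q 0\<close>-coset of \<open>\<mu> - \<lambda>\<close>. Its sum over
  all cosets is finite, so the sum over the cosets outside some box is small, and every coset is hit by
  boundedly many \<open>\<lambda>\<close>.\<close>
lemma gabor_tail:
  assumes sep: "uniformly_separated A H \<Lambda>" and \<phi>: "\<phi> \<in> L2 m" and e: "e > 0"
  obtains k :: nat where "\<And>\<mu> F. finite F \<Longrightarrow> F \<subseteq> {l \<in> \<Lambda>. l - \<mu> \<notin> Q (int k)} \<Longrightarrow>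
     (\<Sum>l\<in>F. (cmod (L2_inner m (gabor window \<mu>) (gabor \<phi> l)))\<^sup>2) \<le> e"
proof -
  obtain B :: nat where B: "\<And>p. finite {l \<in> \<Lambda>. l - p \<in> Q 0}" "\<And>p. card {l \<in> \<Lambda>. l - p \<in> Q 0} \<le> B"
    using separated_Q_0[OF sep] by blast
  have "add_subgroup (UNIV :: ('a \<times> 'a dual) set)" by (simp add: add_subgroup_def)
  then obtain T where T: "transversal UNIV (Q 0) T" using transversal_exists[OF _ subgroup_Q] by metis
  have pos: "spectrogram \<phi> z \<ge> 0" for z by (simp add: spectrogram_def)
  define X where "X = {F. finite F \<and> F \<subseteq> T}"
  have X_le: "sum (spectrogram \<phi>) F \<le> sq_norm m \<phi>" if "F \<in> X" for F
  proof (rule spectrogram_sum_le[OF \<phi>])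
    show "finite F" using that by (simp add: X_def)
    fix z w assume "z \<in> F" "w \<in> F" "z - w \<in> Q 0"
    then show "z = w" using that transversal_eqI[OF T subgroup_Q] unfolding X_def by blast
  qed
  then have bdd: "bdd_above (sum (spectrogram \<phi>) ` X)" by (intro bdd_aboveI2)
  define s where "s = (SUP F\<in>X. sum (spectrogram \<phi>) F)"
  \<comment> \<open>the factor \<open>B\<close> of the multiplicities must be absorbed, and \<open>B\<close> may be 0\<close>
  define d where "d = e / (real B + 1)"
  have d: "d > 0" using e by (simp add: d_def)
  \<comment> \<open>\<open>F0\<close> carries all but \<open>d\<close> of the total mass \<open>s\<close> of the spectrogram, and \<open>Q k\<close> will contain \<open>F0\<close>\<close>
  have "{} \<in> X" by (simp add: X_def)
  then obtain F0 where F0: "F0 \<in> X" "s - d < sum (spectrogram \<phi>) F0"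
    using less_cSUP_iff[of X "sum (spectrogram \<phi>)" "s - d"] bdd d unfolding s_def by auto
  have tail: "sum (spectrogram \<phi>) F \<le> d" if F: "finite F" "F \<subseteq> T - F0" for F
  proof -
    have "F \<union> F0 \<in> X" using F F0(1) by (auto simp: X_def)
    then have "sum (spectrogram \<phi>) (F \<union> F0) \<le> s" unfolding s_def by (rule cSUP_upper[OF _ bdd])
    moreover have "sum (spectrogram \<phi>) (F \<union> F0) = sum (spectrogram \<phi>) F + sum (spectrogram \<phi>) F0"
      using F F0(1) by (intro sum.union_disjoint) (auto simp: X_def)
    ultimately show ?thesis using F0(2) by linarith
  qed
  have "\<exists>n::nat. z \<in> Q (int n)" for z using Q_exhausts by metis
  then obtain N where N: "\<And>z. z \<in> Q (int (N z))" by metis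
  define k where "k = Max (insert 0 (N ` F0))"
  have k: "z \<in> Q (int k)" if "z \<in> F0" for z
  proof -
    have "N z \<le> k" unfolding k_def using that F0(1) by (intro Max_ge) (auto simp: X_def)
    then show ?thesis using N[of z] Q_mono[of "int (N z)" "int k"] by auto
  qed
  show ?thesis
  proof (rule that[of k])
    fix \<mu> F assume F: "finite F" "F \<subseteq> {l \<in> \<Lambda>. l - \<mu> \<notin> Q (int k)}"
    have "\<exists>t. t \<in> T \<and> \<mu> - l - t \<in> Q 0" for l using transversalE[OF T] by (metis UNIV_I)
    then obtain \<tau> where \<tau>: "\<And>l. \<tau> l \<in> T" "\<And>l. \<mu> - l - \<tau> l \<in> Q 0" by metis
    have \<tau>_F0: "\<tau> l \<notin> F0" if "l \<in> F" for l
    proof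
      assume "\<tau> l \<in> F0"
      then have "\<tau> l \<in> Q (int k)" by (rule k)
      moreover have "\<mu> - l - \<tau> l \<in> Q (int k)" by (rule subsetD[OF Q_mono \<tau>(2)]) simp
      ultimately have "\<mu> - l \<in> Q (int k)" using add_subgroup_add[OF subgroup_Q] by fastforce
      then show False using that F(2) add_subgroup_diff_swap[OF subgroup_Q] by blast
    qed
    have fibre: "card {l \<in> F. \<tau> l = z} \<le> B" for z
    proof -
      have "{l \<in> F. \<tau> l = z} \<subseteq> {l \<in> \<Lambda>. l - (\<mu> - z) \<in> Q 0}"
      proof
        fix l assume l: "l \<in> {l \<in> F. \<tau> l = z}"
        then have "\<mu> - l - z \<in> Q 0" using \<tau>(2) by blast
        then have "- (\<mu> - l - z) \<in> Q 0" by (rule add_subgroup_minus[OF subgroup_Q])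
        moreover have "- (\<mu> - l - z) = l - (\<mu> - z)" by (simp add: algebra_simps)
        ultimately have "l - (\<mu> - z) \<in> Q 0" by (simp only:)
        then show "l \<in> {l \<in> \<Lambda>. l - (\<mu> - z) \<in> Q 0}" using l F(2) by blast
      qed
      then show ?thesis using card_mono[OF B(1)] B(2) order_trans by blast
    qed
    have "(\<Sum>l\<in>F. (cmod (L2_inner m (gabor window \<mu>) (gabor \<phi> l)))\<^sup>2) = (\<Sum>l\<in>F. spectrogram \<phi> (\<tau> l))"
      using spectrogram_Q_0[OF \<tau>(2)]
      by (simp add: gabor_covariance[OF window_L2 \<phi>] flip: spectrogram_def)
    also have "\<dots> = (\<Sum>z\<in>\<tau> ` F. real (card {l \<in> F. \<tau> l = z}) * spectrogram \<phi> z)"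
      using F(1) by (intro sum_fun_comp) auto
    also have "\<dots> \<le> (\<Sum>z\<in>\<tau> ` F. real B * spectrogram \<phi> z)"
      using fibre pos by (intro sum_mono mult_right_mono) auto
    also have "\<dots> = real B * sum (spectrogram \<phi>) (\<tau> ` F)" by (simp add: sum_distrib_left)
    also have "\<dots> \<le> real B * d"
      using F(1) \<tau>(1) \<tau>_F0 by (intro mult_left_mono tail) auto
    also have "\<dots> \<le> e" using e by (simp add: d_def field_simps)
    finally show "(\<Sum>l\<in>F. (cmod (L2_inner m (gabor window \<mu>) (gabor \<phi> l)))\<^sup>2) \<le> e" .
  qed
qed

end

section \<open>Lower bounds for frames and Riesz bases\<close>

lemma sum_infsum_le_finite_sums:
  fixes f :: "'j \<Rightarrow> 'i \<Rightarrow> real"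
  assumes "finite J" and f: "\<And>j. j \<in> J \<Longrightarrow> f j summable_on I"
    and b: "\<And>F. finite F \<Longrightarrow> F \<subseteq> I \<Longrightarrow> (\<Sum>j\<in>J. \<Sum>i\<in>F. f j i) \<le> b"
  shows "(\<Sum>j\<in>J. \<Sum>\<^sub>\<infinity>i\<in>I. f j i) \<le> b"
proof (rule tendsto_upperbound)
  show "((\<lambda>F. \<Sum>j\<in>J. sum (f j) F) \<longlongrightarrow> (\<Sum>j\<in>J. \<Sum>\<^sub>\<infinity>i\<in>I. f j i)) (finite_subsets_at_top I)"
    using f by (intro tendsto_sum) (simp add: has_sum_def[symmetric])
  show "eventually (\<lambda>F. (\<Sum>j\<in>J. sum (f j) F) \<le> b) (finite_subsets_at_top I)"
    using b by (intro eventually_finite_subsets_at_top_weakI)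
qed simp

lemma L2_frame_lower_bound:
  assumes "L2_frame m I \<phi>"
  obtains a where "a > 0" "\<And>f. f \<in> L2 m \<Longrightarrow> (\<lambda>i. (cmod (L2_inner m f (\<phi> i)))\<^sup>2) summable_on I"
    "\<And>f. f \<in> L2 m \<Longrightarrow> a * sq_norm m f \<le> (\<Sum>\<^sub>\<infinity>i\<in>I. (cmod (L2_inner m f (\<phi> i)))\<^sup>2)"
  using assms unfolding L2_frame_def L2_norm_squared by metis

text \<open>Let \<open>f = \<Sum> u\<^sub>i \<phi>\<^sub>i\<close> and \<open>h = \<Sum> u\<^sub>i \<psi>\<^sub>i\<close>. By biorthogonality the number \<open>s = \<Sum> \<bar>u\<^sub>i\<bar>\<^sup>2\<close> is both
  \<open>\<langle>f, h\<rangle>\<close> and the sum of all \<open>\<bar>\<langle>h, \<phi>\<^sub>i\<rangle>\<bar>\<^sup>2\<close>, so the lower frame bound for \<open>h\<close> gives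
  \<open>s\<^sup>2 \<le> \<parallel>f\<parallel>\<^sup>2 \<parallel>h\<parallel>\<^sup>2 \<le> \<parallel>f\<parallel>\<^sup>2 s / a\<close>.\<close>
lemma riesz_lower_bound:
  assumes a: "a > 0"
    and lower: "\<And>f. f \<in> L2 m \<Longrightarrow> a * sq_norm m f \<le> (\<Sum>\<^sub>\<infinity>i\<in>I. (cmod (L2_inner m f (\<phi> i)))\<^sup>2)"
    and \<phi>: "\<And>i. i \<in> I \<Longrightarrow> \<phi> i \<in> L2 m" and \<psi>: "\<And>i. i \<in> I \<Longrightarrow> \<psi> i \<in> L2 m"
    and biorth: "\<And>i j. i \<in> I \<Longrightarrow> j \<in> I \<Longrightarrow> L2_inner m (\<phi> i) (\<psi> j) = (if i = j then 1 else 0)"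
    and F: "finite F" "F \<subseteq> I"
  shows "a * (\<Sum>i\<in>F. (cmod (u i))\<^sup>2) \<le> sq_norm m (\<lambda>t. \<Sum>i\<in>F. u i * \<phi> i t)"
proof -
  define s where "s = (\<Sum>i\<in>F. (cmod (u i))\<^sup>2)"
  define f where "f = (\<lambda>t. \<Sum>i\<in>F. u i * \<phi> i t)"
  define h where "h = (\<lambda>t. \<Sum>i\<in>F. u i * \<psi> i t)"
  have fL: "f \<in> L2 m" unfolding f_def using F(2) \<phi> by (intro L2_sum L2_scale) auto
  have hL: "h \<in> L2 m" unfolding h_def using F(2) \<psi> by (intro L2_sum L2_scale) auto
  have \<phi>h: "L2_inner m (\<phi> i) h = (if i \<in> F then cnj (u i) else 0)" if i: "i \<in> I" for i
  proof -
    have "L2_inner m (\<phi> i) h = (\<Sum>j\<in>F. cnj (u j) * L2_inner m (\<phi> i) (\<psi> j))"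
      unfolding h_def using F \<psi> \<phi>[OF i] by (intro L2_inner_sum_right) auto
    also have "\<dots> = (\<Sum>j\<in>F. if j = i then cnj (u j) else 0)"
      using F(2) biorth[OF i] by (intro sum.cong) auto
    also have "\<dots> = (if i \<in> F then cnj (u i) else 0)" using F(1) by simp
    finally show ?thesis .
  qed
  have "L2_inner m f h = (\<Sum>i\<in>F. u i * L2_inner m (\<phi> i) h)"
    unfolding f_def using F \<phi> hL by (intro L2_inner_sum_left) auto
  also have "\<dots> = (\<Sum>i\<in>F. complex_of_real ((cmod (u i))\<^sup>2))"
    using F(2) \<phi>h by (intro sum.cong) (auto simp: complex_norm_square simp del: of_real_power)
  also have "\<dots> = of_real s" by (simp add: s_def)
  finally have fh: "L2_inner m f h = of_real s" .
  have "cmod (L2_inner m h (\<phi> i)) = cmod (L2_inner m (\<phi> i) h)" for i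
    by (subst L2_inner_cnj) simp
  then have "(\<Sum>\<^sub>\<infinity>i\<in>I. (cmod (L2_inner m h (\<phi> i)))\<^sup>2) = (\<Sum>\<^sub>\<infinity>i\<in>F. (cmod (u i))\<^sup>2)"
    using F(2) \<phi>h by (intro infsum_cong_neutral) auto
  also have "\<dots> = s" using F(1) by (simp add: s_def)
  finally have h_le: "a * sq_norm m h \<le> s" using lower[OF hL] by simp
  have s0: "s \<ge> 0" by (simp add: s_def sum_nonneg)
  have "s\<^sup>2 \<le> sq_norm m f * sq_norm m h" using L2_cauchy_schwarz[OF fL hL] fh s0 by simp
  then have "a * s\<^sup>2 \<le> sq_norm m f * (a * sq_norm m h)"
    using a by (simp add: mult.left_commute)
  also have "\<dots> \<le> sq_norm m f * s" using h_le by (intro mult_left_mono) auto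
  finally have "(a * s) * s \<le> sq_norm m f * s" by (simp add: power2_eq_square mult.assoc)
  then have "a * s \<le> sq_norm m f"
    using s0 by (cases "s = 0") (auto simp: mult_le_cancel_right)
  then show ?thesis by (simp add: s_def f_def)
qed

section \<open>Counting the points in a box\<close>

context expansive_haar
begin

text \<open>The functions \<open>\<pi>(\<mu>) 1\<^sub>H\<close>, with \<open>\<mu>\<close> in the box, span a space of dimension \<open>q\<^sup>2\<^sup>n\<close>. Its vectors
  orthogonal to all \<open>\<pi>(\<lambda>) \<phi>\<close>, for the \<open>N\<close> points \<open>\<lambda>\<close> of \<open>\<Lambda>\<close> in the box, form a subspace of dimension
  at least \<open>q\<^sup>2\<^sup>n - N\<close>, in which the frame inequality only involves the points outside the box. As the
  boxes are cosets of subgroups, these points lie outside \<open>\<mu> + Q k\<close> for every \<open>\<mu>\<close>, so by \<open>gabor_tail\<close>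
  they contribute at most \<open>e q\<^sup>2\<^sup>n\<close> to the trace of the frame inequality over that subspace.\<close>
lemma frame_count:
  assumes sep: "uniformly_separated A H \<Lambda>" and \<phi>: "\<phi> \<in> L2 m" and a: "a > 0"
    and summable: "\<And>f. f \<in> L2 m \<Longrightarrow> (\<lambda>l. (cmod (L2_inner m f (gabor \<phi> l)))\<^sup>2) summable_on \<Lambda>"
    and lower: "\<And>f. f \<in> L2 m \<Longrightarrow>
      a * sq_norm m f \<le> (\<Sum>\<^sub>\<infinity>l\<in>\<Lambda>. (cmod (L2_inner m f (gabor \<phi> l)))\<^sup>2)"
    and e: "e > 0"
  shows "\<exists>k::nat. \<forall>n p. k \<le> n \<longrightarrow>
     a * (real (q ^ (2 * n)) - real (card {l \<in> \<Lambda>. l - p \<in> Q (int n)})) \<le> e * real (q ^ (2 * n))"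
proof -
  obtain k :: nat where tail: "\<And>\<mu> F. finite F \<Longrightarrow> F \<subseteq> {l \<in> \<Lambda>. l - \<mu> \<notin> Q (int k)} \<Longrightarrow>
     (\<Sum>l\<in>F. (cmod (L2_inner m (gabor window \<mu>) (gabor \<phi> l)))\<^sup>2) \<le> e"
    using gabor_tail[OF sep \<phi> e] by blast
  show ?thesis
  proof (intro exI[of _ k] allI impI)
    fix n p assume kn: "k \<le> n"
    define J where "J = {l \<in> \<Lambda>. l - p \<in> Q (int n)}"
    have J: "finite J" unfolding J_def by (rule separated_finite[OF sep])
    obtain R S T where R: "transversal (K (int n)) (K 0) R" and S: "transversal (K (- 0)) (K (- int n)) S"
      and T: "transversal (Q (int n)) (Q 0) T" "finite T" "card T = card R * card S"
      using transversal_Q_exists[of "int n" 0] by blast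
    have card_T: "card T = q ^ (2 * n)"
      using card_transversal_K[OF R] card_transversal_K[OF S] T(3)
      by (simp add: mult_2 power_add)
    define I where "I = (+) p ` T"
    have I: "finite I" "card I = q ^ (2 * n)"
      using T(2) card_T by (simp_all add: I_def card_image)
    have I_Q: "i - p \<in> Q (int n)" if "i \<in> I" for i
      using that transversal_subset[OF T(1)] by (auto simp: I_def)
    have I_sep: "i = j" if "i \<in> I" "j \<in> I" "i - j \<in> Q 0" for i j
      using that transversal_eqI[OF T(1) subgroup_Q] unfolding I_def by fastforce
    define b where "b i l = L2_inner m (gabor window i) (gabor \<phi> l)" for i l
    obtain u where u1: "\<And>j. j < card I - card J \<Longrightarrow> (\<Sum>i\<in>I. (cmod (u j i))\<^sup>2) = 1"
      and u2: "\<And>j l. j < card I - card J \<Longrightarrow> l \<in> J \<Longrightarrow> (\<Sum>i\<in>I. u j i * b i l) = 0"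
      and u3: "\<And>w. (\<Sum>j<card I - card J. (cmod (\<Sum>i\<in>I. u j i * w i))\<^sup>2) \<le> (\<Sum>i\<in>I. (cmod (w i))\<^sup>2)"
      using orthonormal_kernel_family[OF I(1) J, of b] by blast
    define r where "r = card I - card J"
    define f where "f j = (\<lambda>t. \<Sum>i\<in>I. u j i * gabor window i t)" for j
    have gL: "gabor window i \<in> L2 m" for i by (intro gabor_L2 window_L2)
    have fL: "f j \<in> L2 m" for j unfolding f_def by (intro L2_sum L2_scale gL)
    have f\<phi>: "L2_inner m (f j) (gabor \<phi> l) = (\<Sum>i\<in>I. u j i * b i l)" for j l
      unfolding f_def b_def by (intro L2_inner_sum_left I(1) gL gabor_L2 \<phi>)
    have f_norm: "sq_norm m (f j) = 1" if "j < r" for j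
    proof -
      have g_f: "L2_inner m (gabor window i) (f j) = cnj (u j i)" if "i \<in> I" for i
      proof -
        have "L2_inner m (gabor window i) (f j)
            = (\<Sum>i'\<in>I. cnj (u j i') * L2_inner m (gabor window i) (gabor window i'))"
          unfolding f_def by (intro L2_inner_sum_right I(1) gL)
        also have "\<dots> = (\<Sum>i'\<in>I. if i' = i then cnj (u j i') else 0)"
          using window_gabor_orthonormal[of I, OF I_sep that] by (intro sum.cong) auto
        finally show ?thesis using I(1) that by simp
      qed
      have "L2_inner m (f j) (f j) = (\<Sum>i\<in>I. u j i * L2_inner m (gabor window i) (f j))"
        by (subst f_def) (intro L2_inner_sum_left I(1) gL fL)
      also have "\<dots> = (\<Sum>i\<in>I. complex_of_real ((cmod (u j i))\<^sup>2))"
        using g_f by (intro sum.cong) (auto simp: complex_norm_square simp del: of_real_power)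
      also have "\<dots> = of_real (\<Sum>i\<in>I. (cmod (u j i))\<^sup>2)" by simp
      finally show ?thesis
        using u1[of j] that unfolding L2_inner_self r_def by (simp only: of_real_eq_iff)
    qed
    have "a * real r = (\<Sum>j<r. a * sq_norm m (f j))" using f_norm by simp
    also have "\<dots> \<le> (\<Sum>j<r. \<Sum>\<^sub>\<infinity>l\<in>\<Lambda>. (cmod (L2_inner m (f j) (gabor \<phi> l)))\<^sup>2)"
      by (intro sum_mono lower fL)
    also have "\<dots> \<le> e * real (card I)"
    proof (rule sum_infsum_le_finite_sums)
      fix F assume F: "finite F" "F \<subseteq> \<Lambda>"
      have "(\<Sum>j<r. \<Sum>l\<in>F. (cmod (L2_inner m (f j) (gabor \<phi> l)))\<^sup>2)
          = (\<Sum>j<r. \<Sum>l\<in>F - J. (cmod (\<Sum>i\<in>I. u j i * b i l))\<^sup>2)"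
        using F(1) u2 unfolding f\<phi> r_def by (intro sum.cong refl sum.mono_neutral_right) auto
      also have "\<dots> = (\<Sum>l\<in>F - J. \<Sum>j<r. (cmod (\<Sum>i\<in>I. u j i * b i l))\<^sup>2)" by (rule sum.swap)
      also have "\<dots> \<le> (\<Sum>l\<in>F - J. \<Sum>i\<in>I. (cmod (b i l))\<^sup>2)"
        unfolding r_def by (intro sum_mono u3)
      also have "\<dots> = (\<Sum>i\<in>I. \<Sum>l\<in>F - J. (cmod (b i l))\<^sup>2)" by (rule sum.swap)
      also have "\<dots> \<le> (\<Sum>i\<in>I. e)"
        unfolding b_def
      proof (intro sum_mono tail)
        show "finite (F - J)" using F(1) by simp
        fix i assume i: "i \<in> I"
        show "F - J \<subseteq> {l \<in> \<Lambda>. l - i \<notin> Q (int k)}"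
        proof
          fix l assume l: "l \<in> F - J"
          have "l - i \<notin> Q (int k)"
          proof
            assume "l - i \<in> Q (int k)"
            then have "l - i \<in> Q (int n)" using Q_mono[of "int k" "int n"] kn by auto
            from add_subgroup_add[OF subgroup_Q this I_Q[OF i]] have "l - p \<in> Q (int n)" by simp
            with l F(2) show False unfolding J_def by blast
          qed
          with l F(2) show "l \<in> {l \<in> \<Lambda>. l - i \<notin> Q (int k)}" by blast
        qed
      qed
      also have "\<dots> = e * real (card I)" by simp
      finally show "(\<Sum>j<r. \<Sum>l\<in>F. (cmod (L2_inner m (f j) (gabor \<phi> l)))\<^sup>2) \<le> e * real (card I)" .
    qed (use summable fL in auto)
    finally have "a * real r \<le> e * real (card I)" .
    moreover have "a * (real (card I) - real (card J)) \<le> a * real r"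
      using a by (intro mult_left_mono) (simp_all add: r_def of_nat_diff_real)
    ultimately show "a * (real (q ^ (2 * n)) - real (card {l \<in> \<Lambda>. l - p \<in> Q (int n)}))
        \<le> e * real (q ^ (2 * n))"
      unfolding I(2) J_def by (rule order_trans[rotated])
  qed
qed

text \<open>The mirror image of the preceding argument: \<open>\<pi>(\<lambda>) \<phi>\<close> is close to \<open>\<pi>(\<lambda>) v\<close> with a step
  function \<open>v\<close>, and for \<open>\<lambda>\<close> in the box all \<open>\<pi>(\<lambda>) v\<close> lie in one space of dimension \<open>q\<^sup>2\<^sup>n\<close>. The
  coefficient vectors \<open>u\<close> with \<open>\<Sum> u\<^sub>\<lambda> \<pi>(\<lambda>) v = 0\<close> form a space of dimension at least \<open>N - q\<^sup>2\<^sup>n\<close>, on which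
  the lower Riesz bound only involves the small functions \<open>\<pi>(\<lambda>) (\<phi> - v)\<close>.\<close>
lemma riesz_count:
  assumes sep: "uniformly_separated A H \<Lambda>" and \<phi>: "\<phi> \<in> L2 m" and a: "a > 0"
    and lower: "\<And>F u. finite F \<Longrightarrow> F \<subseteq> \<Lambda> \<Longrightarrow>
      a * (\<Sum>l\<in>F. (cmod (u l))\<^sup>2) \<le> sq_norm m (\<lambda>t. \<Sum>l\<in>F. u l * gabor \<phi> l t)"
    and e: "e > 0"
  shows "\<exists>k::nat. \<forall>n p. k \<le> n \<longrightarrow>
     a * (real (card {l \<in> \<Lambda>. l - p \<in> Q (int n)}) - real (q ^ (2 * n)))
       \<le> e * real (card {l \<in> \<Lambda>. l - p \<in> Q (int n)})"
proof -
  obtain k v where v: "step_function k v" and v_close: "sq_norm m (\<lambda>t. \<phi> t - v t) < e"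
    using L2_approximable[OF \<phi>] e unfolding approximable_def by blast
  define g where "g = (\<lambda>t. \<phi> t - v t)"
  have gL: "g \<in> L2 m" unfolding g_def by (intro L2_diff \<phi> step_function_L2[OF v])
  show ?thesis
  proof (intro exI[of _ k] allI impI)
    fix n p assume kn: "k \<le> n"
    define I where "I = {l \<in> \<Lambda>. l - p \<in> Q (int n)}"
    have I: "finite I" unfolding I_def by (rule separated_finite[OF sep])
    obtain R where R: "transversal (K (int n)) (K (- int n)) R"
      using transversal_exists[OF subgroup_K subgroup_K] .
    define J where "J = (+) (fst p) ` R"
    have card_J: "card J = q ^ (2 * n)"
    proof -
      have "nat (int n - - int n) = 2 * n" by simp
      then show ?thesis
        using card_transversal_K[OF R] by (simp only: J_def) (simp add: card_image)
    qed
    have J: "finite J" using transversal_K_finite[OF R] by (simp add: J_def)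
    define r where "r = card I - card J"
    obtain u where u1: "\<And>j. j < r \<Longrightarrow> (\<Sum>l\<in>I. (cmod (u j l))\<^sup>2) = 1"
      and u2: "\<And>j t. j < r \<Longrightarrow> t \<in> J \<Longrightarrow> (\<Sum>l\<in>I. u j l * gabor v l t) = 0"
      and u3: "\<And>w. (\<Sum>j<r. (cmod (\<Sum>l\<in>I. u j l * w l))\<^sup>2) \<le> (\<Sum>l\<in>I. (cmod (w l))\<^sup>2)"
      using orthonormal_kernel_family[OF I J, of "gabor v"] unfolding r_def by blast
    \<comment> \<open>All terms vanish unless \<open>t\<close> lies in the coset of \<open>K n\<close>, and translating \<open>t\<close> by an element of
      \<open>K (- n)\<close> multiplies all terms by the same phase; so it suffices to know this for \<open>t \<in> J\<close>.\<close>
    have v_zero: "(\<Sum>l\<in>I. u j l * gabor v l t) = 0" if j: "j < r" for j t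
    proof (cases "t - fst p \<in> K (int n)")
      case False
      have "gabor v l t = 0" if "l \<in> I" for l
      proof -
        have l: "fst l - fst p \<in> K (int n)" using that by (auto simp: I_def Q_def mem_Times_iff)
        have "t - fst l \<notin> K (int k)"
        proof
          assume "t - fst l \<in> K (int k)"
          then have "t - fst l \<in> K (int n)" using K_mono[of "int k" "int n"] kn by auto
          from add_subgroup_add[OF subgroup_K this l] False show False by simp
        qed
        then show ?thesis using v unfolding step_function_def gabor_apply by auto
      qed
      then show ?thesis by simp
    next
      case True
      then obtain x where x: "x \<in> R" "t - fst p - x \<in> K (- int n)" using transversalE[OF R] by blast
      define s where "s = t - fst p - x"
      have s: "s \<in> K (- int n)" "t = (fst p + x) + s" using x(2) by (simp_all add: s_def)
      have "gabor v l t = pairing s (snd p) * gabor v l (fst p + x)" if "l \<in> I" for l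
      proof -
        have "snd l - snd p \<in> annihilator (K (- int n))"
          using that by (auto simp: I_def Q_def mem_Times_iff)
        then have "pairing s (snd l - snd p) = 1" using s(1) by (simp add: annihilator_def)
        moreover have "pairing s (snd l) = pairing s (snd p) * pairing s (snd l - snd p)"
          using pairing_plus[of s "snd p" "snd l - snd p"] by simp
        moreover have "s \<in> K (- int k)" using s(1) K_mono[of "- int n" "- int k"] kn by auto
        then have "v (fst p + x - fst l + s) = v (fst p + x - fst l)"
          using v unfolding step_function_def by blast
        moreover have "t - fst l = fst p + x - fst l + s" by (simp add: s(2) algebra_simps)
        ultimately have "gabor v l t = pairing t (snd l) * v (fst p + x - fst l)"
          "pairing s (snd l) = pairing s (snd p)"
          by (simp_all only: gabor_apply mult_1_right)
        then show ?thesis by (simp add: gabor_apply s(2) pairing_add_left mult_ac)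
      qed
      then have "(\<Sum>l\<in>I. u j l * gabor v l t)
          = pairing s (snd p) * (\<Sum>l\<in>I. u j l * gabor v l (fst p + x))"
        by (simp add: sum_distrib_left mult.left_commute)
      also have "(\<Sum>l\<in>I. u j l * gabor v l (fst p + x)) = 0"
        using x(1) by (intro u2[OF j]) (simp add: J_def)
      finally show ?thesis by simp
    qed
    have "a * real r = (\<Sum>j<r. a * (\<Sum>l\<in>I. (cmod (u j l))\<^sup>2))" using u1 by simp
    also have "\<dots> \<le> (\<Sum>j<r. sq_norm m (\<lambda>t. \<Sum>l\<in>I. u j l * gabor \<phi> l t))"
      by (intro sum_mono lower I) (auto simp: I_def)
    also have "\<dots> = (\<Sum>j<r. sq_norm m (\<lambda>t. \<Sum>l\<in>I. u j l * gabor g l t))"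
    proof (rule sum.cong[OF refl])
      fix j assume "j \<in> {..<r}"
      then have "(\<Sum>l\<in>I. u j l * gabor \<phi> l t) = (\<Sum>l\<in>I. u j l * gabor g l t)" for t
        using v_zero[of j t]
        by (simp add: g_def gabor_diff[symmetric] right_diff_distrib sum_subtractf)
      then show "sq_norm m (\<lambda>t. \<Sum>l\<in>I. u j l * gabor \<phi> l t) = sq_norm m (\<lambda>t. \<Sum>l\<in>I. u j l * gabor g l t)"
        by simp
    qed
    also have "\<dots> = (LINT t|m. (\<Sum>j<r. (cmod (\<Sum>l\<in>I. u j l * gabor g l t))\<^sup>2))"
      by (intro Bochner_Integration.integral_sum[symmetric] L2_square_integrable L2_sum L2_scale gabor_L2 gL)
    also have "\<dots> \<le> (LINT t|m. (\<Sum>l\<in>I. (cmod (gabor g l t))\<^sup>2))"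
      by (intro integral_mono u3 Bochner_Integration.integrable_sum L2_square_integrable L2_sum
          L2_scale gabor_L2 gL)
    also have "\<dots> = (\<Sum>l\<in>I. sq_norm m (gabor g l))"
      by (intro Bochner_Integration.integral_sum L2_square_integrable gabor_L2 gL)
    also have "\<dots> = real (card I) * sq_norm m g" by (simp add: sq_norm_gabor[OF gL])
    also have "\<dots> \<le> real (card I) * e" using v_close by (intro mult_left_mono) (simp_all add: g_def)
    finally have "a * real r \<le> e * real (card I)" by (simp add: mult.commute)
    moreover have "a * (real (card I) - real (card J)) \<le> a * real r"
      using a by (intro mult_left_mono) (simp_all add: r_def of_nat_diff_real)
    ultimately show "a * (real (card {l \<in> \<Lambda>. l - p \<in> Q (int n)}) - real (q ^ (2 * n)))
       \<le> e * real (card {l \<in> \<Lambda>. l - p \<in> Q (int n)})"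
      unfolding card_J I_def by (rule order_trans[rotated])
  qed
qed

lemma num_points_box:
  assumes "uniformly_separated A H \<Lambda>"
  shows "num_points (\<Lambda> \<inter> box_Q A H (int n) p) = ennreal (card {l \<in> \<Lambda>. l - p \<in> Q (int n)})"
proof -
  have "\<Lambda> \<inter> box_Q A H (int n) p = {l \<in> \<Lambda>. l - p \<in> Q (int n)}" by (auto simp: box_Q_iff)
  then show ?thesis
    using separated_finite[OF assms] by (simp add: num_points_finite ennreal_of_nat_eq_real_of_nat)
qed

lemma lower_density_ge_1:
  assumes sep: "uniformly_separated A H \<Lambda>" and \<phi>: "\<phi> \<in> L2 m" and frame: "L2_frame m \<Lambda> (gabor \<phi>)"
  shows "lower_density m A H \<Lambda> \<ge> 1"
proof (rule ennreal_le_epsilon)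
  fix d :: real assume d: "d > 0"
  obtain a where a: "a > 0" and summable: "\<And>f. f \<in> L2 m \<Longrightarrow>
      (\<lambda>l. (cmod (L2_inner m f (gabor \<phi> l)))\<^sup>2) summable_on \<Lambda>"
    and lower: "\<And>f. f \<in> L2 m \<Longrightarrow>
      a * sq_norm m f \<le> (\<Sum>\<^sub>\<infinity>l\<in>\<Lambda>. (cmod (L2_inner m f (gabor \<phi> l)))\<^sup>2)"
    using L2_frame_lower_bound[OF frame] by blast
  have ad: "a * d > 0" using a d by simp
  obtain k :: nat where k: "\<And>n p. k \<le> n \<Longrightarrow>
     a * (real (q ^ (2 * n)) - real (card {l \<in> \<Lambda>. l - p \<in> Q (int n)})) \<le> a * d * real (q ^ (2 * n))"
    using frame_count[OF sep \<phi> a summable lower ad] by blast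
  have "ennreal (1 - d) \<le> lower_density m A H \<Lambda>"
    unfolding lower_density_def
  proof (rule Liminf_bounded)
    show "\<forall>\<^sub>F n in sequentially. ennreal (1 - d)
        \<le> (INF p. num_points (\<Lambda> \<inter> box_Q A H (int n) p)) / ennreal (modulus m A ^ (2 * n))"
      unfolding eventually_sequentially
    proof (intro exI[of _ k] allI impI)
      fix n assume n: "k \<le> n"
      define D where "D = real (q ^ (2 * n))"
      have D: "D > 0" using q_pos by (simp add: D_def)
      have "ennreal ((1 - d) * D) \<le> (INF p. num_points (\<Lambda> \<inter> box_Q A H (int n) p))"
      proof (rule INF_greatest)
        fix p
        let ?N = "real (card {l \<in> \<Lambda>. l - p \<in> Q (int n)})"
        have "a * (D - ?N) \<le> a * (d * D)" using k[OF n, of p] by (simp add: D_def mult.assoc)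
        then have "D - ?N \<le> d * D" using a by simp
        then have "(1 - d) * D \<le> ?N" by (simp add: left_diff_distrib)
        then show "ennreal ((1 - d) * D) \<le> num_points (\<Lambda> \<inter> box_Q A H (int n) p)"
          by (simp add: num_points_box[OF sep] ennreal_leI)
      qed
      then have "ennreal ((1 - d) * D) / ennreal D
          \<le> (INF p. num_points (\<Lambda> \<inter> box_Q A H (int n) p)) / ennreal D"
        by (rule divide_right_mono_ennreal)
      moreover have "ennreal (1 - d) \<le> ennreal ((1 - d) * D) / ennreal D"
        using D by (cases "1 - d \<ge> 0") (simp_all add: divide_ennreal ennreal_neg)
      ultimately have "ennreal (1 - d) \<le> (INF p. num_points (\<Lambda> \<inter> box_Q A H (int n) p)) / ennreal D"
        by (rule order_trans[rotated])
      then show "ennreal (1 - d)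
          \<le> (INF p. num_points (\<Lambda> \<inter> box_Q A H (int n) p)) / ennreal (modulus m A ^ (2 * n))"
        unfolding modulus_eq by (simp add: D_def)
    qed
  qed
  moreover have "1 \<le> ennreal (1 - d) + ennreal d"
    using d by (cases "1 - d \<ge> 0") (simp_all add: ennreal_plus[symmetric] ennreal_neg del: ennreal_plus)
  ultimately show "1 \<le> lower_density m A H \<Lambda> + ennreal d"
    by (meson add_right_mono order_trans)
qed

lemma upper_density_le_1:
  assumes sep: "uniformly_separated A H \<Lambda>" and \<phi>: "\<phi> \<in> L2 m"
    and riesz: "L2_riesz_basis m \<Lambda> (gabor \<phi>)"
  shows "upper_density m A H \<Lambda> \<le> 1"
proof (rule ennreal_le_epsilon)
  fix d :: real assume d: "d > 0"
  have frame: "L2_frame m \<Lambda> (gabor \<phi>)" using riesz by (simp add: L2_riesz_basis_def)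
  obtain \<psi> where \<psi>: "canonical_dual_frame m \<Lambda> (gabor \<phi>) \<psi>" and biorth: "\<And>i j. i \<in> \<Lambda> \<Longrightarrow> j \<in> \<Lambda> \<Longrightarrow>
      L2_inner m (gabor \<phi> i) (\<psi> j) = (if i = j then 1 else 0)"
    using riesz unfolding L2_riesz_basis_def by blast
  have \<psi>_L2: "\<psi> i \<in> L2 m" if "i \<in> \<Lambda>" for i
    using \<psi> that unfolding canonical_dual_frame_def frame_operator_maps_def by blast
  obtain a where a: "a > 0" and "\<And>f. f \<in> L2 m \<Longrightarrow>
      (\<lambda>l. (cmod (L2_inner m f (gabor \<phi> l)))\<^sup>2) summable_on \<Lambda>"
    and lower: "\<And>f. f \<in> L2 m \<Longrightarrow>
      a * sq_norm m f \<le> (\<Sum>\<^sub>\<infinity>l\<in>\<Lambda>. (cmod (L2_inner m f (gabor \<phi> l)))\<^sup>2)"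
    using L2_frame_lower_bound[OF frame] by blast
  note riesz_lower = riesz_lower_bound[OF a lower gabor_L2[OF \<phi>] \<psi>_L2 biorth]
  \<comment> \<open>the solution of \<open>1 / (1 - c) = 1 + d\<close>\<close>
  define c where "c = d / (1 + d)"
  have ac: "a * c > 0" using a d by (simp add: c_def)
  obtain k :: nat where k: "\<And>n p. k \<le> n \<Longrightarrow>
     a * (real (card {l \<in> \<Lambda>. l - p \<in> Q (int n)}) - real (q ^ (2 * n)))
       \<le> a * c * real (card {l \<in> \<Lambda>. l - p \<in> Q (int n)})"
    using riesz_count[OF sep \<phi> a riesz_lower ac] by blast
  have "upper_density m A H \<Lambda> \<le> ennreal (1 + d)"
    unfolding upper_density_def
  proof (rule Limsup_bounded)
    show "\<forall>\<^sub>F n in sequentially. (SUP p. num_points (\<Lambda> \<inter> box_Q A H (int n) p))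
        / ennreal (modulus m A ^ (2 * n)) \<le> ennreal (1 + d)"
      unfolding eventually_sequentially
    proof (intro exI[of _ k] allI impI)
      fix n assume n: "k \<le> n"
      define D where "D = real (q ^ (2 * n))"
      have D: "D > 0" using q_pos by (simp add: D_def)
      have "(SUP p. num_points (\<Lambda> \<inter> box_Q A H (int n) p)) \<le> ennreal ((1 + d) * D)"
      proof (rule SUP_least)
        fix p
        let ?N = "real (card {l \<in> \<Lambda>. l - p \<in> Q (int n)})"
        have "a * (?N - D) \<le> a * (c * ?N)" using k[OF n, of p] by (simp add: D_def mult.assoc)
        then have "?N - D \<le> c * ?N" using a by simp
        then have "?N \<le> (1 + d) * D" using d by (simp add: c_def field_simps)
        then show "num_points (\<Lambda> \<inter> box_Q A H (int n) p) \<le> ennreal ((1 + d) * D)"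
          by (simp add: num_points_box[OF sep] ennreal_leI)
      qed
      then have "(SUP p. num_points (\<Lambda> \<inter> box_Q A H (int n) p)) / ennreal D
          \<le> ennreal ((1 + d) * D) / ennreal D"
        by (rule divide_right_mono_ennreal)
      also have "\<dots> = ennreal (1 + d)" using D d by (simp add: divide_ennreal)
      finally show "(SUP p. num_points (\<Lambda> \<inter> box_Q A H (int n) p))
        / ennreal (modulus m A ^ (2 * n)) \<le> ennreal (1 + d)"
        unfolding modulus_eq by (simp add: D_def)
    qed
  qed
  then show "upper_density m A H \<Lambda> \<le> 1 + ennreal d" using d by (simp add: ennreal_plus)
qed

lemma lower_density_le_upper_density: "lower_density m A H \<Lambda> \<le> upper_density m A H \<Lambda>"
proof -
  have "lower_density m A H \<Lambda> \<le> limsup (\<lambda>n. (INF p. num_points (\<Lambda> \<inter> box_Q A H (int n) p))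
      / ennreal (modulus m A ^ (2 * n)))"
    unfolding lower_density_def by (rule Liminf_le_Limsup) simp
  also have "\<dots> \<le> upper_density m A H \<Lambda>"
    unfolding upper_density_def
    by (intro Limsup_mono always_eventually allI divide_right_mono_ennreal INF_le_SUP) simp
  finally show ?thesis .
qed

end

section \<open>The density theorem\<close>

theorem corollary5p1p6:
  fixes H :: "'a::{t2_space, topological_ab_group_add} set"
    and A :: "'a \<Rightarrow> 'a"
    and m :: "'a measure"
    and \<Lambda> :: "('a \<times> 'a dual) set"
    and \<phi> :: "'a \<Rightarrow> complex"
  assumes "locally_compact_space (euclidean :: 'a topology)"
    and "add_subgroup H" and "compact H" and "open H"
    and "top_automorphism A"
    and "expansive A H"
    and "expansive (dual_adjoint A) (annihilator H)"
    and "haar_measure m" and "emeasure m H = 1"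
    and "uniformly_separated A H \<Lambda>"
    and "\<phi> \<in> L2 m"
  shows "(L2_frame m \<Lambda> (gabor \<phi>) \<longrightarrow> lower_density m A H \<Lambda> \<ge> 1) \<and>
         (L2_riesz_basis m \<Lambda> (gabor \<phi>) \<longrightarrow>
            lower_density m A H \<Lambda> = 1 \<and> upper_density m A H \<Lambda> = 1)"
proof -
  interpret expansive_haar H A m
    using assms by unfold_locales
  have lower: "lower_density m A H \<Lambda> \<ge> 1" if "L2_frame m \<Lambda> (gabor \<phi>)"
    using lower_density_ge_1 assms that by blast
  have "lower_density m A H \<Lambda> = 1 \<and> upper_density m A H \<Lambda> = 1" if riesz: "L2_riesz_basis m \<Lambda> (gabor \<phi>)"
  proof -
    have "L2_frame m \<Lambda> (gabor \<phi>)" using riesz by (simp add: L2_riesz_basis_def)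
    then have "1 \<le> lower_density m A H \<Lambda>" by (rule lower)
    moreover have "upper_density m A H \<Lambda> \<le> 1" using upper_density_le_1 assms riesz by blast
    moreover have "lower_density m A H \<Lambda> \<le> upper_density m A H \<Lambda>"
      by (rule lower_density_le_upper_density)
    ultimately show ?thesis
      using order_trans[of 1 "lower_density m A H \<Lambda>" "upper_density m A H \<Lambda>"]
        order_trans[of "lower_density m A H \<Lambda>" "upper_density m A H \<Lambda>" 1]
      by (simp add: antisym)
  qed
  with lower show ?thesis by blast
qed

end
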